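(* Let $\mathcal N$ be a single-qubit quantum channel that has a unique fixed point and satisfies $c(\mathcal N)<\frac1{48}$. There is a constant $C>0$, depending only on $\mathcal N$, such that for every $n\ge2$, every one-dimensional noisy brickwall circuit on $n$ qubits with layers $\Phi_\ell=\mathcal N^{\otimes n}\circ\mathcal U_\ell$ and arbitrary two-qubit gates, every product initial state $\rho_0$, every cut of the chain into a left part $A$ and a right part $B$, and every $\ell\ge0$, the state $\rho_\ell=\Phi_\ell\circ\cdots\circ\Phi_1(\rho_0)$ satisfies $$S_{OE}(\rho_\ell)\le C\log n .$$
   Context: Brickwall circuit: qubits $1,\dots,n$ on a line; $\mathcal U_\ell(\cdot)=U_\ell(\cdot)U_\ell^\dagger$, where $U_\ell$ is a product of two-qubit gates on the disjoint nearest-neighbour pairs $(i,i+1)$ with $i$ odd for odd $\ell$ and $i$ even for even $\ell$ (staggered layers). After each layer the same channel $\mathcal N$ acts on every qubit. A fixed point of $\mathcal N$ is a density matrix $\omega$ with $\mathcal N(\omega)=\omega$. Contraction coefficient: any single-qubit channel can be written $\mathcal N(\cdot)=U\mathcal N'(V^\dagger(\cdot)V)U^\dagger$ with $U,V$ single-qubit unitaries and $\mathcal N'\big(\tfrac12(\mathbb I+\vec v\cdot\vec\sigma)\big)=\tfrac12\big(\mathbb I+(D\vec v+\vec t)\cdot\vec\sigma\big)$, where $D=\mathrm{diag}(D_X,D_Y,D_Z)$ is real with entries of the same sign, $\vec t=(t_X,t_Y,t_Z)\in\mathbb R^3$, and $\vec\sigma=(X,Y,Z)$ are the Pauli matrices.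 Then $c(\mathcal N)=\frac13(t_X^2+t_Y^2+t_Z^2+D_X^2+D_Y^2+D_Z^2)$. Operator entanglement entropy across $A\mid B$: if $\rho=\sum_\alpha\lambda_\alpha L_\alpha\otimes R_\alpha$ is an operator Schmidt decomposition ($\lambda_\alpha>0$, $\{L_\alpha\}$ on $A$ and $\{R_\alpha\}$ on $B$ Hilbert-Schmidt orthonormal), then $S_{OE}(\rho)=-\sum_\alpha\lambda_\alpha^2\log_2\lambda_\alpha^2$. *)

theory Defs
  imports Complex_Main "Jordan_Normal_Form.Schur_Decomposition"
begin

section \<open>Finite-dimensional quantum mechanics\<close>

definition mat_trace :: "complex mat \<Rightarrow> complex" where
  "mat_trace A = (\<Sum>i<dim_row A. A $$ (i, i))"

definition is_unitary :: "nat \<Rightarrow> complex mat \<Rightarrow> bool" where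
  "is_unitary d U \<longleftrightarrow> U \<in> carrier_mat d d \<and> mat_adjoint U * U = 1\<^sub>m d \<and> U * mat_adjoint U = 1\<^sub>m d"

definition pos_semidef :: "nat \<Rightarrow> complex mat \<Rightarrow> bool" where
  "pos_semidef d A \<longleftrightarrow> A \<in> carrier_mat d d \<and> mat_adjoint A = A \<and>
     (\<forall>v \<in> carrier_vec d. 0 \<le> Re ((A *\<^sub>v v) \<bullet>c v))"

definition density_operator :: "nat \<Rightarrow> complex mat \<Rightarrow> bool" where
  "density_operator d \<rho> \<longleftrightarrow> pos_semidef d \<rho> \<and> mat_trace \<rho> = 1"

text \<open>Kronecker product; the left factor is the most significant part of the index.\<close>

definition kron :: "complex mat \<Rightarrow> complex mat \<Rightarrow> complex mat" where
  "kron A B = mat (dim_row A * dim_row B) (dim_col A * dim_col B)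
     (\<lambda>(i, j). A $$ (i div dim_row B, j div dim_col B) * B $$ (i mod dim_row B, j mod dim_col B))"

definition matrix_unit :: "nat \<Rightarrow> nat \<Rightarrow> nat \<Rightarrow> complex mat" where
  "matrix_unit d i j = mat d d (\<lambda>(a, b). if a = i \<and> b = j then 1 else 0)"

text \<open>Maps on operators are functions on matrices of which only the values on
  \<^term>\<open>carrier_mat d d\<close> matter.\<close>

definition linear_supermap :: "nat \<Rightarrow> (complex mat \<Rightarrow> complex mat) \<Rightarrow> bool" where
  "linear_supermap d F \<longleftrightarrow>
     (\<forall>A \<in> carrier_mat d d. F A \<in> carrier_mat d d) \<and>
     (\<forall>A \<in> carrier_mat d d. \<forall>B \<in> carrier_mat d d. F (A + B) = F A + F B) \<and>
     (\<forall>A \<in> carrier_mat d d. \<forall>c. F (c \<cdot>\<^sub>m A) = c \<cdot>\<^sub>m F A)"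

text \<open>Tensor product of linear maps: the linear extension of
  \<open>kron E E' \<mapsto> kron (F E) (G E')\<close> from pairs of matrix units, written entrywise.\<close>

definition tensor_supermap ::
  "nat \<Rightarrow> nat \<Rightarrow> (complex mat \<Rightarrow> complex mat) \<Rightarrow> (complex mat \<Rightarrow> complex mat) \<Rightarrow> complex mat \<Rightarrow> complex mat"
where
  "tensor_supermap d e F G X = mat (d * e) (d * e) (\<lambda>rc.
     \<Sum>i<d. \<Sum>j<d. \<Sum>k<e. \<Sum>l<e.
       X $$ (i * e + k, j * e + l) * kron (F (matrix_unit d i j)) (G (matrix_unit e k l)) $$ rc)"

definition completely_positive :: "nat \<Rightarrow> (complex mat \<Rightarrow> complex mat) \<Rightarrow> bool" where
  "completely_positive d F \<longleftrightarrow>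
     (\<forall>m X. pos_semidef (m * d) X \<longrightarrow> pos_semidef (m * d) (tensor_supermap m d (\<lambda>A. A) F X))"

definition quantum_channel :: "nat \<Rightarrow> (complex mat \<Rightarrow> complex mat) \<Rightarrow> bool" where
  "quantum_channel d F \<longleftrightarrow> linear_supermap d F \<and> completely_positive d F \<and>
     (\<forall>A \<in> carrier_mat d d. mat_trace (F A) = mat_trace A)"


section \<open>Contraction coefficient of a single-qubit channel\<close>

definition pauli_X :: "complex mat" where "pauli_X = mat_of_rows_list 2 [[0, 1], [1, 0]]"
definition pauli_Y :: "complex mat" where "pauli_Y = mat_of_rows_list 2 [[0, - \<i>], [\<i>, 0]]"
definition pauli_Z :: "complex mat" where "pauli_Z = mat_of_rows_list 2 [[1, 0], [0, - 1]]"

definition bloch :: "real \<Rightarrow> real \<Rightarrow> real \<Rightarrow> complex mat" where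
  "bloch x y z = (1 / 2) \<cdot>\<^sub>m (1\<^sub>m 2 + complex_of_real x \<cdot>\<^sub>m pauli_X
     + complex_of_real y \<cdot>\<^sub>m pauli_Y + complex_of_real z \<cdot>\<^sub>m pauli_Z)"

text \<open>Zero counts as having either sign. The vectors \<^term>\<open>bloch x y z\<close> span all matrices, so the
  linear map \<open>N'\<close> is determined by \<open>D\<close> and \<open>t\<close>.\<close>

definition channel_normal_form ::
  "(complex mat \<Rightarrow> complex mat) \<Rightarrow> complex mat \<Rightarrow> complex mat
     \<Rightarrow> real \<times> real \<times> real \<Rightarrow> real \<times> real \<times> real \<Rightarrow> bool"
where
  "channel_normal_form N U V = (\<lambda>(D\<^sub>X, D\<^sub>Y, D\<^sub>Z) (t\<^sub>X, t\<^sub>Y, t\<^sub>Z).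
     is_unitary 2 U \<and> is_unitary 2 V \<and>
     (0 \<le> D\<^sub>X \<and> 0 \<le> D\<^sub>Y \<and> 0 \<le> D\<^sub>Z \<or> D\<^sub>X \<le> 0 \<and> D\<^sub>Y \<le> 0 \<and> D\<^sub>Z \<le> 0) \<and>
     (\<exists>N'. linear_supermap 2 N' \<and>
        (\<forall>x y z. N' (bloch x y z) = bloch (D\<^sub>X * x + t\<^sub>X) (D\<^sub>Y * y + t\<^sub>Y) (D\<^sub>Z * z + t\<^sub>Z)) \<and>
        (\<forall>A \<in> carrier_mat 2 2. N A = U * N' (mat_adjoint V * A * V) * mat_adjoint U)))"

text \<open>Every single-qubit channel has a normal form, and the value below does not depend on which
  one is taken: unitary conjugations act as rotations of the Bloch vector.\<close>

definition contraction_coeff :: "(complex mat \<Rightarrow> complex mat) \<Rightarrow> real" where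
  "contraction_coeff N = (THE c. \<exists>U V D\<^sub>X D\<^sub>Y D\<^sub>Z t\<^sub>X t\<^sub>Y t\<^sub>Z.
     channel_normal_form N U V (D\<^sub>X, D\<^sub>Y, D\<^sub>Z) (t\<^sub>X, t\<^sub>Y, t\<^sub>Z) \<and>
     c = (t\<^sub>X\<^sup>2 + t\<^sub>Y\<^sup>2 + t\<^sub>Z\<^sup>2 + D\<^sub>X\<^sup>2 + D\<^sub>Y\<^sup>2 + D\<^sub>Z\<^sup>2) / 3)"


section \<open>Noisy brickwall circuits\<close>

text \<open>Qubits are numbered \<open>1, \<dots>, n\<close> from left to right; qubit 1 is the leftmost tensor factor.\<close>

fun product_state :: "nat \<Rightarrow> (nat \<Rightarrow> complex mat) \<Rightarrow> complex mat" where
  "product_state 0 \<sigma> = 1\<^sub>m 1"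
| "product_state (Suc n) \<sigma> = kron (product_state n \<sigma>) (\<sigma> (Suc n))"

fun channel_power :: "(complex mat \<Rightarrow> complex mat) \<Rightarrow> nat \<Rightarrow> complex mat \<Rightarrow> complex mat" where
  "channel_power N 0 = (\<lambda>A. A)"
| "channel_power N (Suc n) = tensor_supermap (2 ^ n) 2 (channel_power N n) N"

definition two_qubit_gate :: "nat \<Rightarrow> nat \<Rightarrow> complex mat \<Rightarrow> complex mat" where
  "two_qubit_gate n i g = kron (kron (1\<^sub>m (2 ^ (i - 1))) g) (1\<^sub>m (2 ^ (n - i - 1)))"

definition brick_positions :: "nat \<Rightarrow> nat \<Rightarrow> nat list" where
  "brick_positions n l = filter (\<lambda>i. odd i \<longleftrightarrow> odd l) [1..<n]"

text \<open>\<^term>\<open>g l i\<close> is the gate on the pair \<open>(i, i + 1)\<close> in layer \<open>l\<close>. The factors have disjoint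
  supports, so their order is immaterial.\<close>

definition layer_unitary :: "nat \<Rightarrow> (nat \<Rightarrow> nat \<Rightarrow> complex mat) \<Rightarrow> nat \<Rightarrow> complex mat" where
  "layer_unitary n g l = foldr (\<lambda>i M. two_qubit_gate n i (g l i) * M) (brick_positions n l) (1\<^sub>m (2 ^ n))"

definition noisy_layer ::
  "(complex mat \<Rightarrow> complex mat) \<Rightarrow> nat \<Rightarrow> (nat \<Rightarrow> nat \<Rightarrow> complex mat) \<Rightarrow> nat \<Rightarrow> complex mat \<Rightarrow> complex mat"
where
  "noisy_layer N n g l \<rho> =
     channel_power N n (layer_unitary n g l * \<rho> * mat_adjoint (layer_unitary n g l))"

fun circuit_state ::
  "(complex mat \<Rightarrow> complex mat) \<Rightarrow> nat \<Rightarrow> (nat \<Rightarrow> nat \<Rightarrow> complex mat) \<Rightarrow> complex mat \<Rightarrow> nat \<Rightarrow> complex mat"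
where
  "circuit_state N n g \<rho>\<^sub>0 0 = \<rho>\<^sub>0"
| "circuit_state N n g \<rho>\<^sub>0 (Suc l) = noisy_layer N n g (Suc l) (circuit_state N n g \<rho>\<^sub>0 l)"


section \<open>Operator entanglement entropy\<close>

definition hs_orthonormal :: "nat \<Rightarrow> nat \<Rightarrow> (nat \<Rightarrow> complex mat) \<Rightarrow> bool" where
  "hs_orthonormal d r L \<longleftrightarrow> (\<forall>a<r. L a \<in> carrier_mat d d) \<and>
     (\<forall>a<r. \<forall>b<r. mat_trace (mat_adjoint (L a) * L b) = (if a = b then 1 else 0))"

definition operator_schmidt_decomp ::
  "nat \<Rightarrow> nat \<Rightarrow> complex mat \<Rightarrow> nat \<Rightarrow> (nat \<Rightarrow> real) \<Rightarrow> (nat \<Rightarrow> complex mat) \<Rightarrow> (nat \<Rightarrow> complex mat) \<Rightarrow> bool"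
where
  "operator_schmidt_decomp d\<^sub>A d\<^sub>B \<rho> r lam L R \<longleftrightarrow>
     (\<forall>a<r. 0 < lam a) \<and> hs_orthonormal d\<^sub>A r L \<and> hs_orthonormal d\<^sub>B r R \<and>
     \<rho> = mat (d\<^sub>A * d\<^sub>B) (d\<^sub>A * d\<^sub>B)
           (\<lambda>ij. \<Sum>a<r. complex_of_real (lam a) * kron (L a) (R a) $$ ij)"

text \<open>The description is well defined: a decomposition exists (singular value decomposition of the
  realigned matrix) and its coefficients are unique up to order. They are not normalised:
  the sum of their squares is the purity of \<open>\<rho>\<close>.\<close>

definition operator_entanglement_entropy :: "nat \<Rightarrow> nat \<Rightarrow> complex mat \<Rightarrow> real" where
  "operator_entanglement_entropy d\<^sub>A d\<^sub>B \<rho> =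
     (THE s. \<exists>r lam L R. operator_schmidt_decomp d\<^sub>A d\<^sub>B \<rho> r lam L R \<and>
        s = - (\<Sum>a<r. (lam a)\<^sup>2 * log 2 ((lam a)\<^sup>2)))"

end

theory Submission
  imports "HOL-Analysis.Analysis" Defs
begin

text \<open>
  The operator Schmidt coefficients are not normalised: their squares sum to the purity \<open>p\<close> of the
  state, and there are at most \<open>4\<^sup>n\<close> of them, so Gibbs' inequality bounds the entropy by
  \<open>2 n p + O(1)\<close>. After at least one layer of noise the purity is exponentially small. Indeed
  \<open>\<Sum>\<^bsub>kl\<^esub> \<parallel>N (E\<^bsub>kl\<^esub>)\<parallel>\<^sup>2 = 1 + 3 c\<close>; removing the trace part of \<open>N\<close>, which contributes \<open>1/2\<close>,
  and treating the qubits one at a time gives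
  \<open>\<parallel>N\<^sup>\<otimes>\<^sup>n (\<psi> \<phi>\<^sup>*)\<parallel>\<^sup>2 \<le> (1/2 + 3 c)\<^sup>n \<parallel>\<psi>\<parallel>\<^sup>2 \<parallel>\<phi>\<parallel>\<^sup>2\<close>, hence \<open>p \<le> (9/16)\<^sup>n\<close> by convexity.
  At depth zero the state is a product across the cut and has Schmidt rank at most one. So the
  entropy is bounded uniformly in \<open>n\<close>.

  Since both the contraction coefficient and the entropy are defined by definite descriptions,
  existence and uniqueness have to be shown: a singular value decomposition in \<open>SO(3)\<close> lifted to
  \<open>SU(2)\<close> for the former, the Schmidt decomposition for the latter.
\<close>


section \<open>Schmidt decompositions over finite index sets\<close>

text \<open>Plain Cauchy-Schwarz on one qubit gives only the factor \<open>1 + 3 c \<ge> 1\<close>,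
  hence no decay. The trace part of \<open>N\<close> is the completely depolarising map, and it
  costs \<open>1/2\<close> times the squared norm of a partial trace. On a general matrix a partial
  trace over one qubit can double the squared Hilbert-Schmidt norm, which would bring the factor
  back above 1; on a rank-one matrix it cannot increase it. Therefore the induction over the qubits
  runs over rank-one inputs with two independent vectors, and states are carried as sums of rank-one
  terms, that is, in Gram form. For \<open>c < 1/48\<close> the factor is below
  \<open>1/2 + 3/48 = 9/16\<close>. Only the last layer of noise is estimated; what precedes it
  merely has to yield a Gram matrix of trace one. The normal form serves to resolve the definite
  description of the coefficient. All estimates use \<open>supermap_norm2\<close>, a sum over matrix
  units that is insensitive to the choice of \<open>U\<close> and \<open>V\<close>.\<close>

definition ip :: "'i set \<Rightarrow> ('i \<Rightarrow> complex) \<Rightarrow> ('i \<Rightarrow> complex) \<Rightarrow> complex" where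
  "ip I u v = (\<Sum>i\<in>I. cnj (u i) * v i)"

definition ortho_family :: "'i set \<Rightarrow> nat \<Rightarrow> (nat \<Rightarrow> 'i \<Rightarrow> complex) \<Rightarrow> bool" where
  "ortho_family I r u \<longleftrightarrow> (\<forall>a<r. \<forall>b<r. ip I (u a) (u b) = (if a = b then 1 else 0))"

text \<open>The index sets are arbitrary because a realigned operator is indexed by pairs. The right
  vectors enter without conjugation, as the factors of \<open>L \<otimes> R\<close> do.\<close>

definition schmidt_decomp ::
  "'i set \<Rightarrow> 'j set \<Rightarrow> ('i \<Rightarrow> 'j \<Rightarrow> complex) \<Rightarrow> nat \<Rightarrow> (nat \<Rightarrow> real) \<Rightarrow> (nat \<Rightarrow> 'i \<Rightarrow> complex)
     \<Rightarrow> (nat \<Rightarrow> 'j \<Rightarrow> complex) \<Rightarrow> bool"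
where
  "schmidt_decomp I J A r lam u v \<longleftrightarrow> (\<forall>a<r. 0 < lam a) \<and> ortho_family I r u \<and> ortho_family J r v \<and>
     (\<forall>i\<in>I. \<forall>j\<in>J. A i j = (\<Sum>a<r. complex_of_real (lam a) * u a i * v a j))"

section \<open>Uniqueness and size of the Schmidt spectrum\<close>

lemma ip_cnj: "cnj (ip I u v) = ip I v u"
  by (simp add: ip_def mult.commute)

lemma ip_self: "ip I u u = complex_of_real (\<Sum>i\<in>I. (cmod (u i))\<^sup>2)"
  unfolding ip_def of_real_sum by (intro sum.cong refl) (simp only: complex_norm_square mult.commute)

lemma ortho_familyD: "ortho_family I r u \<Longrightarrow> a < r \<Longrightarrow> b < r \<Longrightarrow> ip I (u a) (u b) = (if a = b then 1 else 0)"
  by (simp add: ortho_family_def)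

lemma ortho_family_sum_left:
  assumes "ortho_family I r u" "a < r"
  shows "(\<Sum>i\<in>I. cnj (u a i) * (\<Sum>b<r. c b * u b i)) = c a"
proof -
  have "(\<Sum>i\<in>I. cnj (u a i) * (\<Sum>b<r. c b * u b i)) = (\<Sum>b<r. c b * ip I (u a) (u b))"
    unfolding ip_def sum_distrib_left by (subst sum.swap) (simp add: mult_ac)
  also have "\<dots> = (\<Sum>b<r. if b = a then c b else 0)"
    by (intro sum.cong) (use assms in \<open>auto simp: ortho_familyD\<close>)
  finally show ?thesis using assms(2) by simp
qed

lemma bilinear_schmidt_expand:
  assumes "\<And>i j. i \<in> I \<Longrightarrow> j \<in> J \<Longrightarrow> A i j = (\<Sum>a<r. complex_of_real (lam a) * u a i * v a j)"
  shows "(\<Sum>i\<in>I. \<Sum>j\<in>J. x i * A i j * y j)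
    = (\<Sum>a<r. complex_of_real (lam a) * (\<Sum>i\<in>I. x i * u a i) * (\<Sum>j\<in>J. v a j * y j))"
proof -
  have "(\<Sum>i\<in>I. \<Sum>j\<in>J. x i * A i j * y j)
      = (\<Sum>i\<in>I. \<Sum>j\<in>J. \<Sum>a<r. complex_of_real (lam a) * (x i * u a i) * (v a j * y j))"
    by (intro sum.cong refl) (simp add: assms sum_distrib_left sum_distrib_right mult_ac)
  also have "\<dots> = (\<Sum>i\<in>I. \<Sum>a<r. \<Sum>j\<in>J. complex_of_real (lam a) * (x i * u a i) * (v a j * y j))"
    by (intro sum.cong refl sum.swap)
  also have "\<dots> = (\<Sum>a<r. \<Sum>i\<in>I. \<Sum>j\<in>J. complex_of_real (lam a) * (x i * u a i) * (v a j * y j))"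
    by (rule sum.swap)
  finally show ?thesis
    by (simp add: sum_distrib_left sum_distrib_right mult_ac)
qed

text \<open>The singular vector equation; it expresses a left vector through the matrix itself and
  so makes two decompositions of the same matrix comparable.\<close>

lemma schmidt_row_coeff:
  assumes "schmidt_decomp I J A r lam u v" "a < r" "i \<in> I"
  shows "(\<Sum>j\<in>J. A i j * cnj (v a j)) = complex_of_real (lam a) * u a i"
proof -
  have A: "A i j = (\<Sum>b<r. complex_of_real (lam b) * u b i * v b j)" if "j \<in> J" for j
    using assms that by (simp add: schmidt_decomp_def)
  have "(\<Sum>j\<in>J. A i j * cnj (v a j)) = (\<Sum>j\<in>J. cnj (v a j) * (\<Sum>b<r. (complex_of_real (lam b) * u b i) * v b j))"
    by (intro sum.cong refl) (simp add: A mult_ac)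
  also have "\<dots> = complex_of_real (lam a) * u a i"
    by (rule ortho_family_sum_left[where c = "\<lambda>b. complex_of_real (lam b) * u b i"])
       (use assms in \<open>auto simp: schmidt_decomp_def\<close>)
  finally show ?thesis .
qed

text \<open>Each identity evaluates one bilinear form, with a left vector from one family and a
  right vector from the other, in two ways. Chaining them multiplies an overlap by
  \<open>(lam a)\<^sup>2\<close> on one side and by \<open>(mu b)\<^sup>2\<close> on the
  other.\<close>

lemma schmidt_overlaps:
  assumes 1: "schmidt_decomp I J A r lam u v" and 2: "schmidt_decomp I J A r' mu u' v'"
    and a: "a < r" and b: "b < r'"
  shows "complex_of_real (lam a) * ip J (v' b) (v a) = complex_of_real (mu b) * ip I (u a) (u' b)" (is ?A)
    and "complex_of_real (lam a) * ip I (u a) (u' b) = complex_of_real (mu b) * ip J (v' b) (v a)" (is ?B)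
proof -
  have row1: "(\<Sum>i\<in>I. cnj (x i) * (\<Sum>j\<in>J. A i j * cnj (v a j))) = complex_of_real (lam a) * ip I x (u a)" for x
    using schmidt_row_coeff[OF 1 a] by (simp add: ip_def sum_distrib_left mult_ac)
  have row2: "(\<Sum>i\<in>I. cnj (x i) * (\<Sum>j\<in>J. A i j * cnj (v' b j))) = complex_of_real (mu b) * ip I x (u' b)" for x
    using schmidt_row_coeff[OF 2 b] by (simp add: ip_def sum_distrib_left mult_ac)
  have swap: "(\<Sum>i\<in>I. cnj (x i) * (\<Sum>j\<in>J. A i j * cnj (y j))) = (\<Sum>i\<in>I. \<Sum>j\<in>J. cnj (x i) * A i j * cnj (y j))" for x y
    by (simp add: sum_distrib_left mult_ac)
  have col1: "(\<Sum>i\<in>I. \<Sum>j\<in>J. cnj (u a i) * A i j * cnj (y j)) = complex_of_real (lam a) * ip J y (v a)" for y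
  proof -
    have "(\<Sum>i\<in>I. \<Sum>j\<in>J. cnj (u a i) * A i j * cnj (y j))
      = (\<Sum>c<r. complex_of_real (lam c) * (\<Sum>i\<in>I. cnj (u a i) * u c i) * (\<Sum>j\<in>J. v c j * cnj (y j)))"
      by (rule bilinear_schmidt_expand) (use 1 in \<open>auto simp: schmidt_decomp_def\<close>)
    also have "\<dots> = (\<Sum>c<r. if c = a then complex_of_real (lam c) * ip J y (v c) else 0)"
      using 1 a by (intro sum.cong refl)
        (auto simp: ip_def[symmetric] schmidt_decomp_def ortho_family_def, auto simp: ip_def mult_ac)
    finally show ?thesis using a by simp
  qed
  have col2: "(\<Sum>i\<in>I. \<Sum>j\<in>J. cnj (u' b i) * A i j * cnj (y j)) = complex_of_real (mu b) * ip J y (v' b)" for y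
  proof -
    have "(\<Sum>i\<in>I. \<Sum>j\<in>J. cnj (u' b i) * A i j * cnj (y j))
      = (\<Sum>c<r'. complex_of_real (mu c) * (\<Sum>i\<in>I. cnj (u' b i) * u' c i) * (\<Sum>j\<in>J. v' c j * cnj (y j)))"
      by (rule bilinear_schmidt_expand) (use 2 in \<open>auto simp: schmidt_decomp_def\<close>)
    also have "\<dots> = (\<Sum>c<r'. if c = b then complex_of_real (mu c) * ip J y (v' c) else 0)"
      using 2 b by (intro sum.cong refl)
        (auto simp: ip_def[symmetric] schmidt_decomp_def ortho_family_def, auto simp: ip_def mult_ac)
    finally show ?thesis using b by simp
  qed
  show ?A using row2[of "u a"] col1[of "v' b"] swap[of "u a" "v' b"] by simp
  have "complex_of_real (lam a) * ip I (u' b) (u a) = complex_of_real (mu b) * ip J (v a) (v' b)"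
    using row1[of "u' b"] col2[of "v a"] swap[of "u' b" "v a"] by simp
  from arg_cong[OF this, of cnj] show ?B by (simp add: ip_cnj)
qed

text \<open>Since \<open>lam a > 0\<close>, the vector \<open>u a\<close> lies in the range of the
  matrix, which the second left family spans; the claim is then Parseval's identity.\<close>

lemma schmidt_overlap_sum:
  assumes 1: "schmidt_decomp I J A r lam u v" and 2: "schmidt_decomp I J A r' mu u' v'" and a: "a < r"
  shows "(\<Sum>b<r'. (cmod (ip I (u a) (u' b)))\<^sup>2) = 1"
proof -
  have pos: "lam a > 0" using 1 a by (simp add: schmidt_decomp_def)
  have ua: "u a i = (\<Sum>b<r'. ip I (u' b) (u a) * u' b i)" if i: "i \<in> I" for i
  proof -
    have "complex_of_real (lam a) * u a i = (\<Sum>j\<in>J. A i j * cnj (v a j))"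
      using schmidt_row_coeff[OF 1 a i] by simp
    \<comment> \<open>A single row is written as a bilinear form over the index set
      \<open>{i}\<close>, so that the expansion lemma applies to it.\<close>
    also have "\<dots> = (\<Sum>i'\<in>{i}. \<Sum>j\<in>J. 1 * A i' j * cnj (v a j))" by simp
    also have "\<dots> = (\<Sum>b<r'. complex_of_real (mu b) * (\<Sum>i'\<in>{i}. 1 * u' b i') * (\<Sum>j\<in>J. v' b j * cnj (v a j)))"
      by (rule bilinear_schmidt_expand) (use 2 i in \<open>auto simp: schmidt_decomp_def\<close>)
    also have "\<dots> = (\<Sum>b<r'. complex_of_real (lam a) * (ip I (u' b) (u a) * u' b i))"
    proof (intro sum.cong refl)
      fix b assume "b \<in> {..<r'}"
      hence b: "b < r'" by simp
      have "complex_of_real (mu b) * ip J (v a) (v' b) = complex_of_real (lam a) * ip I (u' b) (u a)"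
        using arg_cong[OF schmidt_overlaps(2)[OF 1 2 a b], of cnj] by (simp add: ip_cnj)
      thus "complex_of_real (mu b) * (\<Sum>i'\<in>{i}. 1 * u' b i') * (\<Sum>j\<in>J. v' b j * cnj (v a j))
        = complex_of_real (lam a) * (ip I (u' b) (u a) * u' b i)"
        by (simp add: ip_def mult_ac)
    qed
    also have "\<dots> = complex_of_real (lam a) * (\<Sum>b<r'. ip I (u' b) (u a) * u' b i)"
      by (simp add: sum_distrib_left)
    finally show ?thesis using pos by simp
  qed
  have "ip I (u a) (u a) = (\<Sum>i\<in>I. cnj (u a i) * (\<Sum>b<r'. ip I (u' b) (u a) * u' b i))"
    unfolding ip_def[of I "u a" "u a"] by (intro sum.cong refl) (simp add: ua[symmetric])
  also have "\<dots> = (\<Sum>b<r'. ip I (u' b) (u a) * ip I (u a) (u' b))"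
    unfolding ip_def[of I "u a" "u' _"] sum_distrib_left by (subst sum.swap) (simp add: mult_ac)
  also have "\<dots> = (\<Sum>b<r'. complex_of_real ((cmod (ip I (u a) (u' b)))\<^sup>2))"
    by (intro sum.cong refl) (simp only: complex_norm_square ip_cnj mult.commute)
  finally have "complex_of_real (\<Sum>b<r'. (cmod (ip I (u a) (u' b)))\<^sup>2) = 1"
    using 1 a by (simp add: schmidt_decomp_def ortho_family_def)
  thus ?thesis using of_real_eq_1_iff by blast
qed

text \<open>The squared overlaps of the two families form a doubly stochastic matrix, and coefficients
  with nonzero overlap agree.\<close>

lemma schmidt_spectral_sum_unique:
  assumes 1: "schmidt_decomp I J A r lam u v" and 2: "schmidt_decomp I J A r' mu u' v'"
  shows "(\<Sum>a<r. f (lam a)) = (\<Sum>b<r'. f (mu b) :: real)"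
proof -
  define p where "p a b = (cmod (ip I (u a) (u' b)))\<^sup>2" for a b
  have eq: "p a b * f (lam a) = p a b * f (mu b)" if a: "a < r" and b: "b < r'" for a b
  proof (cases "ip I (u a) (u' b) = 0")
    case False
    let ?c = "ip I (u a) (u' b)" and ?l = "complex_of_real (lam a)" and ?m = "complex_of_real (mu b)"
    have "?l * (?l * ?c) = ?m * (?m * ?c)"
      using schmidt_overlaps[OF 1 2 a b] by (metis mult.left_commute)
    hence "(?l)\<^sup>2 = (?m)\<^sup>2" using False by (simp add: power2_eq_square)
    hence "(lam a)\<^sup>2 = (mu b)\<^sup>2" by (metis of_real_eq_iff of_real_power)
    moreover have "lam a > 0" "mu b > 0" using 1 2 a b by (auto simp: schmidt_decomp_def)
    ultimately have "lam a = mu b" by (simp add: power2_eq_iff_nonneg)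
    thus ?thesis by simp
  qed (simp add: p_def)
  have s1: "(\<Sum>b<r'. p a b) = 1" if "a < r" for a
    using schmidt_overlap_sum[OF 1 2 that] by (simp add: p_def)
  have s2: "(\<Sum>a<r. p a b) = 1" if "b < r'" for b
    using schmidt_overlap_sum[OF 2 1 that] unfolding p_def
    by (metis (no_types, lifting) complex_mod_cnj ip_cnj sum.cong)
  have "(\<Sum>a<r. f (lam a)) = (\<Sum>a<r. \<Sum>b<r'. p a b * f (lam a))"
    by (simp add: sum_distrib_right[symmetric] s1)
  also have "\<dots> = (\<Sum>a<r. \<Sum>b<r'. p a b * f (mu b))" by (simp add: eq)
  also have "\<dots> = (\<Sum>b<r'. \<Sum>a<r. p a b * f (mu b))" by (rule sum.swap)
  also have "\<dots> = (\<Sum>b<r'. f (mu b))" by (simp add: sum_distrib_right[symmetric] s2)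
  finally show ?thesis .
qed

text \<open>Parseval for the matrix as a whole. For a realigned density matrix the right-hand side
  is the purity.\<close>

lemma schmidt_square_sum:
  assumes 1: "schmidt_decomp I J A r lam u v"
  shows "(\<Sum>a<r. (lam a)\<^sup>2) = (\<Sum>i\<in>I. \<Sum>j\<in>J. (cmod (A i j))\<^sup>2)"
proof -
  have A: "A i j = (\<Sum>a<r. complex_of_real (lam a) * u a i * v a j)" if "i \<in> I" "j \<in> J" for i j
    using 1 that by (simp add: schmidt_decomp_def)
  have ou: "ortho_family I r u" using 1 by (simp add: schmidt_decomp_def)
  have "complex_of_real (\<Sum>i\<in>I. \<Sum>j\<in>J. (cmod (A i j))\<^sup>2) = (\<Sum>i\<in>I. \<Sum>j\<in>J. A i j * cnj (A i j))"
    by (simp only: complex_norm_square of_real_sum)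
  also have "\<dots> = (\<Sum>i\<in>I. \<Sum>j\<in>J. \<Sum>a<r. A i j * (complex_of_real (lam a) * cnj (u a i) * cnj (v a j)))"
    by (intro sum.cong refl) (simp add: A[THEN arg_cong[where f = cnj]] sum_distrib_left)
  also have "\<dots> = (\<Sum>i\<in>I. \<Sum>a<r. \<Sum>j\<in>J. A i j * (complex_of_real (lam a) * cnj (u a i) * cnj (v a j)))"
    by (intro sum.cong refl sum.swap)
  also have "\<dots> = (\<Sum>i\<in>I. \<Sum>a<r. complex_of_real (lam a) * cnj (u a i) * (\<Sum>j\<in>J. A i j * cnj (v a j)))"
    by (simp add: sum_distrib_left mult_ac)
  also have "\<dots> = (\<Sum>i\<in>I. \<Sum>a<r. complex_of_real (lam a) * cnj (u a i) * (complex_of_real (lam a) * u a i))"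
    by (intro sum.cong refl) (simp add: schmidt_row_coeff[OF 1])
  also have "\<dots> = (\<Sum>a<r. \<Sum>i\<in>I. complex_of_real (lam a) * cnj (u a i) * (complex_of_real (lam a) * u a i))"
    by (rule sum.swap)
  also have "\<dots> = (\<Sum>a<r. complex_of_real ((lam a)\<^sup>2) * ip I (u a) (u a))"
    by (simp add: ip_def sum_distrib_left power2_eq_square mult_ac)
  also have "\<dots> = complex_of_real (\<Sum>a<r. (lam a)\<^sup>2)"
    using ou by (simp add: ortho_family_def)
  finally show ?thesis using of_real_eq_iff by metis
qed

text \<open>The number \<open>r\<close> is the trace of the projection onto the span of the family,
  and no diagonal entry of a projection exceeds 1.\<close>

lemma ortho_family_le_card:
  assumes o: "ortho_family I r u" and fin: "finite I"
  shows "r \<le> card I"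
proof -
  have b: "(\<Sum>a<r. (cmod (u a i))\<^sup>2) \<le> 1" if i: "i \<in> I" for i
  proof -
    define s where "s = (\<Sum>a<r. (cmod (u a i))\<^sup>2)"
    \<comment> \<open>Column \<open>i\<close> of that projection. Idempotence makes its squared norm
      equal to its own entry \<open>s\<close> at \<open>i\<close>, whence
      \<open>s\<^sup>2 \<le> s\<close>.\<close>
    define w where "w k = (\<Sum>a<r. cnj (u a i) * u a k)" for k
    have s_def': "complex_of_real s = (\<Sum>a<r. cnj (u a i) * u a i)"
      unfolding s_def of_real_sum by (intro sum.cong refl) (simp only: complex_norm_square mult.commute)
    have wi: "w i = complex_of_real s" by (simp add: w_def s_def')
    have "ip I w w = (\<Sum>k\<in>I. \<Sum>a<r. u a i * (cnj (u a k) * w k))"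
      by (simp add: ip_def w_def[THEN arg_cong[where f = cnj]] sum_distrib_left sum_distrib_right mult_ac)
    also have "\<dots> = (\<Sum>a<r. u a i * (\<Sum>k\<in>I. cnj (u a k) * w k))"
      by (subst sum.swap) (simp add: sum_distrib_left)
    also have "\<dots> = (\<Sum>a<r. u a i * cnj (u a i))"
      by (intro sum.cong refl) (simp add: w_def ortho_family_sum_left[OF o])
    also have "\<dots> = complex_of_real s" by (simp add: s_def' mult.commute)
    finally have "complex_of_real (\<Sum>k\<in>I. (cmod (w k))\<^sup>2) = complex_of_real s" by (simp only: ip_self)
    hence "(\<Sum>k\<in>I. (cmod (w k))\<^sup>2) = s" using of_real_eq_iff by blast
    moreover have "(cmod (w i))\<^sup>2 \<le> (\<Sum>k\<in>I. (cmod (w k))\<^sup>2)"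
      using i fin by (intro member_le_sum) auto
    ultimately have "s\<^sup>2 \<le> s" by (simp add: wi)
    hence "s \<le> 1" using mult_strict_left_mono[of 1 s s] by (cases "s \<le> 1") (auto simp: power2_eq_square)
    thus ?thesis by (simp add: s_def)
  qed
  have "real r = (\<Sum>a<r. \<Sum>i\<in>I. (cmod (u a i))\<^sup>2)"
  proof -
    have "(\<Sum>i\<in>I. (cmod (u a i))\<^sup>2) = 1" if "a < r" for a
      using ortho_familyD[OF o that that] ip_self[of I "u a"] by (metis of_real_eq_1_iff)
    thus ?thesis by simp
  qed
  also have "\<dots> = (\<Sum>i\<in>I. \<Sum>a<r. (cmod (u a i))\<^sup>2)" by (rule sum.swap)
  also have "\<dots> \<le> (\<Sum>i\<in>I. 1)" using b by (intro sum_mono) auto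
  finally show ?thesis by simp
qed

section \<open>Existence of Schmidt decompositions by deflation\<close>

text \<open>Tychonoff's theorem: vectors are functions on the whole index type, and demanding zeros
  outside \<open>J\<close> makes the sphere a closed subset of a product of unit discs.\<close>

lemma compact_unit_sphere_fun:
  fixes J :: "'j set"
  assumes fin: "finite J"
  shows "compact {x :: 'j \<Rightarrow> complex. (\<forall>j. j \<notin> J \<longrightarrow> x j = 0) \<and> (\<Sum>j\<in>J. (cmod (x j))\<^sup>2) = 1}" (is "compact ?S")
proof -
  have "compactin (product_topology (\<lambda>_. euclidean) UNIV) (PiE UNIV (\<lambda>_::'j. cball (0::complex) 1))"
    unfolding compactin_PiE by simp
  hence c: "compact (PiE UNIV (\<lambda>_::'j. cball (0::complex) 1))"
    by (simp add: euclidean_product_topology)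
  have cont: "continuous_on UNIV (\<lambda>x::'j \<Rightarrow> complex. x j)" for j
    by (rule continuous_on_product_coordinates)
  have cl1: "closed {x :: 'j \<Rightarrow> complex. x j = 0}" for j
    by (intro closed_Collect_eq cont continuous_on_const)
  have cl2: "closed {x :: 'j \<Rightarrow> complex. (\<Sum>j\<in>J. (cmod (x j))\<^sup>2) = 1}"
    by (intro closed_Collect_eq continuous_intros cont)
  have S: "?S = (\<Inter>j\<in>-J. {x. x j = 0}) \<inter> {x. (\<Sum>j\<in>J. (cmod (x j))\<^sup>2) = 1}" by auto
  have closed: "closed ?S" unfolding S using cl1 cl2 by (intro closed_Int closed_INT) auto
  have "?S \<subseteq> PiE UNIV (\<lambda>_::'j. cball (0::complex) 1)"
  proof
    fix x assume x: "x \<in> ?S"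
    have "cmod (x j) \<le> 1" for j
    proof (cases "j \<in> J")
      case True
      hence "(cmod (x j))\<^sup>2 \<le> (\<Sum>j\<in>J. (cmod (x j))\<^sup>2)" using fin by (intro member_le_sum) auto
      hence "(cmod (x j))\<^sup>2 \<le> 1" using x by simp
      thus ?thesis by (simp add: power_le_one_iff)
    qed (use x in auto)
    thus "x \<in> PiE UNIV (\<lambda>_::'j. cball (0::complex) 1)" by auto
  qed
  hence "?S = PiE UNIV (\<lambda>_::'j. cball (0::complex) 1) \<inter> ?S" by blast
  thus ?thesis using compact_Int_closed[OF c closed] by simp
qed

text \<open>First-order condition at an extremum. The perturbation \<open>e\<close> is complex, so
  the real and the imaginary part of the linear coefficient vanish together.\<close>

lemma quadratic_perturbation_zero:
  fixes w :: complex and K :: real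
  assumes "\<And>e::complex. 2 * Re (e * w) \<le> (cmod e)\<^sup>2 * K"
  shows "w = 0"
proof (rule ccontr)
  assume "w \<noteq> 0"
  hence W: "(cmod w)\<^sup>2 > 0" by simp
  \<comment> \<open>Small enough that \<open>t * K \<le> 1\<close>, whereas the perturbation
    \<open>e = t * cnj w\<close> would force \<open>2 \<le> t * K\<close>.\<close>
  define t where "t = 1 / (\<bar>K\<bar> + 1)"
  have t: "t > 0" by (simp add: t_def add_nonneg_pos)
  have "2 * Re (complex_of_real t * cnj w * w) \<le> (cmod (complex_of_real t * cnj w))\<^sup>2 * K"
    by (rule assms)
  moreover have "Re (complex_of_real t * cnj w * w) = t * (cmod w)\<^sup>2"
    unfolding cmod_power2 by (simp add: power2_eq_square algebra_simps)
  ultimately have "2 * t * (cmod w)\<^sup>2 \<le> t\<^sup>2 * (cmod w)\<^sup>2 * K"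
    by (simp add: norm_mult power_mult_distrib)
  hence "(t * (cmod w)\<^sup>2) * 2 \<le> (t * (cmod w)\<^sup>2) * (t * K)" by (simp add: power2_eq_square algebra_simps)
  hence "2 \<le> t * K" using t W by (simp add: mult_le_cancel_left_pos)
  also have "t * K \<le> 1" unfolding t_def using abs_ge_self[of K] by (simp add: divide_simps)
  finally show False by simp
qed

lemma sum_cmod_square_add:
  fixes x y :: "'i \<Rightarrow> complex"
  shows "(\<Sum>i\<in>I. (cmod (x i + e * y i))\<^sup>2)
    = (\<Sum>i\<in>I. (cmod (x i))\<^sup>2) + 2 * Re (e * ip I x y) + (cmod e)\<^sup>2 * (\<Sum>i\<in>I. (cmod (y i))\<^sup>2)"
proof -
  have "(cmod (a + e * b))\<^sup>2 = (cmod a)\<^sup>2 + 2 * Re (e * (cnj a * b)) + (cmod e)\<^sup>2 * (cmod b)\<^sup>2" for a b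
    unfolding cmod_power2 by (simp add: power2_eq_square algebra_simps)
  thus ?thesis by (simp add: sum.distrib sum_distrib_left ip_def)
qed

text \<open>The pair is found by maximising \<open>\<parallel>B x\<parallel>\<close> over the unit sphere.\<close>

lemma top_singular_pair:
  fixes B :: "'i \<Rightarrow> 'j \<Rightarrow> complex"
  assumes fin: "finite I" "finite J" and nz: "i0 \<in> I" "j0 \<in> J" "B i0 j0 \<noteq> 0"
  shows "\<exists>s u x. 0 < s \<and> ip I u u = 1 \<and> ip J x x = 1 \<and>
     (\<forall>i\<in>I. (\<Sum>j\<in>J. B i j * x j) = complex_of_real s * u i) \<and>
     (\<forall>j\<in>J. (\<Sum>i\<in>I. cnj (u i) * B i j) = complex_of_real s * cnj (x j))"
proof -
  define S where "S = {x :: 'j \<Rightarrow> complex. (\<forall>j. j \<notin> J \<longrightarrow> x j = 0) \<and> (\<Sum>j\<in>J. (cmod (x j))\<^sup>2) = 1}"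
  define Bx where "Bx x i = (\<Sum>j\<in>J. B i j * x j)" for x i
  define f where "f x = (\<Sum>i\<in>I. (cmod (Bx x i))\<^sup>2)" for x
  define nn where "nn x = (\<Sum>j\<in>J. (cmod (x j))\<^sup>2)" for x :: "'j \<Rightarrow> complex"
  have comp: "compact S" unfolding S_def by (rule compact_unit_sphere_fun[OF fin(2)])
  have cont: "continuous_on S f" unfolding f_def Bx_def
    by (intro continuous_intros continuous_on_subset[OF continuous_on_product_coordinates]) auto
  define e where "e k j = (if j = k then 1 else 0 :: complex)" for k j :: 'j
  have eS: "e k \<in> S" if "k \<in> J" for k
  proof -
    have "(\<Sum>j\<in>J. (cmod (e k j))\<^sup>2) = (\<Sum>j\<in>J. if j = k then 1 else 0)"
      by (intro sum.cong) (auto simp: e_def)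
    thus ?thesis using that fin by (auto simp: S_def e_def)
  qed
  have Be: "Bx (e k) i = B i k" if "k \<in> J" for k i
    using that fin by (simp add: Bx_def e_def if_distrib[of "\<lambda>x. _ * x"] cong: if_cong)
  obtain x where x: "x \<in> S" and max: "\<And>y. y \<in> S \<Longrightarrow> f y \<le> f x"
    using continuous_attains_sup[OF comp _ cont] eS[OF nz(2)] by blast
  have "0 < (cmod (B i0 j0))\<^sup>2" using nz by simp
  also have "\<dots> \<le> f (e j0)" unfolding f_def using nz fin
    by (subst Be[symmetric]) (auto intro!: member_le_sum)
  also have "\<dots> \<le> f x" by (rule max[OF eS[OF nz(2)]])
  finally have fpos: "f x > 0" .
  have nnx: "nn x = 1" using x by (simp add: S_def nn_def)
  \<comment> \<open>Homogeneity extends the maximum from the sphere to all vectors, so perturbed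
    vectors need no renormalisation.\<close>
  have bound: "f y \<le> f x * nn y" for y
  proof (cases "nn y = 0")
    case True
    hence "\<forall>j\<in>J. y j = 0" using fin by (simp add: nn_def sum_nonneg_eq_0_iff)
    hence "f y = 0" by (simp add: f_def Bx_def)
    thus ?thesis using True by simp
  next
    case False
    have "nn y \<ge> 0" by (simp add: nn_def sum_nonneg)
    with False have pos: "nn y > 0" by simp
    define c where "c = complex_of_real (1 / sqrt (nn y))"
    have c2: "(cmod c)\<^sup>2 = 1 / nn y" using pos unfolding c_def by (simp add: norm_divide power_divide)
    define z where "z j = (if j \<in> J then c * y j else 0)" for j
    have "nn z = (\<Sum>j\<in>J. (cmod c)\<^sup>2 * (cmod (y j))\<^sup>2)" unfolding nn_def
      by (intro sum.cong refl) (simp add: z_def norm_mult power_mult_distrib)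
    also have "\<dots> = (cmod c)\<^sup>2 * nn y" by (simp add: sum_distrib_left nn_def)
    finally have "z \<in> S" using pos c2 by (simp add: S_def z_def nn_def)
    hence "f z \<le> f x" by (rule max)
    moreover have "f z = (cmod c)\<^sup>2 * f y"
    proof -
      have "Bx z i = c * Bx y i" for i
        by (simp add: Bx_def z_def sum_distrib_left mult_ac)
      thus ?thesis by (simp add: f_def norm_mult power_mult_distrib sum_distrib_left)
    qed
    ultimately show ?thesis using pos c2 by (simp add: field_simps)
  qed
  \<comment> \<open>The inequality \<open>bound\<close> is an equality at \<open>x\<close>.
    Perturbing \<open>x\<close> by \<open>d * y\<close> makes the term linear in \<open>d\<close>
    vanish: the eigenvector equation of \<open>B\<^sup>* B\<close> in weak form.\<close>
  have stat: "ip I (Bx x) (Bx y) = complex_of_real (f x) * ip J x y" for y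
  proof -
    define w where "w = ip I (Bx x) (Bx y) - complex_of_real (f x) * ip J x y"
    have "2 * Re (d * w) \<le> (cmod d)\<^sup>2 * (f x * nn y - f y)" for d
    proof -
      have lin: "Bx (\<lambda>j. x j + d * y j) i = Bx x i + d * Bx y i" for i
        by (simp add: Bx_def sum.distrib sum_distrib_left algebra_simps)
      have "f (\<lambda>j. x j + d * y j) \<le> f x * nn (\<lambda>j. x j + d * y j)" by (rule bound)
      hence "f x + 2 * Re (d * ip I (Bx x) (Bx y)) + (cmod d)\<^sup>2 * f y
        \<le> f x * (nn x + 2 * Re (d * ip J x y) + (cmod d)\<^sup>2 * nn y)"
        unfolding f_def[of "\<lambda>j. x j + d * y j"] lin sum_cmod_square_add
        unfolding nn_def[of "\<lambda>j. x j + d * y j"] sum_cmod_square_add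
        by (simp add: f_def nn_def)
      thus ?thesis unfolding nnx w_def by (simp add: algebra_simps)
    qed
    hence "w = 0" by (rule quadratic_perturbation_zero)
    thus ?thesis by (simp add: w_def)
  qed
  define s where "s = sqrt (f x)"
  have s: "s > 0" "s * s = f x" using fpos by (auto simp: s_def)
  define u where "u i = Bx x i / complex_of_real s" for i
  have su: "complex_of_real s * u i = Bx x i" for i using s by (simp add: u_def)
  have "ip I u u = 1"
  proof -
    have "ip I u u = complex_of_real (\<Sum>i\<in>I. (cmod (u i))\<^sup>2)" by (rule ip_self)
    also have "(\<Sum>i\<in>I. (cmod (u i))\<^sup>2) = (\<Sum>i\<in>I. (cmod (Bx x i))\<^sup>2 / f x)"
      using s by (intro sum.cong refl) (simp add: u_def norm_divide power_divide power2_eq_square)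
    also have "\<dots> = 1" using fpos by (simp add: sum_divide_distrib[symmetric] f_def)
    finally show ?thesis by simp
  qed
  moreover have "ip J x x = 1" using nnx by (simp add: ip_self nn_def)
  \<comment> \<open>Stationarity tested against the coordinate vector \<open>e j\<close> yields the
    equation for the adjoint.\<close>
  moreover have "(\<Sum>i\<in>I. cnj (u i) * B i j) = complex_of_real s * cnj (x j)" if j: "j \<in> J" for j
  proof -
    have "complex_of_real s * (\<Sum>i\<in>I. cnj (u i) * B i j) = (\<Sum>i\<in>I. cnj (complex_of_real s * u i) * B i j)"
      by (simp add: sum_distrib_left mult_ac)
    also have "\<dots> = ip I (Bx x) (Bx (e j))" unfolding su ip_def by (simp add: Be[OF j])
    also have "\<dots> = complex_of_real (f x) * ip J x (e j)" by (rule stat)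
    also have "ip J x (e j) = cnj (x j)"
      using j fin by (simp add: ip_def e_def if_distrib[of "\<lambda>x. _ * x"] cong: if_cong)
    also have "complex_of_real (f x) = complex_of_real s * complex_of_real s"
      by (simp flip: s(2))
    finally show ?thesis using s by simp
  qed
  ultimately show ?thesis using s(1) su unfolding Bx_def[symmetric] by (intro exI[of _ s] exI[of _ u] exI[of _ x]) auto
qed

text \<open>Deflation: take a longest partial decomposition whose remainder is annihilated by all
  vectors chosen so far. A nonzero remainder would supply a top singular pair orthogonal to them and
  extend it. The length is bounded by \<open>card J\<close>.\<close>

lemma schmidt_decomp_exists:
  fixes A :: "'i \<Rightarrow> 'j \<Rightarrow> complex"
  assumes fin: "finite I" "finite J"
  shows "\<exists>r lam u v. schmidt_decomp I J A r lam u v"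
proof -
  define rest where "rest r lam u v i j = A i j - (\<Sum>a<r. complex_of_real (lam a) * u a i * v a j)"
    for r :: nat and lam :: "nat \<Rightarrow> real" and u v i j
  define part where "part r lam u v \<longleftrightarrow> (\<forall>a<r. 0 < lam a) \<and> ortho_family I r u \<and> ortho_family J r v \<and>
     (\<forall>a<r. \<forall>i\<in>I. (\<Sum>j\<in>J. rest r lam u v i j * cnj (v a j)) = 0) \<and>
     (\<forall>a<r. \<forall>j\<in>J. (\<Sum>i\<in>I. cnj (u a i) * rest r lam u v i j) = 0)"
    for r lam u v
  define P where "P r \<longleftrightarrow> (\<exists>lam u v. part r lam u v)" for r
  have P0: "P 0" by (auto simp: P_def part_def ortho_family_def)
  have bnd: "r \<le> card J" if "P r" for r
    using that ortho_family_le_card[OF _ fin(2)] by (auto simp: P_def part_def)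
  define r where "r = (GREATEST r. P r)"
  have Pr: "P r" unfolding r_def by (rule GreatestI_nat[of P, OF P0]) (use bnd in auto)
  have maxr: "\<not> P (Suc r)"
  proof
    assume "P (Suc r)"
    hence "Suc r \<le> r" unfolding r_def by (rule Greatest_le_nat[where b = "card J"]) (use bnd in auto)
    thus False by simp
  qed
  from Pr obtain lam u v where p: "part r lam u v" by (auto simp: P_def)
  define B where "B = rest r lam u v"
  have killv: "(\<Sum>j\<in>J. B i j * cnj (v a j)) = 0" if "a < r" "i \<in> I" for a i
    using p that by (simp add: part_def B_def)
  have killu: "(\<Sum>i\<in>I. cnj (u a i) * B i j) = 0" if "a < r" "j \<in> J" for a j
    using p that by (simp add: part_def B_def)
  have "B i j = 0" if ij: "i \<in> I" "j \<in> J" for i j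
  proof (rule ccontr)
    assume "B i j \<noteq> 0"
    from top_singular_pair[where B = B, OF fin ij this] obtain s u0 x where s: "0 < s" and
      n: "ip I u0 u0 = 1" "ip J x x = 1" and
      Bx: "\<And>i. i \<in> I \<Longrightarrow> (\<Sum>j\<in>J. B i j * x j) = complex_of_real s * u0 i" and
      uB: "\<And>j. j \<in> J \<Longrightarrow> (\<Sum>i\<in>I. cnj (u0 i) * B i j) = complex_of_real s * cnj (x j)" by blast
    \<comment> \<open>The conjugate of the maximiser, because right vectors enter the decomposition
      without conjugation.\<close>
    define v0 where "v0 j = cnj (x j)" for j
    \<comment> \<open>Up to the factor \<open>s > 0\<close>, the new left vector is the remainder
      applied to \<open>x\<close>, and the old left vectors annihilate the remainder.\<close>
    have ou: "ip I (u a) u0 = 0" if a: "a < r" for a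
    proof -
      have "complex_of_real s * ip I (u a) u0 = (\<Sum>i\<in>I. cnj (u a i) * (\<Sum>j\<in>J. B i j * x j))"
        unfolding ip_def by (subst sum_distrib_left, intro sum.cong refl) (simp add: Bx)
      also have "\<dots> = (\<Sum>j\<in>J. (\<Sum>i\<in>I. cnj (u a i) * B i j) * x j)"
        unfolding sum_distrib_left sum_distrib_right by (subst sum.swap) (simp add: mult_ac)
      also have "\<dots> = 0" by (simp add: killu[OF a])
      finally show ?thesis using s by simp
    qed
    have ov: "ip J (v a) v0 = 0" if a: "a < r" for a
    proof -
      have "complex_of_real s * ip J (v a) v0 = (\<Sum>j\<in>J. (\<Sum>i\<in>I. cnj (u0 i) * B i j) * cnj (v a j))"
        unfolding ip_def by (subst sum_distrib_left, intro sum.cong refl) (simp add: uB v0_def)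
      also have "\<dots> = (\<Sum>i\<in>I. cnj (u0 i) * (\<Sum>j\<in>J. B i j * cnj (v a j)))"
        unfolding sum_distrib_left sum_distrib_right by (subst sum.swap) (simp add: mult_ac)
      also have "\<dots> = 0" by (simp add: killv[OF a])
      finally show ?thesis using s by simp
    qed
    have nv0: "ip J v0 v0 = 1" using n(2) by (simp add: ip_def v0_def mult.commute)
    define lam' where "lam' = lam(r := s)"
    define u' where "u' = u(r := u0)"
    define v' where "v' = v(r := v0)"
    have rest': "rest (Suc r) lam' u' v' i j = B i j - complex_of_real s * u0 i * v0 j" for i j
    proof -
      have "(\<Sum>a<r. complex_of_real (lam' a) * u' a i * v' a j) = (\<Sum>a<r. complex_of_real (lam a) * u a i * v a j)"
        by (intro sum.cong refl) (auto simp: lam'_def u'_def v'_def)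
      thus ?thesis by (simp add: rest_def B_def) (simp add: lam'_def u'_def v'_def)
    qed
    have ext: "ortho_family K (Suc r) (w(r := w0))" if o: "ortho_family K r w" and "ip K w0 w0 = 1"
      and z: "\<And>a. a < r \<Longrightarrow> ip K (w a) w0 = 0" for K :: "'k set" and w w0
    proof -
      have "ip K w0 (w a) = 0" if "a < r" for a using z[OF that] by (metis complex_cnj_zero ip_cnj)
      thus ?thesis using that by (auto simp: ortho_family_def less_Suc_eq)
    qed
    have "part (Suc r) lam' u' v'"
    proof -
      have "\<forall>a<Suc r. 0 < lam' a" using p s by (auto simp: part_def lam'_def less_Suc_eq)
      moreover have "ortho_family I (Suc r) u'" unfolding u'_def
        using p n ou by (intro ext) (auto simp: part_def)
      moreover have "ortho_family J (Suc r) v'" unfolding v'_def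
        using p nv0 ov by (intro ext) (auto simp: part_def)
      moreover have "(\<Sum>j\<in>J. rest (Suc r) lam' u' v' i j * cnj (v' a j)) = 0" if a: "a < Suc r" and i: "i \<in> I" for a i
      proof -
        have *: "(\<Sum>j\<in>J. rest (Suc r) lam' u' v' i j * cnj (y j))
          = (\<Sum>j\<in>J. B i j * cnj (y j)) - complex_of_real s * u0 i * ip J y v0" for y
          by (simp add: rest' ip_def sum_subtractf sum_distrib_left algebra_simps)
        show ?thesis
        proof (cases "a = r")
          case True
          thus ?thesis unfolding * using Bx[OF i] nv0 by (simp add: v'_def) (simp add: v0_def)
        next
          case False
          with a have "a < r" by simp
          thus ?thesis unfolding * using killv[OF _ i] ov by (simp add: v'_def)
        qed
      qed
      moreover have "(\<Sum>i\<in>I. cnj (u' a i) * rest (Suc r) lam' u' v' i j) = 0" if a: "a < Suc r" and j: "j \<in> J" for a j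
      proof -
        have *: "(\<Sum>i\<in>I. cnj (y i) * rest (Suc r) lam' u' v' i j)
          = (\<Sum>i\<in>I. cnj (y i) * B i j) - complex_of_real s * v0 j * ip I y u0" for y
          by (simp add: rest' ip_def sum_subtractf sum_distrib_left algebra_simps)
        show ?thesis
        proof (cases "a = r")
          case True
          thus ?thesis unfolding * using uB[OF j] n by (simp add: u'_def) (simp add: v0_def)
        next
          case False
          with a have "a < r" by simp
          thus ?thesis unfolding * using killu[OF _ j] ou by (simp add: u'_def)
        qed
      qed
      ultimately show ?thesis by (simp add: part_def)
    qed
    thus False using maxr by (auto simp: P_def)
  qed
  hence "schmidt_decomp I J A r lam u v"
    using p by (auto simp: schmidt_decomp_def part_def B_def rest_def)
  thus ?thesis by blast
qed

section \<open>Entropy bound for unnormalised weights\<close>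

text \<open>The tangent bound \<open>ln t \<le> t - 1\<close> at \<open>t = q / x\<close>. It holds
  for each weight separately, so nothing has to sum to one.\<close>

lemma neg_x_ln_x_le:
  fixes x q :: real
  assumes "x > 0" "q > 0"
  shows "- x * ln x \<le> - x * ln q + q - x"
proof -
  have "x * ln (q / x) \<le> x * (q / x - 1)"
    using assms by (intro mult_left_mono ln_le_minus_one) auto
  thus ?thesis using assms by (simp add: ln_div algebra_simps)
qed

text \<open>Gibbs' inequality against the uniform weight \<open>4\<^sup>-\<^sup>m\<close>.\<close>

lemma entropy_le_of_square_sum:
  fixes lam :: "nat \<Rightarrow> real"
  assumes pos: "\<And>a. a < r \<Longrightarrow> 0 < lam a" and r: "r \<le> 4 ^ m"
  shows "- (\<Sum>a<r. (lam a)\<^sup>2 * log 2 ((lam a)\<^sup>2)) \<le> 2 * real m * (\<Sum>a<r. (lam a)\<^sup>2) + 2"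
proof -
  define q :: real where "q = 1 / 4 ^ m"
  have q: "q > 0" "ln q = - (2 * real m * ln 2)"
  proof -
    have "ln (4::real) = 2 * ln 2" using ln_realpow[of 2 2] by simp
    thus "ln q = - (2 * real m * ln 2)" by (simp add: q_def ln_div ln_realpow)
  qed (simp add: q_def)
  \<comment> \<open>In base 2 the total reference mass, at most 1, becomes \<open>1 / ln 2\<close>;
    this bounds it by the additive constant 2.\<close>
  have l2: "ln (2::real) \<ge> 1 / 2" using ln_2_less_1 ln_le_minus_one[of "1/2::real"] by (simp add: ln_div)
  have "- (\<Sum>a<r. (lam a)\<^sup>2 * ln ((lam a)\<^sup>2)) = (\<Sum>a<r. - (lam a)\<^sup>2 * ln ((lam a)\<^sup>2))"
    by (simp add: sum_negf)
  also have "\<dots> \<le> (\<Sum>a<r. - (lam a)\<^sup>2 * ln q + q)"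
  proof (intro sum_mono)
    fix a assume "a \<in> {..<r}"
    hence "(lam a)\<^sup>2 > 0" using pos[of a] by simp
    thus "- (lam a)\<^sup>2 * ln ((lam a)\<^sup>2) \<le> - (lam a)\<^sup>2 * ln q + q"
      using neg_x_ln_x_le[of "(lam a)\<^sup>2" q] q(1) by linarith
  qed
  also have "\<dots> = 2 * real m * ln 2 * (\<Sum>a<r. (lam a)\<^sup>2) + real r * q"
    by (simp add: sum.distrib q(2) sum_distrib_left mult_ac)
  also have "real r * q \<le> 1"
  proof -
    have "real r \<le> 4 ^ m" using r of_nat_mono[OF r, where 'a = real] by simp
    thus ?thesis by (simp add: q_def)
  qed
  finally have "- (\<Sum>a<r. (lam a)\<^sup>2 * ln ((lam a)\<^sup>2)) / ln 2 \<le> (2 * real m * ln 2 * (\<Sum>a<r. (lam a)\<^sup>2) + 1) / ln 2"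
    by (intro divide_right_mono) auto
  also have "\<dots> = 2 * real m * (\<Sum>a<r. (lam a)\<^sup>2) + 1 / ln 2" by (simp add: add_divide_distrib)
  also have "1 / ln 2 \<le> (2::real)" using l2 by (simp add: field_simps)
  finally show ?thesis by (simp add: log_def sum_divide_distrib)
qed

section \<open>Singular value decomposition in three dimensions\<close>

lemma orthogonal_unit_vector_exists:
  fixes a :: "real ^ 3"
  shows "\<exists>x. norm x = 1 \<and> inner x a = 0"
proof -
  obtain y where y: "y \<noteq> 0" "Linear_Algebra.orthogonal a y"
    using orthogonal_to_vector_exists[of a] by auto
  hence "norm (y /\<^sub>R norm y) = 1 \<and> inner (y /\<^sub>R norm y) a = 0"
    by (simp add: Linear_Algebra.orthogonal_def inner_commute)
  thus ?thesis by blast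
qed

text \<open>One step of the singular value decomposition, inside the orthogonal complements of \<open>a\<close> and \<open>b\<close>.\<close>

lemma singular_pair_orthogonal:
  fixes f g :: "real ^ 3 \<Rightarrow> real ^ 3"
  assumes lin: "linear f" and adj: "\<And>x y. inner (f y) x = inner y (g x)"
    and fa: "\<And>y. inner y b = 0 \<Longrightarrow> inner (f y) a = 0"
    and gb: "\<And>x. inner x a = 0 \<Longrightarrow> inner (g x) b = 0"
  shows "\<exists>x y s. norm x = 1 \<and> norm y = 1 \<and> inner x a = 0 \<and> inner y b = 0 \<and> 0 \<le> s \<and>
    f y = s *\<^sub>R x \<and> g x = s *\<^sub>R y"
proof -
  \<comment> \<open>The bilinear form is maximised over both unit vectors jointly; its maximum is
    the singular value.\<close>
  define S where "S = (sphere 0 1 \<inter> {x. inner x a = 0}) \<times> (sphere 0 1 \<inter> {y. inner y b = 0})"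
  have comp: "compact S" unfolding S_def
    by (intro compact_Times compact_Int_closed compact_sphere closed_Collect_eq continuous_intros)
  have ne: "S \<noteq> {}"
    using orthogonal_unit_vector_exists[of a] orthogonal_unit_vector_exists[of b] by (auto simp: S_def)
  have cf: "continuous_on UNIV f" using lin by (simp add: linear_continuous_on linear_conv_bounded_linear)
  have cont: "continuous_on S (\<lambda>p. inner (fst p) (f (snd p)))"
    by (intro continuous_intros continuous_on_compose2[OF cf]) auto
  obtain p where p: "p \<in> S" and max: "\<And>q. q \<in> S \<Longrightarrow> inner (fst q) (f (snd q)) \<le> inner (fst p) (f (snd p))"
    using continuous_attains_sup[OF comp ne cont] by blast
  obtain x y where xy: "p = (x, y)" by fastforce
  define s where "s = inner x (f y)"
  have x: "norm x = 1" "inner x a = 0" and y: "norm y = 1" "inner y b = 0" using p by (auto simp: S_def xy)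
  have le: "inner x' (f y') \<le> s" if "norm x' = 1" "inner x' a = 0" "norm y' = 1" "inner y' b = 0" for x' y'
    using max[of "(x', y')"] that by (auto simp: S_def xy s_def)
  have s0: "0 \<le> s" using le[of "- x" y] x y by (simp add: s_def)
  have "f y = s *\<^sub>R x"
  proof (cases "f y = 0")
    case True thus ?thesis by (simp add: s_def)
  next
    case False
    \<comment> \<open>By \<open>fa\<close> the normalised \<open>f y\<close> is itself an admissible
      competitor for \<open>x\<close>. Hence \<open>s\<close> equals \<open>norm (f y)\<close>, and
      the equality case of Cauchy-Schwarz makes \<open>f y\<close> parallel to
      \<open>x\<close>.\<close>
    have "inner (f y /\<^sub>R norm (f y)) (f y) \<le> s"
      using False fa[OF y(2)] y by (intro le) auto
    hence "norm (f y) \<le> s" using False by (simp add: power2_norm_eq_inner[symmetric] power2_eq_square field_simps)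
    moreover have "s \<le> norm (f y)" using norm_cauchy_schwarz[of x "f y"] x by (simp add: s_def)
    ultimately have s: "s = norm (f y)" by simp
    hence "inner x (f y) = norm x * norm (f y)" using x by (simp add: s_def)
    thus ?thesis using norm_cauchy_schwarz_eq[of x "f y"] x s by simp
  qed
  moreover have "g x = s *\<^sub>R y"
  proof (cases "g x = 0")
    case True thus ?thesis using adj[of y x] by (simp add: s_def inner_commute)
  next
    case False
    have "inner x (f (g x /\<^sub>R norm (g x))) \<le> s"
      using False gb[OF x(2)] x by (intro le) auto
    hence "inner (g x /\<^sub>R norm (g x)) (g x) \<le> s" using adj by (simp add: inner_commute)
    hence "norm (g x) \<le> s" using False by (simp add: power2_norm_eq_inner[symmetric] power2_eq_square field_simps)
    moreover have sg: "s = inner y (g x)" using adj[of y x] by (simp add: s_def inner_commute)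
    moreover have "inner y (g x) \<le> norm (g x)" using norm_cauchy_schwarz[of y "g x"] y by simp
    ultimately have s: "s = norm (g x)" by simp
    hence "inner y (g x) = norm y * norm (g x)" using y sg by simp
    thus ?thesis using norm_cauchy_schwarz_eq[of y "g x"] y s by simp
  qed
  ultimately show ?thesis using x y s0 by blast
qed

lemma cross3_unit:
  assumes "norm x = 1" "norm y = 1" "inner x y = 0"
  shows "norm (cross3 x y) = 1" "inner (cross3 x y) x = 0" "inner (cross3 x y) y = 0"
  using norm_cross[of x y] assms dot_cross_self[of x y] dot_cross_self[of y x]
  by (auto simp: inner_commute power2_eq_1_iff) (smt (verit) norm_ge_zero)

text \<open>After removing the component along the unit normal, both the dot and the cross product
  with that normal vanish.\<close>

lemma parallel_to_cross3:
  assumes xy: "norm x = 1" "norm y = 1" "inner x y = 0" and v: "inner v x = 0" "inner v y = 0"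
  shows "v = inner v (cross3 x y) *\<^sub>R cross3 x y"
proof -
  define z where "z = cross3 x y"
  define w where "w = v - inner v z *\<^sub>R z"
  have z: "norm z = 1" unfolding z_def by (rule cross3_unit[OF xy])
  have zz: "inner z z = 1" using z by (simp add: dot_square_norm)
  have "cross3 w z = 0"
    unfolding w_def z_def using v xy cross3_unit[OF xy]
    by (simp add: inner_diff_left Cross3.left_diff_distrib cross_mult_left Lagrange)
  moreover have "inner w z = 0" by (simp add: w_def inner_diff_left zz)
  ultimately have "w = 0" using norm_and_cross_eq_0[of w z] z by auto
  thus ?thesis by (simp add: w_def z_def)
qed

text \<open>The columns of a rotation. The cross product encodes determinant \<open>+1\<close>,
  which is what permits the lift to a unitary.\<close>

definition right_handed_frame :: "real ^ 3 \<Rightarrow> real ^ 3 \<Rightarrow> real ^ 3 \<Rightarrow> bool" where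
  "right_handed_frame x y z \<longleftrightarrow> norm x = 1 \<and> norm y = 1 \<and> inner x y = 0 \<and> z = cross3 x y"

text \<open>Two deflation steps fix two pairs of vectors, and right-handedness then forces the third
  pair. Its coefficient \<open>d\<close> may be negative; this is where the common sign convention
  of the normal form comes from.\<close>

lemma svd_right_handed:
  fixes f :: "real ^ 3 \<Rightarrow> real ^ 3"
  assumes lin: "linear f"
  shows "\<exists>x1 x2 x3 y1 y2 y3 d1 d2 d3. right_handed_frame x1 x2 x3 \<and> right_handed_frame y1 y2 y3 \<and>
    (0 \<le> d1 \<and> 0 \<le> d2 \<and> 0 \<le> d3 \<or> d1 \<le> 0 \<and> d2 \<le> 0 \<and> d3 \<le> 0) \<and>
    f y1 = d1 *\<^sub>R x1 \<and> f y2 = d2 *\<^sub>R x2 \<and> f y3 = d3 *\<^sub>R x3"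
proof -
  define g where "g = adjoint f"
  have adj: "inner (f y) x = inner y (g x)" for x y
    using adjoint_works[OF lin] by (simp add: g_def inner_commute)
  \<comment> \<open>With \<open>a = b = 0\<close> the orthogonality constraints are void.\<close>
  obtain x1 y1 s1 where 1: "norm x1 = 1" "norm y1 = 1" "0 \<le> s1" "f y1 = s1 *\<^sub>R x1" "g x1 = s1 *\<^sub>R y1"
    using singular_pair_orthogonal[OF lin adj, of 0 0] by auto
  have fa: "inner (f y) x1 = 0" if "inner y y1 = 0" for y using that by (simp add: adj 1)
  have gb: "inner (g x) y1 = 0" if "inner x x1 = 0" for x
    using that adj[of y1 x] by (simp add: 1 inner_commute)
  obtain x2 y2 s2 where 2: "norm x2 = 1" "norm y2 = 1" "inner x2 x1 = 0" "inner y2 y1 = 0" "0 \<le> s2"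
     "f y2 = s2 *\<^sub>R x2" "g x2 = s2 *\<^sub>R y2"
    using singular_pair_orthogonal[OF lin adj fa gb] by auto
  define x3 where "x3 = cross3 x1 x2"
  define y3 where "y3 = cross3 y1 y2"
  define d where "d = inner (f y3) x3"
  have o: "inner x1 x2 = 0" "inner y1 y2 = 0" using 2 by (auto simp: inner_commute)
  have y3: "inner y3 y1 = 0" "inner y3 y2 = 0" using cross3_unit[OF 1(2) 2(2) o(2)] by (auto simp: y3_def)
  have "inner (f y3) x1 = 0" "inner (f y3) x2 = 0" using y3 by (auto simp: adj 1 2)
  hence f3: "f y3 = d *\<^sub>R x3" unfolding d_def x3_def by (rule parallel_to_cross3[OF 1(1) 2(1) o(1)])
  have fy: "right_handed_frame y1 y2 y3" using 1 2 o by (simp add: right_handed_frame_def y3_def)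
  show ?thesis
  proof (cases "d \<ge> 0")
    case True
    have "right_handed_frame x1 x2 x3" using 1 2 o by (simp add: right_handed_frame_def x3_def)
    thus ?thesis using fy True 1 2 f3 by blast
  next
    case False
    \<comment> \<open>Negating two vectors leaves their cross product unchanged and flips the first
      two coefficients, matching the sign of \<open>d\<close>.\<close>
    have "right_handed_frame (- x1) (- x2) x3" using 1 2 o by (simp add: right_handed_frame_def x3_def)
    moreover have "f y1 = (- s1) *\<^sub>R (- x1)" "f y2 = (- s2) *\<^sub>R (- x2)" using 1 2 by auto
    moreover have "- s1 \<le> 0" "- s2 \<le> 0" "d \<le> 0" using 1 2 False by auto
    ultimately show ?thesis using fy f3 by blast
  qed
qed

section \<open>The contraction coefficient as a Hilbert-Schmidt norm\<close>

lemma mat2_mult_index: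
  assumes "A \<in> carrier_mat 2 2" "B \<in> carrier_mat 2 2" "i < 2" "j < 2"
  shows "(A * B) $$ (i, j) = A $$ (i, 0) * B $$ (0, j) + A $$ (i, 1) * B $$ (1, j :: nat)"
  using assms by (simp add: scalar_prod_def numeral_2_eq_2)

lemma mat2_mult_carrier [simp]:
  "A \<in> carrier_mat 2 2 \<Longrightarrow> B \<in> carrier_mat 2 2 \<Longrightarrow> A * B \<in> carrier_mat 2 2"
  by (rule mult_carrier_mat)

lemma mat2_eqI:
  fixes A :: "'a mat"
  assumes "A \<in> carrier_mat 2 2" "B \<in> carrier_mat 2 2"
    "A $$ (0, 0) = B $$ (0, 0)" "A $$ (0, 1) = B $$ (0, 1)" "A $$ (1, 0) = B $$ (1, 0)" "A $$ (1, 1) = B $$ (1, 1)"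
  shows "A = B"
proof (rule eq_matI)
  fix i j assume "i < dim_row B" "j < dim_col B"
  hence "i < 2" "j < 2" using assms by auto
  thus "A $$ (i, j) = B $$ (i, j)" using assms(3-6) by (auto dest!: less_2_cases)
qed (use assms in auto)

lemma pauli_carrier [simp]: "pauli_X \<in> carrier_mat 2 2" "pauli_Y \<in> carrier_mat 2 2" "pauli_Z \<in> carrier_mat 2 2"
  by (rule carrier_matI; simp add: pauli_X_def pauli_Y_def pauli_Z_def mat_of_rows_list_def)+

lemma pauli_dim [simp]:
  "dim_row pauli_X = 2" "dim_row pauli_Y = 2" "dim_row pauli_Z = 2"
  "dim_col pauli_X = 2" "dim_col pauli_Y = 2" "dim_col pauli_Z = 2"
  using pauli_carrier by (auto simp only: carrier_matD)

lemma pauli_index [simp]: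
  "pauli_X $$ (0, 0) = 0" "pauli_X $$ (0, Suc 0) = 1" "pauli_X $$ (Suc 0, 0) = 1" "pauli_X $$ (Suc 0, Suc 0) = 0"
  "pauli_Y $$ (0, 0) = 0" "pauli_Y $$ (0, Suc 0) = - \<i>" "pauli_Y $$ (Suc 0, 0) = \<i>" "pauli_Y $$ (Suc 0, Suc 0) = 0"
  "pauli_Z $$ (0, 0) = 1" "pauli_Z $$ (0, Suc 0) = 0" "pauli_Z $$ (Suc 0, 0) = 0" "pauli_Z $$ (Suc 0, Suc 0) = - 1"
  by (simp_all add: pauli_X_def pauli_Y_def pauli_Z_def mat_of_rows_list_def)

text \<open>The matrix \<open>v \<cdot> \<sigma>\<close>, with its entries written out.\<close>

definition sigma_mat :: "real ^ 3 \<Rightarrow> complex mat" where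
  "sigma_mat v = mat 2 2 (\<lambda>(i, j). if i = 0 then (if j = 0 then complex_of_real (vec_nth v 3) else Complex (vec_nth v 1) (- vec_nth v 2))
     else (if j = 0 then Complex (vec_nth v 1) (vec_nth v 2) else - complex_of_real (vec_nth v 3)))"

lemma sigma_mat_carrier [simp]: "sigma_mat v \<in> carrier_mat 2 2"
  by (simp add: sigma_mat_def)

lemma sigma_mat_index [simp]:
  "sigma_mat v $$ (0, 0) = complex_of_real (vec_nth v 3)" "sigma_mat v $$ (0, Suc 0) = Complex (vec_nth v 1) (- vec_nth v 2)"
  "sigma_mat v $$ (Suc 0, 0) = Complex (vec_nth v 1) (vec_nth v 2)" "sigma_mat v $$ (Suc 0, Suc 0) = - complex_of_real (vec_nth v 3)"
  by (simp_all add: sigma_mat_def)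

lemma mat_adjoint_carrier [simp]: "A \<in> carrier_mat n m \<Longrightarrow> mat_adjoint A \<in> carrier_mat m n"
  by (rule carrier_matI) (auto simp: mat_adjoint_def)

lemma mat_adjoint_index [simp]:
  "i < dim_col A \<Longrightarrow> j < dim_row A \<Longrightarrow> mat_adjoint A $$ (i, j) = cnj (A $$ (j, i))" for A :: "complex mat"
  by (simp add: mat_adjoint_def mat_of_rows_index)

lemma mat_adjoint_dim [simp]: "dim_row (mat_adjoint A) = dim_col A" "dim_col (mat_adjoint A) = dim_row A"
  by (simp_all add: mat_adjoint_def)

text \<open>The first column is a unit \<open>+1\<close> eigenvector of \<open>x\<^sub>3 \<cdot> \<sigma>\<close>, the second its image under \<open>x\<^sub>1 \<cdot> \<sigma>\<close>.\<close>

lemma right_handed_frame_unitary: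
  assumes frame: "right_handed_frame x1 x2 x3"
  shows "\<exists>U. is_unitary 2 U \<and> sigma_mat x1 * U = U * pauli_X \<and> sigma_mat x2 * U = U * pauli_Y \<and>
     sigma_mat x3 * U = U * pauli_Z"
proof -
  define a1 where "a1 = vec_nth x1 1"
  define b1 where "b1 = vec_nth x1 2"
  define c1 where "c1 = vec_nth x1 3"
  define a2 where "a2 = vec_nth x2 1"
  define b2 where "b2 = vec_nth x2 2"
  define c2 where "c2 = vec_nth x2 3"
  define a3 where "a3 = vec_nth x3 1"
  define b3 where "b3 = vec_nth x3 2"
  define c3 where "c3 = vec_nth x3 3"
  note v = a1_def b1_def c1_def a2_def b2_def c2_def a3_def b3_def c3_def
  have n1: "a1 * a1 + b1 * b1 + c1 * c1 = 1" and n2: "a2 * a2 + b2 * b2 + c2 * c2 = 1"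
    using frame by (auto simp: right_handed_frame_def norm_eq_1 inner_vec_def sum_3 v)
  have o: "a1 * a2 + b1 * b2 + c1 * c2 = 0"
    using frame by (auto simp: right_handed_frame_def inner_vec_def sum_3 v)
  have x3: "x3 = cross3 x1 x2" using frame by (simp add: right_handed_frame_def)
  have cr: "a3 = b1 * c2 - b2 * c1" "b3 = c1 * a2 - c2 * a1" "c3 = a1 * b2 - a2 * b1"
    by (simp_all add: v x3 cross_components)
  have "norm x3 = 1" using frame cross3_unit[of x1 x2] by (simp add: right_handed_frame_def)
  hence n3: "a3 * a3 + b3 * b3 + c3 * c3 = 1" by (simp add: norm_eq_1 inner_vec_def sum_3 v)
  have "inner x3 x1 = 0" using frame cross3_unit[of x1 x2] by (simp add: right_handed_frame_def)
  hence o3: "a1 * a3 + b1 * b3 + c1 * c3 = 0" by (simp add: inner_vec_def sum_3 v mult.commute)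
  have x2: "x2 = cross3 x3 x1"
  proof -
    have "cross3 x3 x1 = - cross3 x1 (cross3 x1 x2)" unfolding x3 by (rule cross_skew)
    also have "\<dots> = x2" using frame
      by (simp add: Lagrange right_handed_frame_def inner_commute dot_square_norm)
    finally show ?thesis by simp
  qed
  have cr2: "a2 = b3 * c1 - b1 * c3" "b2 = c3 * a1 - c1 * a3" "c2 = a3 * b1 - a1 * b3"
    using x2 by (simp_all add: v cross_components)
  \<comment> \<open>In \<open>x \<cdot> \<sigma>\<close> the letter \<open>m\<close> is the upper
    right entry, \<open>k\<close> the lower left one, and \<open>C\<close> the upper diagonal
    one.\<close>
  define m1 where "m1 = Complex a1 (- b1)"
  define k1 where "k1 = Complex a1 b1"
  define m2 where "m2 = Complex a2 (- b2)"
  define k2 where "k2 = Complex a2 b2"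
  define m3 where "m3 = Complex a3 (- b3)"
  define k3 where "k3 = Complex a3 b3"
  note m = m1_def k1_def m2_def k2_def m3_def k3_def
  define C1 where "C1 = complex_of_real c1"
  define C2 where "C2 = complex_of_real c2"
  define C3 where "C3 = complex_of_real c3"
  note C = C1_def C2_def C3_def
  \<comment> \<open>The Pauli algebra of the frame, entrywise: \<open>sq1\<close> says that
    \<open>x1 \<cdot> \<sigma>\<close> squares to 1, \<open>anti\<close> that it anticommutes with
    \<open>x3 \<cdot> \<sigma>\<close>, and \<open>P2\<close> that
    \<open>x2 \<cdot> \<sigma>\<close> is \<open>\<i>\<close> times the product of
    \<open>x1 \<cdot> \<sigma>\<close> and \<open>x3 \<cdot> \<sigma>\<close>.\<close>
  have sq1: "C1 * C1 + m1 * k1 = 1" using n1 by (simp add: m C complex_eq_iff algebra_simps)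
  have anti: "2 * C1 * C3 + m1 * k3 + k1 * m3 = 0" using o3 by (simp add: m C complex_eq_iff algebra_simps)
  have P2: "C2 = \<i> * (C1 * C3 + m1 * k3)" "m2 = \<i> * (C1 * m3 - m1 * C3)" "k2 = \<i> * (k1 * C3 - C1 * k3)"
    "- C2 = \<i> * (k1 * m3 + C1 * C3)"
    using o3 cr2 by (simp_all add: m C complex_eq_iff algebra_simps)
  have cn: "cnj m1 = k1" "cnj k1 = m1" "cnj m3 = k3" "cnj k3 = m3" "cnj C1 = C1" "cnj C3 = C3"
    by (simp_all add: m C complex_eq_iff)
  \<comment> \<open>The eigenvector is the first column of \<open>1 + x3 \<cdot> \<sigma>\<close>,
    of squared norm \<open>2 (1 + c3)\<close>. This column vanishes exactly for
    \<open>c3 = - 1\<close>, where the second basis vector serves.\<close>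
  have "\<exists>p q. C3 * p + m3 * q = p \<and> k3 * p - C3 * q = q \<and> cnj p * p + cnj q * q = 1"
  proof (cases "c3 = - 1")
    case True
    hence "a3 = 0" "b3 = 0" using n3 sum_squares_eq_zero_iff[of a3 b3] by auto
    thus ?thesis using True by (intro exI[of _ 0] exI[of _ 1]) (simp add: m C complex_eq_iff)
  next
    case False
    have "c3 * c3 \<le> 1" using n3 by (smt (verit) zero_le_square)
    hence "\<bar>c3\<bar> \<le> 1" by (metis abs_le_square_iff abs_one one_power2 power2_eq_square)
    with False have pos: "1 + c3 > 0" by simp
    define h where "h = sqrt (2 * (1 + c3))"
    have h: "h > 0" "h * h = 2 * (1 + c3)" using pos by (auto simp: h_def)
    define p q where pq: "p = complex_of_real ((1 + c3) / h)" "q = Complex (a3 / h) (b3 / h)"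
    have "c3 * ((1 + c3) / h) + (a3 * (a3 / h) + b3 * (b3 / h)) = (c3 * (1 + c3) + a3 * a3 + b3 * b3) / h"
      by (simp add: add_divide_distrib distrib_left)
    also have "c3 * (1 + c3) + a3 * a3 + b3 * b3 = 1 + c3" using n3 by (simp add: algebra_simps)
    finally have e1: "C3 * p + m3 * q = p"
      by (simp add: pq m C complex_eq_iff)
    have "x * ((1 + c3) / h) - c3 * (x / h) = x / h" for x
      by (simp add: algebra_simps add_divide_distrib)
    hence e2: "k3 * p - C3 * q = q" by (simp add: pq m C complex_eq_iff)
    have "(1 + c3) * (1 + c3) + (a3 * a3 + b3 * b3) = h * h"
      unfolding h(2) using n3 by (simp add: algebra_simps)
    hence "((1 + c3) * (1 + c3) + (a3 * a3 + b3 * b3)) / (h * h) = 1" using h(1) by simp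
    hence "((1 + c3) / h) * ((1 + c3) / h) + ((a3 / h) * (a3 / h) + (b3 / h) * (b3 / h)) = 1"
      by (simp only: times_divide_times_eq add_divide_distrib[symmetric])
    hence e3: "cnj p * p + cnj q * q = 1"
      by (simp add: pq complex_eq_iff)
    from e1 e2 e3 show ?thesis by blast
  qed
  then obtain p q where pq: "C3 * p + m3 * q = p" "k3 * p - C3 * q = q" and nrm: "cnj p * p + cnj q * q = 1" by blast
  define r s where rs: "r = C1 * p + m1 * q" "s = k1 * p - C1 * q"
  have P1r: "C1 * r + m1 * s = p" "k1 * r - C1 * s = q"
  proof -
    have "C1 * r + m1 * s = (C1 * C1 + m1 * k1) * p" "k1 * r - C1 * s = (C1 * C1 + m1 * k1) * q"
      by (simp_all add: rs algebra_simps)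
    thus "C1 * r + m1 * s = p" "k1 * r - C1 * s = q" by (simp_all add: sq1)
  qed
  \<comment> \<open>By anticommutation, \<open>x1 \<cdot> \<sigma>\<close> carries the
    \<open>+1\<close> eigenvector of \<open>x3 \<cdot> \<sigma>\<close> to a \<open>-1\<close>
    eigenvector.\<close>
  have P3r: "C3 * r + m3 * s = - r" "k3 * r - C3 * s = - s"
  proof -
    have "C3 * r + m3 * s = (2 * C1 * C3 + m1 * k3 + k1 * m3) * p - (C1 * (C3 * p + m3 * q) + m1 * (k3 * p - C3 * q))"
      "k3 * r - C3 * s = (2 * C1 * C3 + m1 * k3 + k1 * m3) * q - (k1 * (C3 * p + m3 * q) - C1 * (k3 * p - C3 * q))"
      by (simp_all add: rs algebra_simps)
    thus "C3 * r + m3 * s = - r" "k3 * r - C3 * s = - s" unfolding anti pq by (simp_all add: rs)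
  qed
  have P2x: "C2 * x + m2 * y = \<i> * (C1 * (C3 * x + m3 * y) + m1 * (k3 * x - C3 * y))" for x y
    unfolding P2(1,2) by (simp add: algebra_simps)
  have P2y: "k2 * x - C2 * y = \<i> * (k1 * (C3 * x + m3 * y) - C1 * (k3 * x - C3 * y))" for x y
  proof -
    have "k2 * x - C2 * y = k2 * x + (- C2) * y" by simp
    thus ?thesis unfolding P2(3,4) by (simp add: algebra_simps)
  qed
  have P2p: "C2 * p + m2 * q = \<i> * r" "k2 * p - C2 * q = \<i> * s"
    unfolding P2x P2y pq by (simp_all add: rs)
  have P2r: "C2 * r + m2 * s = - \<i> * p" "k2 * r - C2 * s = - \<i> * q"
  proof -
    have "C2 * r + m2 * s = - \<i> * (C1 * r + m1 * s)" unfolding P2x P3r by (simp add: algebra_simps)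
    thus "C2 * r + m2 * s = - \<i> * p" by (simp only: P1r)
    have "k2 * r - C2 * s = - \<i> * (k1 * r - C1 * s)" unfolding P2y P3r by (simp add: algebra_simps)
    thus "k2 * r - C2 * s = - \<i> * q" by (simp only: P1r)
  qed
  have pqc: "C3 * cnj p + k3 * cnj q = cnj p" "m3 * cnj p - C3 * cnj q = cnj q"
    using arg_cong[OF pq(1), of cnj] arg_cong[OF pq(2), of cnj] by (simp_all add: cn)
  have rsc: "cnj r = C1 * cnj p + k1 * cnj q" "cnj s = m1 * cnj p - C1 * cnj q"
    by (simp_all add: rs cn)
  \<comment> \<open>Eigenvectors of a Hermitian matrix for the eigenvalues \<open>1\<close> and
    \<open>-1\<close>: the inner product equals its own negative.\<close>
  have orth: "cnj p * r + cnj q * s = 0"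
  proof -
    have "cnj p * r + cnj q * s = (C3 * cnj p + k3 * cnj q) * r + (m3 * cnj p - C3 * cnj q) * s"
      by (simp only: pqc)
    also have "\<dots> = cnj p * (C3 * r + m3 * s) + cnj q * (k3 * r - C3 * s)" by (simp add: algebra_simps)
    also have "\<dots> = - (cnj p * r + cnj q * s)" by (simp add: P3r)
    finally have "cnj p * r + cnj q * s + (cnj p * r + cnj q * s) = 0" unfolding eq_neg_iff_add_eq_0 .
    hence "2 * (cnj p * r + cnj q * s) = 0" by (simp only: mult_2)
    thus ?thesis by (metis mult_eq_0_iff zero_neq_numeral)
  qed
  have orth': "cnj r * p + cnj s * q = 0"
    using arg_cong[OF orth, of cnj] by (simp add: mult.commute)
  have nrm2: "cnj r * r + cnj s * s = 1"
  proof -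
    have "cnj r * r + cnj s * s = cnj p * (C1 * r + m1 * s) + cnj q * (k1 * r - C1 * s)"
      unfolding rsc by (simp add: algebra_simps)
    thus ?thesis by (simp only: P1r nrm)
  qed
  define U where "U = mat 2 2 (\<lambda>(i, j). if i = 0 then (if j = 0 then p else r) else (if j = 0 then q else (s :: complex)))"
  have Uc: "U \<in> carrier_mat 2 2" by (simp add: U_def)
  have Ui: "U $$ (0, 0) = p" "U $$ (0, Suc 0) = r" "U $$ (Suc 0, 0) = q" "U $$ (Suc 0, Suc 0) = s"
    by (simp_all add: U_def)
  have Ud: "dim_row U = 2" "dim_col U = 2" by (simp_all add: U_def)
  have UU: "mat_adjoint U * U = 1\<^sub>m 2"
    by (rule mat2_eqI) (use Uc mat_adjoint_carrier[OF Uc] mult_carrier_mat[OF mat_adjoint_carrier[OF Uc] Uc] orth orth' nrm nrm2 in \<open>simp_all add: mat2_mult_index Ui Ud del: index_mult_mat(1)\<close>)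
  have "U * mat_adjoint U = 1\<^sub>m 2"
    using mat_mult_left_right_inverse[OF mat_adjoint_carrier[OF Uc] Uc UU] .
  hence "is_unitary 2 U" using Uc UU by (simp add: is_unitary_def)
  moreover have "sigma_mat x1 * U = U * pauli_X"
    by (rule mat2_eqI) (use Uc P1r in \<open>simp_all add: mat2_mult_index Ui v[symmetric] m[symmetric] C[symmetric] rs del: index_mult_mat(1)\<close>)
  moreover have "sigma_mat x2 * U = U * pauli_Y"
    by (rule mat2_eqI) (use Uc P2p P2r in \<open>simp_all add: mat2_mult_index Ui v[symmetric] m[symmetric] C[symmetric] mult.commute del: index_mult_mat(1)\<close>)
  moreover have "sigma_mat x3 * U = U * pauli_Z"
    by (rule mat2_eqI) (use Uc pq P3r in \<open>simp_all add: mat2_mult_index Ui v[symmetric] m[symmetric] C[symmetric] del: index_mult_mat(1)\<close>)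
  ultimately show ?thesis by blast
qed

section \<open>The Hilbert-Schmidt norm of a map and its unitary invariance\<close>

lemma matrix_unit_carrier [simp]: "matrix_unit d i j \<in> carrier_mat d d"
  by (simp add: matrix_unit_def)

lemma matrix_unit_dim [simp]: "dim_row (matrix_unit d i j) = d" "dim_col (matrix_unit d i j) = d"
  by (simp_all add: matrix_unit_def)

lemma matrix_unit_index: "a < d \<Longrightarrow> b < d \<Longrightarrow> matrix_unit d i j $$ (a, b) = (if a = i \<and> b = j then 1 else 0)"
  by (simp add: matrix_unit_def)

lemma sum_lessThan_2: "(\<Sum>i<(2::nat). f i) = f 0 + f 1"
  by (simp add: numeral_2_eq_2)

lemma linear_supermap_expand2:
  assumes F: "linear_supermap 2 F" and A: "A \<in> carrier_mat 2 2" and ab: "a < 2" "b < 2"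
  shows "F A $$ (a, b) = (\<Sum>i<2. \<Sum>j<2. A $$ (i, j) * F (matrix_unit 2 i j) $$ (a, b))"
proof -
  let ?E = "\<lambda>i j. A $$ (i, j) \<cdot>\<^sub>m matrix_unit 2 i j"
  have F1: "F X \<in> carrier_mat 2 2" if "X \<in> carrier_mat 2 2" for X using F that by (auto simp: linear_supermap_def)
  have F2: "F (X + Y) = F X + F Y" if "X \<in> carrier_mat 2 2" "Y \<in> carrier_mat 2 2" for X Y
    using F that by (auto simp: linear_supermap_def)
  have F3: "F (?E i j) = A $$ (i, j) \<cdot>\<^sub>m F (matrix_unit 2 i j)" for i j
    using F by (auto simp: linear_supermap_def)
  have "A = ?E 0 0 + (?E 0 1 + (?E 1 0 + ?E 1 1))"
    by (rule mat2_eqI) (use A in \<open>auto simp: matrix_unit_index\<close>)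
  hence "F A = F (?E 0 0 + (?E 0 1 + (?E 1 0 + ?E 1 1)))" by simp
  also have "\<dots> = F (?E 0 0) + (F (?E 0 1) + (F (?E 1 0) + F (?E 1 1)))"
    by (simp add: F2)
  finally have "F A = F (?E 0 0) + (F (?E 0 1) + (F (?E 1 0) + F (?E 1 1)))" .
  moreover have "dim_row (F (matrix_unit 2 i j)) = 2" "dim_col (F (matrix_unit 2 i j)) = 2" for i j
    using F1[OF matrix_unit_carrier, of i j] by auto
  ultimately show ?thesis using ab by (simp add: F3 sum_lessThan_2)
qed

lemma isometry_sum_cmod:
  fixes W :: "nat \<Rightarrow> nat \<Rightarrow> complex"
  assumes W: "\<And>i j. i < d \<Longrightarrow> j < d \<Longrightarrow> (\<Sum>a<m. cnj (W a i) * W a j) = (if i = j then 1 else 0)"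
  shows "(\<Sum>a<m. (cmod (\<Sum>i<d. W a i * x i))\<^sup>2) = (\<Sum>i<d. (cmod (x i))\<^sup>2)"
proof -
  have "complex_of_real (\<Sum>a<m. (cmod (\<Sum>i<d. W a i * x i))\<^sup>2) = (\<Sum>a<m. (\<Sum>j<d. W a j * x j) * cnj (\<Sum>i<d. W a i * x i))"
    by (simp only: complex_norm_square of_real_sum)
  also have "\<dots> = (\<Sum>a<m. \<Sum>i<d. \<Sum>j<d. (cnj (x i) * x j) * (cnj (W a i) * W a j))"
    by (simp add: sum_distrib_left sum_distrib_right mult_ac)
  also have "\<dots> = (\<Sum>i<d. \<Sum>a<m. \<Sum>j<d. (cnj (x i) * x j) * (cnj (W a i) * W a j))" by (rule sum.swap)
  also have "\<dots> = (\<Sum>i<d. \<Sum>j<d. \<Sum>a<m. (cnj (x i) * x j) * (cnj (W a i) * W a j))"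
    by (intro sum.cong refl sum.swap)
  also have "\<dots> = (\<Sum>i<d. \<Sum>j<d. (cnj (x i) * x j) * (if i = j then 1 else 0))"
    by (intro sum.cong refl) (simp add: sum_distrib_left[symmetric] W)
  also have "\<dots> = (\<Sum>i<d. x i * cnj (x i))"
    by (intro sum.cong refl) (simp add: if_distrib[of "\<lambda>y. _ * y"] mult.commute cong: if_cong)
  also have "\<dots> = complex_of_real (\<Sum>i<d. (cmod (x i))\<^sup>2)" by (simp only: complex_norm_square of_real_sum)
  finally show ?thesis using of_real_eq_iff by blast
qed

text \<open>The two indices are treated one after the other. It is applied both to the entries of an
  output matrix and to the pair labelling the input matrix unit.\<close>

lemma isometry_sandwich_sum_cmod:
  fixes W W' :: "nat \<Rightarrow> nat \<Rightarrow> complex"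
  assumes W: "\<And>i j. i < d \<Longrightarrow> j < d \<Longrightarrow> (\<Sum>a<m. cnj (W a i) * W a j) = (if i = j then 1 else 0)"
    and W': "\<And>i j. i < d' \<Longrightarrow> j < d' \<Longrightarrow> (\<Sum>a<m'. cnj (W' a i) * W' a j) = (if i = j then 1 else 0)"
  shows "(\<Sum>a<m. \<Sum>b<m'. (cmod (\<Sum>i<d. \<Sum>j<d'. W a i * W' b j * x i j))\<^sup>2) = (\<Sum>i<d. \<Sum>j<d'. (cmod (x i j))\<^sup>2)"
proof -
  have "(\<Sum>a<m. \<Sum>b<m'. (cmod (\<Sum>i<d. \<Sum>j<d'. W a i * W' b j * x i j))\<^sup>2)
      = (\<Sum>b<m'. \<Sum>a<m. (cmod (\<Sum>i<d. W a i * (\<Sum>j<d'. W' b j * x i j)))\<^sup>2)"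
    by (subst sum.swap) (simp add: sum_distrib_left mult_ac)
  also have "\<dots> = (\<Sum>b<m'. \<Sum>i<d. (cmod (\<Sum>j<d'. W' b j * x i j))\<^sup>2)"
    using isometry_sum_cmod[where d = d and m = m and W = W] W by simp
  also have "\<dots> = (\<Sum>i<d. \<Sum>b<m'. (cmod (\<Sum>j<d'. W' b j * x i j))\<^sup>2)" by (rule sum.swap)
  also have "\<dots> = (\<Sum>i<d. \<Sum>j<d'. (cmod (x i j))\<^sup>2)"
    using isometry_sum_cmod[where d = d' and m = m' and W = W'] W' by simp
  finally show ?thesis .
qed

lemma unitary_isometry:
  assumes "is_unitary d U" "i < d" "j < d"
  shows "(\<Sum>a<d. cnj (U $$ (a, i)) * U $$ (a, j)) = (if i = j then 1 else 0)"
    and "(\<Sum>a<d. U $$ (a, i) * cnj (U $$ (a, j))) = (if i = j then 1 else 0)"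
proof -
  have U: "U \<in> carrier_mat d d" and UU: "mat_adjoint U * U = 1\<^sub>m d" using assms by (auto simp: is_unitary_def)
  have "(mat_adjoint U * U) $$ (i, j) = (\<Sum>a<d. cnj (U $$ (a, i)) * U $$ (a, j))"
    using U assms(2,3) by (simp add: scalar_prod_def atLeast0LessThan)
  thus *: "(\<Sum>a<d. cnj (U $$ (a, i)) * U $$ (a, j)) = (if i = j then 1 else 0)" using UU assms(2,3) by simp
  from arg_cong[OF this, of cnj] show "(\<Sum>a<d. U $$ (a, i) * cnj (U $$ (a, j))) = (if i = j then 1 else 0)"
    by (simp split: if_splits)
qed

lemma sandwich_index:
  fixes A B C :: "complex mat"
  assumes "A \<in> carrier_mat m d" "B \<in> carrier_mat d d'" "C \<in> carrier_mat d' m'" "a < m" "b < m'"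
  shows "(A * B * C) $$ (a, b) = (\<Sum>i<d. \<Sum>j<d'. A $$ (a, i) * C $$ (j, b) * B $$ (i, j))"
  using assms by (simp add: scalar_prod_def atLeast0LessThan sum_distrib_left mult_ac)

text \<open>The squared Hilbert-Schmidt norm of the Choi matrix of \<open>N\<close>.\<close>

definition supermap_norm2 :: "(complex mat \<Rightarrow> complex mat) \<Rightarrow> real" where
  "supermap_norm2 N = (\<Sum>k<2. \<Sum>l<2. \<Sum>a<2. \<Sum>b<2. (cmod (N (matrix_unit 2 k l) $$ (a, b)))\<^sup>2)"

lemma bloch_carrier [simp]: "bloch x y z \<in> carrier_mat 2 2"
  by (simp add: bloch_def)

lemma bloch_index [simp]:
  "bloch x y z $$ (0, 0) = complex_of_real ((1 + z) / 2)" "bloch x y z $$ (0, Suc 0) = Complex (x / 2) (- y / 2)"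
  "bloch x y z $$ (Suc 0, 0) = Complex (x / 2) (y / 2)" "bloch x y z $$ (Suc 0, Suc 0) = complex_of_real ((1 - z) / 2)"
  by (simp_all add: bloch_def complex_eq_iff)

text \<open>In the orthonormal basis of normalised identity and Pauli matrices the map has first row
  \<open>(1, 0, 0, 0)\<close>, first column \<open>(1, t)\<close> and remaining block
  \<open>D\<close>; the norm adds up the squares.\<close>

lemma supermap_norm2_bloch:
  assumes F: "linear_supermap 2 F"
    and bl: "\<And>x y z. F (bloch x y z) = bloch (D1 * x + t1) (D2 * y + t2) (D3 * z + t3)"
  shows "supermap_norm2 F = 1 + (t1\<^sup>2 + t2\<^sup>2 + t3\<^sup>2 + D1\<^sup>2 + D2\<^sup>2 + D3\<^sup>2)"
proof -
  define e where "e i j a b = F (matrix_unit 2 i j) $$ (a, b)" for i j a b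
  have ex: "bloch (D1 * x + t1) (D2 * y + t2) (D3 * z + t3) $$ (a, b) =
     of_real ((1 + z) / 2) * e 0 0 a b + Complex (x / 2) (- y / 2) * e 0 1 a b + Complex (x / 2) (y / 2) * e 1 0 a b
       + of_real ((1 - z) / 2) * e 1 1 a b" if "a < 2" "b < 2" for x y z a b
    using linear_supermap_expand2[OF F bloch_carrier[of x y z] that]
    by (simp add: bl sum_lessThan_2 e_def)
  define \<beta> where "\<beta> x y z a b = bloch (D1 * x + t1) (D2 * y + t2) (D3 * z + t3) $$ (a, b)" for x y z a b
  \<comment> \<open>The Bloch vectors 0 and the three coordinate vectors already determine the
    images of all four matrix units.\<close>
  have e00: "e 0 0 a b = \<beta> 0 0 1 a b" if "a < 2" "b < 2" for a b
    using ex[OF that, of 0 0 1] by (simp add: \<beta>_def flip: zero_complex.code)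
  have s: "e 0 0 a b + e 1 1 a b = 2 * \<beta> 0 0 0 a b" if "a < 2" "b < 2" for a b
    using ex[OF that, of 0 0 0] by (simp add: \<beta>_def complex_eq_iff)
  have x: "e 0 1 a b + e 1 0 a b = 2 * (\<beta> 1 0 0 a b - \<beta> 0 0 0 a b)" if "a < 2" "b < 2" for a b
    using ex[OF that, of 1 0 0] ex[OF that, of 0 0 0] by (simp add: \<beta>_def complex_eq_iff)
  have y: "e 0 1 a b - e 1 0 a b = 2 * \<i> * (\<beta> 0 1 0 a b - \<beta> 0 0 0 a b)" if "a < 2" "b < 2" for a b
    using ex[OF that, of 0 1 0] ex[OF that, of 0 0 0] by (simp add: \<beta>_def complex_eq_iff)
  have e01: "e 0 1 a b = (\<beta> 1 0 0 a b - \<beta> 0 0 0 a b) + \<i> * (\<beta> 0 1 0 a b - \<beta> 0 0 0 a b)" if "a < 2" "b < 2" for a b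
    using x[OF that] y[OF that] by (simp add: complex_eq_iff)
  have e10: "e 1 0 a b = (\<beta> 1 0 0 a b - \<beta> 0 0 0 a b) - \<i> * (\<beta> 0 1 0 a b - \<beta> 0 0 0 a b)" if "a < 2" "b < 2" for a b
    using x[OF that] y[OF that] by (simp add: complex_eq_iff)
  have e11: "e 1 1 a b = 2 * \<beta> 0 0 0 a b - \<beta> 0 0 1 a b" if "a < 2" "b < 2" for a b
    using s[OF that] e00[OF that] by (simp add: algebra_simps)
  have v:
    "e 0 0 0 0 = Complex ((1 + D3 + t3) / 2) 0"
    "e 1 1 0 0 = Complex ((1 + t3 - D3) / 2) 0"
    "e 0 1 0 0 = Complex 0 0"
    "e 1 0 0 0 = Complex 0 0"
    "e 0 0 1 1 = Complex ((1 - D3 - t3) / 2) 0"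
    "e 1 1 1 1 = Complex ((1 - t3 + D3) / 2) 0"
    "e 0 1 1 1 = Complex 0 0"
    "e 1 0 1 1 = Complex 0 0"
    "e 0 0 0 1 = Complex (t1 / 2) (- t2 / 2)"
    "e 1 1 0 1 = Complex (t1 / 2) (- t2 / 2)"
    "e 0 1 0 1 = Complex ((D1 + D2) / 2) 0"
    "e 1 0 0 1 = Complex ((D1 - D2) / 2) 0"
    "e 0 0 1 0 = Complex (t1 / 2) (t2 / 2)"
    "e 1 1 1 0 = Complex (t1 / 2) (t2 / 2)"
    "e 0 1 1 0 = Complex ((D1 - D2) / 2) 0"
    "e 1 0 1 0 = Complex ((D1 + D2) / 2) 0"
    by (simp_all add: e00 e01[simplified] e10[simplified] e11[simplified] \<beta>_def complex_eq_iff field_simps)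
  have "supermap_norm2 F = (\<Sum>k<2. \<Sum>l<2. \<Sum>a<2. \<Sum>b<2. (cmod (e k l a b))\<^sup>2)"
    by (simp add: supermap_norm2_def e_def)
  also have "\<dots> = 1 + (t1\<^sup>2 + t2\<^sup>2 + t3\<^sup>2 + D1\<^sup>2 + D2\<^sup>2 + D3\<^sup>2)"
    unfolding sum_lessThan_2 v cmod_power2 complex.sel by (simp add: power2_eq_square field_simps)
  finally show ?thesis .
qed

text \<open>Conjugating the output is an isometry in the entries \<open>a, b\<close>. Conjugating
  the input replaces matrix units by combinations with coefficients from \<open>V\<close>, which is
  an isometry in the labels \<open>k, l\<close>.\<close>

lemma supermap_norm2_unitary:
  assumes U: "is_unitary 2 U" and V: "is_unitary 2 V" and F: "linear_supermap 2 F"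
    and N: "\<And>A. A \<in> carrier_mat 2 2 \<Longrightarrow> N A = U * F (mat_adjoint V * A * V) * mat_adjoint U"
  shows "supermap_norm2 N = supermap_norm2 F"
proof -
  have Uc: "U \<in> carrier_mat 2 2" and Vc: "V \<in> carrier_mat 2 2" using U V by (auto simp: is_unitary_def)
  have Fc: "F X \<in> carrier_mat 2 2" if "X \<in> carrier_mat 2 2" for X using F that by (auto simp: linear_supermap_def)
  define M where "M k l = mat_adjoint V * matrix_unit 2 k l * V" for k l
  have Mc: "M k l \<in> carrier_mat 2 2" for k l using Vc by (auto simp: M_def intro!: mult_carrier_mat)
  have Mi: "M k l $$ (i, j) = cnj (V $$ (k, i)) * V $$ (l, j)" if "i < 2" "j < 2" "k < 2" "l < 2" for i j k l
  proof -
    have "M k l $$ (i, j) = (\<Sum>p<2. \<Sum>q<2. mat_adjoint V $$ (i, p) * V $$ (q, j) * matrix_unit 2 k l $$ (p, q))"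
      unfolding M_def using Vc that by (intro sandwich_index) auto
    also have "\<dots> = (\<Sum>p<2. \<Sum>q<2. if p = k then (if q = l then cnj (V $$ (p, i)) * V $$ (q, j) else 0) else 0)"
      using Vc that by (intro sum.cong refl) (auto simp: matrix_unit_index)
    also have "\<dots> = (\<Sum>p<2. if p = k then (\<Sum>q<2. if q = l then cnj (V $$ (p, i)) * V $$ (q, j) else 0) else 0)"
      by (intro sum.cong refl) simp
    also have "\<dots> = cnj (V $$ (k, i)) * V $$ (l, j)" using that by simp
    finally show ?thesis .
  qed
  have "supermap_norm2 N = (\<Sum>k<2. \<Sum>l<2. \<Sum>a<2. \<Sum>b<2. (cmod (\<Sum>i<2. \<Sum>j<2. U $$ (a, i) * cnj (U $$ (b, j)) * F (M k l) $$ (i, j)))\<^sup>2)"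
    unfolding supermap_norm2_def
  proof (intro sum.cong refl)
    fix k l a b :: nat assume ab: "a \<in> {..<2}" "b \<in> {..<2}"
    have "N (matrix_unit 2 k l) $$ (a, b) = (\<Sum>i<2. \<Sum>j<2. U $$ (a, i) * mat_adjoint U $$ (j, b) * F (M k l) $$ (i, j))"
      unfolding N[OF matrix_unit_carrier] M_def[symmetric]
      using Uc Fc[OF Mc] ab by (intro sandwich_index) auto
    also have "\<dots> = (\<Sum>i<2. \<Sum>j<2. U $$ (a, i) * cnj (U $$ (b, j)) * F (M k l) $$ (i, j))"
      using Uc ab by (intro sum.cong refl) auto
    finally show "(cmod (N (matrix_unit 2 k l) $$ (a, b)))\<^sup>2 = (cmod (\<Sum>i<2. \<Sum>j<2. U $$ (a, i) * cnj (U $$ (b, j)) * F (M k l) $$ (i, j)))\<^sup>2"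
      by simp
  qed
  also have "\<dots> = (\<Sum>k<2. \<Sum>l<2. \<Sum>i<2. \<Sum>j<2. (cmod (F (M k l) $$ (i, j)))\<^sup>2)"
    by (intro sum.cong refl isometry_sandwich_sum_cmod) (use unitary_isometry[OF U] in auto)
  also have "\<dots> = (\<Sum>a<2. \<Sum>b<2. \<Sum>k<2. \<Sum>l<2. (cmod (F (M k l) $$ (a, b)))\<^sup>2)"
    unfolding sum_lessThan_2 by (simp add: add_ac)
  also have "\<dots> = (\<Sum>a<2. \<Sum>b<2. \<Sum>k<2. \<Sum>l<2. (cmod (\<Sum>i<2. \<Sum>j<2. cnj (V $$ (k, i)) * V $$ (l, j) * F (matrix_unit 2 i j) $$ (a, b)))\<^sup>2)"
    by (intro sum.cong refl) (simp add: linear_supermap_expand2[OF F Mc] Mi)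
  also have "\<dots> = (\<Sum>a<2. \<Sum>b<2. \<Sum>i<2. \<Sum>j<2. (cmod (F (matrix_unit 2 i j) $$ (a, b)))\<^sup>2)"
    by (intro sum.cong refl isometry_sandwich_sum_cmod) (use unitary_isometry[OF V] in auto)
  also have "\<dots> = supermap_norm2 F"
    unfolding supermap_norm2_def sum_lessThan_2 by (simp add: add_ac)
  finally show ?thesis .
qed

text \<open>The left-hand side does not mention the normal form; this is the uniqueness half of the
  definite description of the coefficient.\<close>

lemma channel_normal_form_norm2:
  assumes "channel_normal_form N U V (D1, D2, D3) (t1, t2, t3)"
  shows "supermap_norm2 N = 1 + (t1\<^sup>2 + t2\<^sup>2 + t3\<^sup>2 + D1\<^sup>2 + D2\<^sup>2 + D3\<^sup>2)"
proof -
  from assms obtain F where U: "is_unitary 2 U" "is_unitary 2 V" and F: "linear_supermap 2 F"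
    and bl: "\<And>x y z. F (bloch x y z) = bloch (D1 * x + t1) (D2 * y + t2) (D3 * z + t3)"
    and N: "\<And>A. A \<in> carrier_mat 2 2 \<Longrightarrow> N A = U * F (mat_adjoint V * A * V) * mat_adjoint U"
    by (auto simp: channel_normal_form_def)
  show ?thesis
    using supermap_norm2_unitary[OF U F N] supermap_norm2_bloch[OF F bl] by simp
qed

section \<open>Existence of the normal form\<close>

lemma sigma_mat_dim [simp]: "dim_row (sigma_mat v) = 2" "dim_col (sigma_mat v) = 2"
  by (simp_all add: sigma_mat_def)

lemma sigma_mat_add: "sigma_mat (v + w) = sigma_mat v + sigma_mat w"
  by (rule mat2_eqI) (simp_all add: complex_eq_iff)

lemma sigma_mat_scaleR: "sigma_mat (c *\<^sub>R v) = complex_of_real c \<cdot>\<^sub>m sigma_mat v"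
  by (rule mat2_eqI) (simp_all add: complex_eq_iff)

lemma bloch_sigma_mat: "bloch x y z = (1 / 2) \<cdot>\<^sub>m (1\<^sub>m 2 + sigma_mat (vector [x, y, z]))"
  by (rule mat2_eqI) (simp_all add: complex_eq_iff)

lemma sigma_mat_vector: "sigma_mat (vector [x, y, z]) =
   complex_of_real x \<cdot>\<^sub>m pauli_X + (complex_of_real y \<cdot>\<^sub>m pauli_Y + complex_of_real z \<cdot>\<^sub>m pauli_Z)"
  by (rule mat2_eqI) (simp_all add: complex_eq_iff)

lemma sigma_mat_intertwine:
  assumes U: "U \<in> carrier_mat 2 2" and "sigma_mat x1 * U = U * pauli_X" "sigma_mat x2 * U = U * pauli_Y"
     "sigma_mat x3 * U = U * pauli_Z"
  shows "sigma_mat (x *\<^sub>R x1 + (y *\<^sub>R x2 + z *\<^sub>R x3)) * U = U * sigma_mat (vector [x, y, z])"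
proof -
  have "sigma_mat (x *\<^sub>R x1 + (y *\<^sub>R x2 + z *\<^sub>R x3)) * U
    = (complex_of_real x \<cdot>\<^sub>m sigma_mat x1 + (complex_of_real y \<cdot>\<^sub>m sigma_mat x2 + complex_of_real z \<cdot>\<^sub>m sigma_mat x3)) * U"
    by (simp add: sigma_mat_add sigma_mat_scaleR)
  also have "\<dots> = complex_of_real x \<cdot>\<^sub>m (sigma_mat x1 * U) + (complex_of_real y \<cdot>\<^sub>m (sigma_mat x2 * U)
     + complex_of_real z \<cdot>\<^sub>m (sigma_mat x3 * U))"
    using U by (simp add: add_mult_distrib_mat[where nr = 2 and n = 2 and nc = 2]
       mult_smult_assoc_mat[where nr = 2 and n = 2 and nc = 2])
  also have "\<dots> = U * sigma_mat (vector [x, y, z])" unfolding assms(2-4) sigma_mat_vector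
    using U by (simp add: mult_add_distrib_mat[where nr = 2 and n = 2 and nc = 2]
       mult_smult_distrib[where nr = 2 and n = 2 and nc = 2])
  finally show ?thesis .
qed

lemma frame_expansion:
  assumes "right_handed_frame x1 x2 x3"
  shows "v = inner v x1 *\<^sub>R x1 + (inner v x2 *\<^sub>R x2 + inner v x3 *\<^sub>R x3)"
proof -
  have x: "norm x1 = 1" "norm x2 = 1" "inner x1 x2 = 0" "x3 = cross3 x1 x2"
    using assms by (auto simp: right_handed_frame_def)
  have sq: "inner x1 x1 = 1" "inner x2 x2 = 1" using x by (auto simp: dot_square_norm)
  define w where "w = v - inner v x1 *\<^sub>R x1 - inner v x2 *\<^sub>R x2"
  have "inner w x1 = 0" "inner w x2 = 0" using x sq inner_commute[of x2 x1] by (auto simp: w_def inner_diff_left)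
  from parallel_to_cross3[OF x(1-3) this] have "w = inner w x3 *\<^sub>R x3" by (simp add: x(4))
  moreover have "inner w x3 = inner v x3"
    using cross3_unit(2,3)[OF x(1-3)] inner_commute[of "cross3 x1 x2"] by (simp add: w_def inner_diff_left x(4))
  ultimately have "w = inner v x3 *\<^sub>R x3" by simp
  thus ?thesis unfolding w_def by (simp add: algebra_simps)
qed

definition hermiticity_preserving :: "(complex mat \<Rightarrow> complex mat) \<Rightarrow> bool" where
  "hermiticity_preserving F \<longleftrightarrow> (\<forall>A\<in>carrier_mat 2 2. mat_adjoint A = A \<longrightarrow> mat_adjoint (F A) = F A)"

text \<open>Inverts \<open>sigma_mat\<close> on traceless Hermitian matrices; the minus sign arises
  because the upper right entry of \<open>v \<cdot> \<sigma>\<close> is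
  \<open>x - \<i> y\<close>.\<close>

definition pauli_coords :: "complex mat \<Rightarrow> real ^ 3" where
  "pauli_coords A = vector [Re (A $$ (0, 1)), - Im (A $$ (0, 1)), Re (A $$ (0, 0))]"

lemma sigma_mat_pauli_coords:
  assumes "A \<in> carrier_mat 2 2" "mat_adjoint A = A" "mat_trace A = 0"
  shows "sigma_mat (pauli_coords A) = A"
proof -
  have h: "cnj (A $$ (j, i)) = A $$ (i, j)" if "i < 2" "j < 2" for i j
    using assms(1,2) that mat_adjoint_index[of i A j] by auto
  have t: "A $$ (0, 0) + A $$ (1, 1) = 0" using assms by (simp add: mat_trace_def sum_lessThan_2)
  show ?thesis
    using assms(1) h[of 0 0] h[of 1 0] t
    by (intro mat2_eqI) (auto simp: pauli_coords_def complex_eq_iff)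
qed

lemma sigma_mat_hermitian: "mat_adjoint (sigma_mat v) = sigma_mat v"
  by (rule mat2_eqI) (simp_all add: complex_eq_iff)

lemma mat_trace_sigma_mat: "mat_trace (sigma_mat v) = 0"
  by (simp add: mat_trace_def sum_lessThan_2)

lemma one_mat2_hermitian: "mat_adjoint (1\<^sub>m 2 :: complex mat) = 1\<^sub>m 2"
  by (rule mat2_eqI) simp_all

text \<open>On Bloch vectors \<open>N\<close> is affine, with linear part \<open>f\<close> and
  translation \<open>s\<close>. The frames of a singular value decomposition of \<open>f\<close>
  lift to \<open>U\<close> and \<open>V\<close>; \<open>D\<close> collects the singular coefficients
  and \<open>t\<close> the coordinates of \<open>s\<close> in the output frame.\<close>

lemma channel_normal_form_exists:
  assumes lin: "linear_supermap 2 N" and herm: "hermiticity_preserving N"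
    and tr: "\<And>A. A \<in> carrier_mat 2 2 \<Longrightarrow> mat_trace (N A) = mat_trace A"
  shows "\<exists>U V D1 D2 D3 t1 t2 t3. channel_normal_form N U V (D1, D2, D3) (t1, t2, t3)"
proof -
  have Nc [simp]: "N X \<in> carrier_mat 2 2" if "X \<in> carrier_mat 2 2" for X using lin that by (auto simp: linear_supermap_def)
  have Nd [simp]: "dim_row (N X) = 2" "dim_col (N X) = 2" if "X \<in> carrier_mat 2 2" for X
    using Nc[OF that] by (auto simp del: Nc)
  have N2: "N (X + Y) = N X + N Y" if "X \<in> carrier_mat 2 2" "Y \<in> carrier_mat 2 2" for X Y
    using lin that by (auto simp: linear_supermap_def)
  have N3: "N (c \<cdot>\<^sub>m X) = c \<cdot>\<^sub>m N X" if "X \<in> carrier_mat 2 2" for c X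
    using lin that by (auto simp: linear_supermap_def)
  define f where "f v = pauli_coords (N (sigma_mat v))" for v
  have Nsig: "N (sigma_mat v) = sigma_mat (f v)" for v
    unfolding f_def using herm by (intro sigma_mat_pauli_coords[symmetric])
      (auto simp: hermiticity_preserving_def sigma_mat_hermitian tr mat_trace_sigma_mat)
  have linf: "linear f"
  proof (rule linearI)
    show "f (v + w) = f v + f w" for v w
      by (simp add: f_def sigma_mat_add N2) (simp add: pauli_coords_def Finite_Cartesian_Product.vec_eq_iff forall_3)
    show "f (c *\<^sub>R v) = c *\<^sub>R f v" for c v
      by (simp add: f_def sigma_mat_scaleR N3) (simp add: pauli_coords_def Finite_Cartesian_Product.vec_eq_iff forall_3)
  qed
  \<comment> \<open>The Bloch vector of the image of the maximally mixed state.\<close>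
  define s where "s = pauli_coords (N (1\<^sub>m 2) - 1\<^sub>m 2)"
  have N1h: "mat_adjoint (N (1\<^sub>m 2)) = N (1\<^sub>m 2)"
    using herm by (auto simp: hermiticity_preserving_def one_mat2_hermitian)
  have hN1: "cnj (N (1\<^sub>m 2) $$ (j, i)) = N (1\<^sub>m 2) $$ (i, j)" if "i < 2" "j < 2" for i j
    using arg_cong[OF N1h, of "\<lambda>M. M $$ (i, j)"] that by simp
  have "sigma_mat s = N (1\<^sub>m 2) - 1\<^sub>m 2" unfolding s_def
  proof (rule sigma_mat_pauli_coords)
    show "mat_adjoint (N (1\<^sub>m 2) - 1\<^sub>m 2) = N (1\<^sub>m 2) - 1\<^sub>m 2"
      by (rule eq_matI) (auto simp: hN1)
    have "mat_trace (N (1\<^sub>m 2)) = 2" by (simp add: tr) (simp add: mat_trace_def)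
    thus "mat_trace (N (1\<^sub>m 2) - 1\<^sub>m 2) = 0" by (simp add: mat_trace_def sum_lessThan_2)
  qed auto
  hence N1: "N (1\<^sub>m 2) = 1\<^sub>m 2 + sigma_mat s"
    by (intro eq_matI) auto
  have Nshift: "N (1\<^sub>m 2 + sigma_mat w) = 1\<^sub>m 2 + sigma_mat (s + f w)" for w
    by (simp add: N2 N1 Nsig sigma_mat_add) (rule eq_matI; simp)
  obtain x1 x2 x3 y1 y2 y3 D1 D2 D3 where fx: "right_handed_frame x1 x2 x3" and fy: "right_handed_frame y1 y2 y3"
    and sgn: "0 \<le> D1 \<and> 0 \<le> D2 \<and> 0 \<le> D3 \<or> D1 \<le> 0 \<and> D2 \<le> 0 \<and> D3 \<le> 0"
    and fD: "f y1 = D1 *\<^sub>R x1" "f y2 = D2 *\<^sub>R x2" "f y3 = D3 *\<^sub>R x3"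
    using svd_right_handed[OF linf] by blast
  obtain U where U: "is_unitary 2 U" and Ux: "sigma_mat x1 * U = U * pauli_X" "sigma_mat x2 * U = U * pauli_Y"
     "sigma_mat x3 * U = U * pauli_Z" using right_handed_frame_unitary[OF fx] by blast
  obtain V where V: "is_unitary 2 V" and Vy: "sigma_mat y1 * V = V * pauli_X" "sigma_mat y2 * V = V * pauli_Y"
     "sigma_mat y3 * V = V * pauli_Z" using right_handed_frame_unitary[OF fy] by blast
  have Uc [simp]: "U \<in> carrier_mat 2 2" and Vc [simp]: "V \<in> carrier_mat 2 2" using U V by (auto simp: is_unitary_def)
  have UU: "mat_adjoint U * U = 1\<^sub>m 2" "U * mat_adjoint U = 1\<^sub>m 2" and VV: "mat_adjoint V * V = 1\<^sub>m 2" "V * mat_adjoint V = 1\<^sub>m 2"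
    using U V by (auto simp: is_unitary_def)
  \<comment> \<open>The relation required of the normal form, solved for the inner map.\<close>
  define F where "F A = mat_adjoint U * N (V * A * mat_adjoint V) * U" for A
  have Vin [simp]: "V * A * mat_adjoint V \<in> carrier_mat 2 2" if "A \<in> carrier_mat 2 2" for A
    using that by (intro mult_carrier_mat[of _ 2 2]) auto
  have Uin: "mat_adjoint U * B * U \<in> carrier_mat 2 2" if "B \<in> carrier_mat 2 2" for B
    using that by (intro mult_carrier_mat[of _ 2 2]) auto
  have sand_add: "P * (A + B) * Q = P * A * Q + P * B * Q" 
    if "P \<in> carrier_mat 2 2" "A \<in> carrier_mat 2 2" "B \<in> carrier_mat 2 2" "Q \<in> carrier_mat 2 2" for P A B Q :: "complex mat"
    using that by (simp add: mult_add_distrib_mat[where nr = 2 and n = 2 and nc = 2] add_mult_distrib_mat[where nr = 2 and n = 2 and nc = 2])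
  have sand_smult: "P * (c \<cdot>\<^sub>m A) * Q = c \<cdot>\<^sub>m (P * A * Q)" 
    if "P \<in> carrier_mat 2 2" "A \<in> carrier_mat 2 2" "Q \<in> carrier_mat 2 2" for P A Q :: "complex mat" and c
    using that by (simp add: mult_smult_distrib[where nr = 2 and n = 2 and nc = 2] mult_smult_assoc_mat[where nr = 2 and n = 2 and nc = 2])
  have Flin: "linear_supermap 2 F"
    unfolding linear_supermap_def F_def by (auto simp: sand_add sand_smult N2 N3 Uin)
  have conjV: "V * (1\<^sub>m 2 + sigma_mat (vector [x, y, z])) * mat_adjoint V
     = 1\<^sub>m 2 + sigma_mat (x *\<^sub>R y1 + (y *\<^sub>R y2 + z *\<^sub>R y3))" for x y z
  proof -
    have "V * sigma_mat (vector [x, y, z]) * mat_adjoint V = sigma_mat (x *\<^sub>R y1 + (y *\<^sub>R y2 + z *\<^sub>R y3)) * V * mat_adjoint V"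
      by (simp only: sigma_mat_intertwine[OF Vc Vy])
    also have "\<dots> = sigma_mat (x *\<^sub>R y1 + (y *\<^sub>R y2 + z *\<^sub>R y3)) * (V * mat_adjoint V)"
      by (rule assoc_mult_mat[of _ 2 2 _ 2 _ 2]) auto
    finally show ?thesis by (simp add: sand_add VV right_mult_one_mat[OF Vc] del: assoc_mult_mat)
  qed
  have conjU: "mat_adjoint U * (1\<^sub>m 2 + sigma_mat (x *\<^sub>R x1 + (y *\<^sub>R x2 + z *\<^sub>R x3))) * U
     = 1\<^sub>m 2 + sigma_mat (vector [x, y, z])" for x y z
  proof -
    have "mat_adjoint U * sigma_mat (x *\<^sub>R x1 + (y *\<^sub>R x2 + z *\<^sub>R x3)) * U
      = mat_adjoint U * (sigma_mat (x *\<^sub>R x1 + (y *\<^sub>R x2 + z *\<^sub>R x3)) * U)"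
      by (rule assoc_mult_mat[of _ 2 2 _ 2 _ 2]) auto
    also have "\<dots> = mat_adjoint U * U * sigma_mat (vector [x, y, z])"
      unfolding sigma_mat_intertwine[OF Uc Ux] by (rule assoc_mult_mat[of _ 2 2 _ 2 _ 2, symmetric]) auto
    finally show ?thesis by (simp add: sand_add UU right_mult_one_mat[OF mat_adjoint_carrier[OF Uc]] del: assoc_mult_mat)
  qed
  have bl: "F (bloch x y z) = bloch (D1 * x + inner s x1) (D2 * y + inner s x2) (D3 * z + inner s x3)" for x y z
  proof -
    let ?w = "x *\<^sub>R y1 + (y *\<^sub>R y2 + z *\<^sub>R y3)"
    have "f ?w = x *\<^sub>R (D1 *\<^sub>R x1) + (y *\<^sub>R (D2 *\<^sub>R x2) + z *\<^sub>R (D3 *\<^sub>R x3))"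
      using linf by (simp add: linear_add linear_scale fD)
    hence sf: "s + f ?w = (D1 * x + inner s x1) *\<^sub>R x1 + ((D2 * y + inner s x2) *\<^sub>R x2 + (D3 * z + inner s x3) *\<^sub>R x3)"
      using frame_expansion[OF fx, of s] by (simp add: algebra_simps)
    have "F (bloch x y z) = (1 / 2) \<cdot>\<^sub>m (mat_adjoint U * N (1\<^sub>m 2 + sigma_mat ?w) * U)"
      by (simp add: F_def bloch_sigma_mat sand_smult N3 conjV del: assoc_mult_mat)
    also have "N (1\<^sub>m 2 + sigma_mat ?w) = 1\<^sub>m 2 + sigma_mat (s + f ?w)"
      by (rule Nshift)
    finally show ?thesis by (simp only: sf conjU bloch_sigma_mat)
  qed
  have NF: "N A = U * F (mat_adjoint V * A * V) * mat_adjoint U" if A: "A \<in> carrier_mat 2 2" for A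
  proof -
    have 1: "P * (Q * B * R) * T = (P * Q) * B * (R * T)" 
      if "P \<in> carrier_mat 2 2" "Q \<in> carrier_mat 2 2" "B \<in> carrier_mat 2 2" "R \<in> carrier_mat 2 2" "T \<in> carrier_mat 2 2"
      for P Q B R T :: "complex mat"
      using that by (simp add: assoc_mult_mat[of _ 2 2 _ 2 _ 2])
    have "V * (mat_adjoint V * A * V) * mat_adjoint V = A" using A by (simp add: 1 VV del: assoc_mult_mat)
    thus ?thesis unfolding F_def using A by (simp add: 1 UU del: assoc_mult_mat)
  qed
  have "channel_normal_form N U V (D1, D2, D3) (inner s x1, inner s x2, inner s x3)"
    unfolding channel_normal_form_def using U V sgn Flin bl NF by auto
  thus ?thesis by blast
qed

lemma contraction_coeff_eq:
  assumes lin: "linear_supermap 2 N" and herm: "hermiticity_preserving N"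
    and tr: "\<And>A. A \<in> carrier_mat 2 2 \<Longrightarrow> mat_trace (N A) = mat_trace A"
  shows "contraction_coeff N = (supermap_norm2 N - 1) / 3"
  unfolding contraction_coeff_def
proof (rule the_equality)
  show "\<exists>U V D1 D2 D3 t1 t2 t3. channel_normal_form N U V (D1, D2, D3) (t1, t2, t3) \<and>
     (supermap_norm2 N - 1) / 3 = (t1\<^sup>2 + t2\<^sup>2 + t3\<^sup>2 + D1\<^sup>2 + D2\<^sup>2 + D3\<^sup>2) / 3"
    using channel_normal_form_exists[OF assms] channel_normal_form_norm2
    by (metis add_diff_cancel_left')
qed (use channel_normal_form_norm2 in force)

section \<open>Kraus form of tensor powers\<close>

text \<open>Positive semidefiniteness in the form that the purity estimate consumes, a sum of
  rank-one terms. It passes through Kraus maps and Kronecker products by explicit formulas for the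
  vectors \<open>w\<close>.\<close>

definition gram_kernel :: "nat \<Rightarrow> (nat \<Rightarrow> nat \<Rightarrow> complex) \<Rightarrow> bool" where
  "gram_kernel d X \<longleftrightarrow> (\<exists>M (w :: nat \<Rightarrow> nat \<Rightarrow> complex). \<forall>i<d. \<forall>j<d. X i j = (\<Sum>m<(M::nat). w m i * cnj (w m j)))"

text \<open>Cholesky factorisation: eliminate the last index by a Schur complement.\<close>

lemma gram_kernel_of_positive:
  assumes "\<And>i j. i < d \<Longrightarrow> j < d \<Longrightarrow> X j i = cnj (X i j)"
    and "\<And>v. 0 \<le> Re (\<Sum>i<d. \<Sum>j<d. cnj (v i) * X i j * v j)"
  shows "gram_kernel d X"
  using assms
proof (induction d arbitrary: X)
  case 0
  thus ?case by (simp add: gram_kernel_def)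
next
  case (Suc d)
  define c where "c i = X i d" for i
  define p where "p = Re (X d d)"
  have herm: "X j i = cnj (X i j)" if "i < Suc d" "j < Suc d" for i j using Suc.prems(1) that .
  have Xdd: "X d d = complex_of_real p" using herm[of d d] by (simp add: p_def complex_eq_iff)
  have Xd: "X d j = cnj (c j)" if "j \<le> d" for j using herm[of j d] that by (simp add: c_def)
  have cd: "c d = complex_of_real p" by (simp add: c_def Xdd)
  have split: "(\<Sum>i<Suc d. \<Sum>j<Suc d. cnj (v i) * X i j * v j)
     = (\<Sum>i<d. \<Sum>j<d. cnj (v i) * X i j * v j) + cnj (v d) * (\<Sum>j<d. cnj (c j) * v j)
      + (\<Sum>i<d. cnj (v i) * c i) * v d + cnj (v d) * complex_of_real p * v d" for v
    by (simp add: sum.distrib Xd cd c_def[symmetric] sum_distrib_left sum_distrib_right mult_ac)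
  show ?case
  proof (cases "p > 0")
    case False
    have "0 \<le> Re (\<Sum>i<Suc d. \<Sum>j<Suc d. cnj (if i = d then 1 else 0) * X i j * (if j = d then 1 else 0))"
      by (rule Suc.prems(2))
    hence "0 \<le> p" unfolding split by simp
    with False have p0: "p = 0" by simp
    \<comment> \<open>A zero pivot forces its column to vanish: on a basis vector perturbed by
      \<open>- e\<close> in coordinate \<open>k\<close>, the form is linear in \<open>e\<close> up
      to a term in \<open>(cmod e)\<^sup>2\<close>.\<close>
    have c0: "c k = 0" if k: "k < d" for k
    proof -
      have "2 * Re (e * cnj (c k)) \<le> (cmod e)\<^sup>2 * Re (X k k)" for e
      proof -
        let ?v = "\<lambda>i. if i = d then 1 else if i = k then - e else 0"
        have "0 \<le> Re (\<Sum>i<Suc d. \<Sum>j<Suc d. cnj (?v i) * X i j * ?v j)" by (rule Suc.prems(2))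
        also have "(\<Sum>i<Suc d. \<Sum>j<Suc d. cnj (?v i) * X i j * ?v j)
          = (\<Sum>i<d. \<Sum>j<d. cnj (?v i) * X i j * ?v j) + (\<Sum>j<d. cnj (c j) * ?v j) + (\<Sum>i<d. cnj (?v i) * c i)"
          unfolding split p0 by simp
        also have "(\<Sum>j<d. cnj (c j) * ?v j) = (\<Sum>j<d. if j = k then cnj (c j) * (- e) else 0)"
          by (intro sum.cong) auto
        also have "\<dots> = - (e * cnj (c k))" using k by (simp add: mult.commute)
        also have "(\<Sum>i<d. cnj (?v i) * c i) = (\<Sum>i<d. if i = k then - (cnj e * c i) else 0)"
          by (intro sum.cong) auto
        also have "\<dots> = - (cnj e * c k)" using k by simp
        also have "(\<Sum>i<d. \<Sum>j<d. cnj (?v i) * X i j * ?v j)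
          = (\<Sum>i<d. \<Sum>j<d. if i = k then if j = k then cnj e * X i j * e else 0 else 0)"
          by (intro sum.cong refl) auto
        also have "\<dots> = (\<Sum>i<d. if i = k then cnj e * X i k * e else 0)"
          by (intro sum.cong refl) (use k in auto)
        also have "\<dots> = cnj e * X k k * e" using k by simp
        finally have "0 \<le> Re (cnj e * X k k * e) - 2 * Re (e * cnj (c k))" by simp
        moreover have "Re (cnj e * X k k * e) = (cmod e)\<^sup>2 * Re (X k k)"
          unfolding cmod_power2 using herm[of k k] k by (simp add: complex_eq_iff power2_eq_square algebra_simps)
        ultimately show ?thesis by simp
      qed
      from quadratic_perturbation_zero[OF this] show ?thesis by simp
    qed
    have "gram_kernel d X"
    proof (rule Suc.IH)
      show "X j i = cnj (X i j)" if "i < d" "j < d" for i j by (rule herm) (use that in auto)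
      show "0 \<le> Re (\<Sum>i<d. \<Sum>j<d. cnj (v i) * X i j * v j)" for v
      proof -
        have "0 \<le> Re (\<Sum>i<Suc d. \<Sum>j<Suc d. cnj (if i = d then 0 else v i) * X i j * (if j = d then 0 else v j))"
          by (rule Suc.prems(2))
        also have "(\<Sum>i<Suc d. \<Sum>j<Suc d. cnj (if i = d then 0 else v i) * X i j * (if j = d then 0 else v j))
          = (\<Sum>i<d. \<Sum>j<d. cnj (v i) * X i j * v j)"
          by (simp add: split)
        finally show ?thesis .
      qed
    qed
    then obtain M w where w: "\<And>i j. i < d \<Longrightarrow> j < d \<Longrightarrow> X i j = (\<Sum>m<(M::nat). w m i * cnj (w m j))"
      by (auto simp: gram_kernel_def)
    have "X i j = (\<Sum>m<M. ((w m)(d := 0)) i * cnj (((w m)(d := 0)) j))" if "i < Suc d" "j < Suc d" for i j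
    proof (cases "i = d \<or> j = d")
      case True
      hence "X i j = 0" using that c0 Xd Xdd p0 by (auto simp: less_Suc_eq c_def[symmetric])
      thus ?thesis using True by auto
    next
      case False
      thus ?thesis using that w by (auto simp: less_Suc_eq)
    qed
    thus ?thesis unfolding gram_kernel_def by (intro exI[of _ M] exI[of _ "\<lambda>m. (w m)(d := 0)"]) auto
  next
    case True
    define X' where "X' i j = X i j - c i * cnj (c j) / complex_of_real p" for i j
    have "gram_kernel d X'"
    proof (rule Suc.IH)
      show "X' j i = cnj (X' i j)" if "i < d" "j < d" for i j using herm[of i j] that by (simp add: X'_def)
      show "0 \<le> Re (\<Sum>i<d. \<Sum>j<d. cnj (v i) * X' i j * v j)" for v
      proof -
        define s where "s = (\<Sum>j<d. cnj (c j) * v j)"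
        \<comment> \<open>The last coordinate that minimises the quadratic form; the minimum is the
          form of the Schur complement.\<close>
        define z where "z = - s / complex_of_real p"
        let ?v = "v(d := z)"
        have cs: "(\<Sum>i<d. cnj (v i) * c i) = cnj s" by (simp add: s_def mult.commute)
        have "0 \<le> Re (\<Sum>i<Suc d. \<Sum>j<Suc d. cnj (?v i) * X i j * ?v j)" by (rule Suc.prems(2))
        also have "(\<Sum>i<Suc d. \<Sum>j<Suc d. cnj (?v i) * X i j * ?v j)
          = (\<Sum>i<d. \<Sum>j<d. cnj (v i) * X i j * v j) + cnj z * s + cnj s * z + cnj z * complex_of_real p * z"
          unfolding split by (simp add: s_def[symmetric] cs)
        also have "\<dots> = (\<Sum>i<d. \<Sum>j<d. cnj (v i) * X i j * v j) - cnj s * s / complex_of_real p"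
          using True by (simp add: z_def)
        also have "cnj s * s / complex_of_real p = (\<Sum>i<d. \<Sum>j<d. cnj (v i) * (c i * cnj (c j) / complex_of_real p) * v j)"
        proof -
          have "cnj s * s = (\<Sum>i<d. \<Sum>j<d. (cnj (v i) * c i) * (cnj (c j) * v j))"
            unfolding cs[symmetric] unfolding s_def by (rule sum_product)
          thus ?thesis by (simp add: sum_divide_distrib mult_ac)
        qed
        also have "(\<Sum>i<d. \<Sum>j<d. cnj (v i) * X i j * v j) - \<dots> = (\<Sum>i<d. \<Sum>j<d. cnj (v i) * X' i j * v j)"
          by (simp add: X'_def sum_subtractf algebra_simps)
        finally show ?thesis .
      qed
    qed
    then obtain M w where w: "\<And>i j. i < d \<Longrightarrow> j < d \<Longrightarrow> X' i j = (\<Sum>m<(M::nat). w m i * cnj (w m j))"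
      by (auto simp: gram_kernel_def)
    \<comment> \<open>The old vectors are extended by 0 at index \<open>d\<close>; the extra vector,
      the pivot column over \<open>sqrt p\<close>, supplies the last row and column and restores the
      subtracted term.\<close>
    define w' where "w' m = (if m < M then (w m)(d := 0) else (\<lambda>i. c i / complex_of_real (sqrt p)))" for m
    have sp: "complex_of_real (sqrt p) * complex_of_real (sqrt p) = complex_of_real p"
      using True by (simp flip: of_real_mult)
    have "X i j = (\<Sum>m<Suc M. w' m i * cnj (w' m j))" if ij: "i < Suc d" "j < Suc d" for i j
    proof -
      have "(\<Sum>m<Suc M. w' m i * cnj (w' m j)) = (\<Sum>m<M. ((w m)(d := 0)) i * cnj (((w m)(d := 0)) j)) + c i * cnj (c j) / complex_of_real p"
        by (simp add: w'_def sp)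
      also have "\<dots> = X i j"
      proof (cases "i = d \<or> j = d")
        case True
        have "X i d = c i" by (simp add: c_def)
        hence "c i * cnj (c j) / complex_of_real p = X i j"
          using True \<open>p > 0\<close> Xd[of j] ij cd by (elim disjE) simp_all
        thus ?thesis using True by auto
      next
        case False
        hence "i < d" "j < d" using ij by auto
        thus ?thesis using False by (simp add: w[symmetric] X'_def)
      qed
      finally show ?thesis by simp
    qed
    thus ?thesis unfolding gram_kernel_def by (intro exI[of _ "Suc M"] exI[of _ w']) auto
  qed
qed

lemma gram_kernel_of_pos_semidef:
  assumes "pos_semidef d A"
  shows "gram_kernel d (\<lambda>i j. A $$ (i, j))"
proof (rule gram_kernel_of_positive)
  have A: "A \<in> carrier_mat d d" and h: "mat_adjoint A = A"
    and pos: "\<And>v. v \<in> carrier_vec d \<Longrightarrow> 0 \<le> Re ((A *\<^sub>v v) \<bullet>c v)"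
    using assms by (auto simp: pos_semidef_def)
  show "A $$ (j, i) = cnj (A $$ (i, j))" if "i < d" "j < d" for i j
    using mat_adjoint_index[of j A i] A h that by auto
  show "0 \<le> Re (\<Sum>i<d. \<Sum>j<d. cnj (v i) * A $$ (i, j) * v j)" for v
  proof -
    have "(A *\<^sub>v vec d v) \<bullet>c vec d v = (\<Sum>i<d. \<Sum>j<d. cnj (v i) * A $$ (i, j) * v j)"
      using A by (simp add: scalar_prod_def atLeast0LessThan sum_distrib_left sum_distrib_right mult_ac)
    thus ?thesis using pos[of "vec d v"] by simp
  qed
qed

lemma sum_lessThan_prod_index:
  fixes f :: "nat \<Rightarrow> nat \<Rightarrow> 'a :: comm_monoid_add"
  shows "(\<Sum>m<A * B. f (m div B) (m mod B)) = (\<Sum>i<A. \<Sum>j<B. f i j)"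
proof -
  have "(\<Sum>i<A. \<Sum>j<B. f i j) = (\<Sum>(i, j)\<in>{..<A} \<times> {..<B}. f i j)" by (simp add: sum.cartesian_product)
  also have "\<dots> = (\<Sum>m<A * B. f (m div B) (m mod B))"
  proof (rule sum.reindex_bij_witness[where i = "\<lambda>m. (m div B, m mod B)" and j = "\<lambda>(i, j). i * B + j"], goal_cases)
    case (2 x)
    then obtain i j where x: "x = (i, j)" "i < A" "j < B" by auto
    have "i * B + j < (i + 1) * B" using x by simp
    also have "\<dots> \<le> A * B" using x by (intro mult_right_mono) auto
    finally show ?case using x by simp
  next
    case (4 m)
    hence "B > 0" by (cases B) auto
    thus ?case using 4 by (auto simp: less_mult_imp_div_less)
  qed auto
  finally show ?thesis by simp
qed

lemma sum_lessThan_prod_index':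
  fixes f :: "nat \<Rightarrow> 'a :: comm_monoid_add"
  shows "(\<Sum>m<A * B. f m) = (\<Sum>i<A. \<Sum>j<B. f (i * B + j))"
  using sum_lessThan_prod_index[where f = "\<lambda>i j. f (i * B + j)" and A = A and B = B] by simp

lemma prod_index_less: "i < A \<Longrightarrow> j < B \<Longrightarrow> i * B + j < A * (B :: nat)"
proof -
  assume "i < A" "j < B"
  hence "i * B + j < (i + 1) * B" by simp
  also have "\<dots> \<le> A * B" using \<open>i < A\<close> by (intro mult_right_mono) auto
  finally show ?thesis .
qed

section \<open>Kernel and Kraus operators of the tensor power\<close>

definition channel_tensor :: "(complex mat \<Rightarrow> complex mat) \<Rightarrow> nat \<Rightarrow> nat \<Rightarrow> nat \<Rightarrow> nat \<Rightarrow> complex" where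
  "channel_tensor N a b k l = N (matrix_unit 2 k l) $$ (a, b)"

text \<open>Indices are read in binary. The last qubit is the least significant digit, as in
  \<open>kron\<close>, so \<open>div 2\<close> and \<open>mod 2\<close> split it off.\<close>

fun power_tensor :: "(complex mat \<Rightarrow> complex mat) \<Rightarrow> nat \<Rightarrow> nat \<Rightarrow> nat \<Rightarrow> nat \<Rightarrow> nat \<Rightarrow> complex" where
  "power_tensor N 0 a b i j = 1"
| "power_tensor N (Suc n) a b i j = power_tensor N n (a div 2) (b div 2) (i div 2) (j div 2)
     * channel_tensor N (a mod 2) (b mod 2) (i mod 2) (j mod 2)"

text \<open>Replaces the nested tensor products of maps by one explicit kernel, through which the
  tensor power is handled from here on.\<close>

lemma channel_power_index:
  assumes N: "\<And>X. X \<in> carrier_mat 2 2 \<Longrightarrow> N X \<in> carrier_mat 2 2"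
  shows "X \<in> carrier_mat (2 ^ n) (2 ^ n) \<Longrightarrow> channel_power N n X \<in> carrier_mat (2 ^ n) (2 ^ n) \<and>
    (\<forall>a<2 ^ n. \<forall>b<2 ^ n. channel_power N n X $$ (a, b) = (\<Sum>i<2 ^ n. \<Sum>j<2 ^ n. X $$ (i, j) * power_tensor N n a b i j))"
proof (induction n arbitrary: X)
  case 0
  thus ?case by simp
next
  case (Suc n)
  let ?P = "channel_power N n"
  have Pc: "?P (matrix_unit (2 ^ n) i j) \<in> carrier_mat (2 ^ n) (2 ^ n)" for i j
    using Suc.IH[of "matrix_unit (2 ^ n) i j"] by simp
  have PE: "?P (matrix_unit (2 ^ n) i j) $$ (a, b) = power_tensor N n a b i j"
    if "i < 2 ^ n" "j < 2 ^ n" "a < 2 ^ n" "b < 2 ^ n" for i j a b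
  proof -
    have "?P (matrix_unit (2 ^ n) i j) $$ (a, b)
      = (\<Sum>i'<2 ^ n. \<Sum>j'<2 ^ n. matrix_unit (2 ^ n) i j $$ (i', j') * power_tensor N n a b i' j')"
      using Suc.IH[of "matrix_unit (2 ^ n) i j"] that by simp
    also have "\<dots> = (\<Sum>i'<2 ^ n. if i' = i then (\<Sum>j'<2 ^ n. if j' = j then power_tensor N n a b i' j' else 0) else 0)"
      by (intro sum.cong refl) (auto simp: matrix_unit_index if_distrib[of "\<lambda>x. x * _"] cong: if_cong)
    also have "\<dots> = power_tensor N n a b i j" using that by simp
    finally show ?thesis .
  qed
  have d: "dim_row (?P (matrix_unit (2 ^ n) i j)) = 2 ^ n" "dim_col (?P (matrix_unit (2 ^ n) i j)) = 2 ^ n"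
    "dim_row (N (matrix_unit 2 k l)) = 2" "dim_col (N (matrix_unit 2 k l)) = 2" for i j k l
    using Pc[of i j] N[OF matrix_unit_carrier, of k l] by auto
  have "channel_power N (Suc n) X $$ (a, b) = (\<Sum>i<2 ^ Suc n. \<Sum>j<2 ^ Suc n. X $$ (i, j) * power_tensor N (Suc n) a b i j)"
    if ab: "a < 2 ^ Suc n" "b < 2 ^ Suc n" for a b
  proof -
    have ab': "a div 2 < 2 ^ n" "b div 2 < 2 ^ n" "a < 2 ^ n * 2" "b < 2 ^ n * 2" using ab by auto
    have "channel_power N (Suc n) X $$ (a, b) = (\<Sum>i<2 ^ n. \<Sum>j<2 ^ n. \<Sum>k<2. \<Sum>l<2.
       X $$ (i * 2 + k, j * 2 + l) * kron (?P (matrix_unit (2 ^ n) i j)) (N (matrix_unit 2 k l)) $$ (a, b))"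
      using ab' by (simp add: tensor_supermap_def)
    also have "\<dots> = (\<Sum>i<2 ^ n. \<Sum>j<2 ^ n. \<Sum>k<2. \<Sum>l<2. X $$ (i * 2 + k, j * 2 + l) * power_tensor N (Suc n) a b (i * 2 + k) (j * 2 + l))"
      by (intro sum.cong refl arg_cong2[where f = "(*)"])
        (use ab' in \<open>auto simp: kron_def d PE channel_tensor_def\<close>)
    also have "\<dots> = (\<Sum>i<2 ^ n. \<Sum>k<2. \<Sum>j<2 ^ n. \<Sum>l<2. X $$ (i * 2 + k, j * 2 + l) * power_tensor N (Suc n) a b (i * 2 + k) (j * 2 + l))"
      by (intro sum.cong refl sum.swap)
    also have "\<dots> = (\<Sum>i<2 ^ n * 2. \<Sum>j<2 ^ n * 2. X $$ (i, j) * power_tensor N (Suc n) a b i j)"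
      by (simp only: sum_lessThan_prod_index')
    finally show ?thesis by (simp add: mult.commute)
  qed
  moreover have "channel_power N (Suc n) X \<in> carrier_mat (2 ^ Suc n) (2 ^ Suc n)"
    by (simp add: tensor_supermap_def mult.commute)
  ultimately show ?case by blast
qed

text \<open>Choi's theorem: complete positivity is applied to the unnormalised maximally entangled
  state, and the Gram vectors of the resulting Choi matrix, cut into blocks, are Kraus
  operators.\<close>

lemma channel_tensor_gram:
  assumes cp: "completely_positive 2 N" and N: "\<And>X. X \<in> carrier_mat 2 2 \<Longrightarrow> N X \<in> carrier_mat 2 2"
  shows "\<exists>M K. \<forall>a<2. \<forall>b<2. \<forall>i<2. \<forall>j<2. channel_tensor N a b i j = (\<Sum>m<(M::nat). K m a i * cnj (K m b j))"
proof -
  \<comment> \<open>The vector \<open>e\<^sub>0 \<otimes> e\<^sub>0 + e\<^sub>1 \<otimes>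
    e\<^sub>1\<close>, supported below 4 on the indices 0 and 3.\<close>
  define om :: "nat \<Rightarrow> complex" where "om r = (if r div 2 = r mod 2 then 1 else 0)" for r
  define X where "X = mat 4 4 (\<lambda>(r, c). om r * om c)"
  have cnj_om: "cnj (om r) = om r" for r by (simp add: om_def)
  have "pos_semidef (2 * 2) X"
    unfolding pos_semidef_def
  proof (intro conjI ballI)
    show "X \<in> carrier_mat (2 * 2) (2 * 2)" by (simp add: X_def)
    show "mat_adjoint X = X" by (rule eq_matI) (auto simp: X_def cnj_om)
    fix v :: "complex vec" assume v: "v \<in> carrier_vec (2 * 2)"
    define s where "s = (\<Sum>j<4. om j * v $ j)"
    have "(X *\<^sub>v v) \<bullet>c v = (\<Sum>i<4. (\<Sum>j<4. om i * om j * v $ j) * cnj (v $ i))"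
      using v by (simp add: scalar_prod_def atLeast0LessThan X_def)
    also have "\<dots> = s * cnj s"
      by (simp add: s_def cnj_om sum_distrib_left sum_distrib_right mult_ac)
    also have "Re (s * cnj s) = (cmod s)\<^sup>2" by (metis Re_complex_of_real complex_norm_square)
    finally show "0 \<le> Re ((X *\<^sub>v v) \<bullet>c v)" by simp
  qed
  hence ps: "pos_semidef (2 * 2) (tensor_supermap 2 2 (\<lambda>A. A) N X)"
    using cp unfolding completely_positive_def by blast
  have entry: "tensor_supermap 2 2 (\<lambda>A. A) N X $$ (i * 2 + a, j * 2 + b) = channel_tensor N a b i j"
    if "a < 2" "b < 2" "i < 2" "j < 2" for a b i j
  proof -
    have dN: "dim_row (N (matrix_unit 2 k l)) = 2" "dim_col (N (matrix_unit 2 k l)) = 2" for k l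
      using N[OF matrix_unit_carrier, of k l] by auto
    have lt: "i * 2 + a < 2 * 2" "j * 2 + b < 2 * 2" using that by auto
    have "tensor_supermap 2 2 (\<lambda>A. A) N X $$ (i * 2 + a, j * 2 + b)
      = (\<Sum>i'<2. \<Sum>j'<2. \<Sum>k<2. \<Sum>l<2. X $$ (i' * 2 + k, j' * 2 + l) *
          kron (matrix_unit 2 i' j') (N (matrix_unit 2 k l)) $$ (i * 2 + a, j * 2 + b))"
      using lt by (simp add: tensor_supermap_def)
    also have "\<dots> = (\<Sum>i'<2. \<Sum>j'<2. \<Sum>k<2. \<Sum>l<2. (if k = i' \<and> l = j' then 1 else 0) *
          ((if i = i' \<and> j = j' then 1 else 0) * N (matrix_unit 2 k l) $$ (a, b)))"
    proof (intro sum.cong refl arg_cong2[where f = "(*)"])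
      fix i' j' k l :: nat assume "i' \<in> {..<2}" "j' \<in> {..<2}" "k \<in> {..<2}" "l \<in> {..<2}"
      thus "X $$ (i' * 2 + k, j' * 2 + l) = (if k = i' \<and> l = j' then 1 else 0)"
        by (auto simp: X_def om_def)
      show "kron (matrix_unit 2 i' j') (N (matrix_unit 2 k l)) $$ (i * 2 + a, j * 2 + b)
        = (if i = i' \<and> j = j' then 1 else 0) * N (matrix_unit 2 k l) $$ (a, b)"
        using that lt by (simp add: kron_def dN matrix_unit_index)
    qed
    also have "\<dots> = channel_tensor N a b i j"
      using that unfolding sum_lessThan_2 channel_tensor_def by (auto dest!: less_2_cases)
    finally show ?thesis .
  qed
  from gram_kernel_of_pos_semidef[OF ps] obtain M w where
    w: "\<And>r c. r < 4 \<Longrightarrow> c < 4 \<Longrightarrow> tensor_supermap 2 2 (\<lambda>A. A) N X $$ (r, c) = (\<Sum>m<(M::nat). w m r * cnj (w m c))"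
    by (auto simp: gram_kernel_def)
  have "channel_tensor N a b i j = (\<Sum>m<M. w m (i * 2 + a) * cnj (w m (j * 2 + b)))" if "a < 2" "b < 2" "i < 2" "j < 2" for a b i j
    using entry[OF that] w[of "i * 2 + a" "j * 2 + b"] that by simp
  thus ?thesis by (intro exI[of _ M] exI[of _ "\<lambda>m a i. w m (i * 2 + a)"]) auto
qed

text \<open>The matrices \<open>K m\<close> are Kraus operators of the tensor power.\<close>

lemma power_tensor_gram:
  assumes "completely_positive 2 N" "\<And>X. X \<in> carrier_mat 2 2 \<Longrightarrow> N X \<in> carrier_mat 2 2"
  shows "\<exists>M K. \<forall>a<2 ^ n. \<forall>b<2 ^ n. \<forall>i<2 ^ n. \<forall>j<2 ^ n. power_tensor N n a b i j = (\<Sum>m<(M::nat). K m a i * cnj (K m b j))"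
proof (induction n)
  case 0
  show ?case by (rule exI[of _ 1], rule exI[of _ "\<lambda>_ _ _. 1"]) simp
next
  case (Suc n)
  then obtain M K where K: "\<And>a b i j. a < 2 ^ n \<Longrightarrow> b < 2 ^ n \<Longrightarrow> i < 2 ^ n \<Longrightarrow> j < 2 ^ n \<Longrightarrow>
     power_tensor N n a b i j = (\<Sum>m<(M::nat). K m a i * cnj (K m b j))" by blast
  obtain M' K' where K': "\<And>a b i j. a < 2 \<Longrightarrow> b < 2 \<Longrightarrow> i < 2 \<Longrightarrow> j < 2 \<Longrightarrow>
     channel_tensor N a b i j = (\<Sum>m<(M'::nat). K' m a i * cnj (K' m b j))" using channel_tensor_gram[OF assms] by blast
  \<comment> \<open>All Kronecker products of a Kraus operator of the first \<open>n\<close> qubits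
    with one of the last; \<open>m\<close> packs the two labels.\<close>
  define L where "L m a i = K (m div M') (a div 2) (i div 2) * K' (m mod M') (a mod 2) (i mod 2)" for m a i
  have "power_tensor N (Suc n) a b i j = (\<Sum>m<M * M'. L m a i * cnj (L m b j))"
    if "a < 2 ^ Suc n" "b < 2 ^ Suc n" "i < 2 ^ Suc n" "j < 2 ^ Suc n" for a b i j
  proof -
    have lt: "a div 2 < 2 ^ n" "b div 2 < 2 ^ n" "i div 2 < 2 ^ n" "j div 2 < 2 ^ n" using that by auto
    have "(\<Sum>m<M * M'. L m a i * cnj (L m b j)) = (\<Sum>p<M. \<Sum>q<M'.
      (K p (a div 2) (i div 2) * K' q (a mod 2) (i mod 2)) * cnj (K p (b div 2) (j div 2) * K' q (b mod 2) (j mod 2)))"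
      unfolding L_def by (rule sum_lessThan_prod_index)
    also have "\<dots> = power_tensor N (Suc n) a b i j"
      by (simp add: K[OF lt] K' sum_distrib_left sum_distrib_right mult_ac)
    finally show ?thesis by simp
  qed
  thus ?case by blast
qed

lemma power_tensor_trace:
  assumes "\<And>k l. k < 2 \<Longrightarrow> l < 2 \<Longrightarrow> (\<Sum>a<2. channel_tensor N a a k l) = (if k = l then 1 else 0)"
  shows "i < 2 ^ n \<Longrightarrow> j < 2 ^ n \<Longrightarrow> (\<Sum>a<2 ^ n. power_tensor N n a a i j) = (if i = j then 1 else 0)"
proof (induction n arbitrary: i j)
  case 0
  thus ?case by simp
next
  case (Suc n)
  have lt: "i div 2 < 2 ^ n" "j div 2 < 2 ^ n" using Suc.prems by auto
  have "(\<Sum>a<2 ^ Suc n. power_tensor N (Suc n) a a i j)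
    = (\<Sum>a<2 ^ n * 2. power_tensor N n (a div 2) (a div 2) (i div 2) (j div 2) * channel_tensor N (a mod 2) (a mod 2) (i mod 2) (j mod 2))"
    by (simp add: mult.commute)
  also have "\<dots> = (\<Sum>p<2 ^ n. \<Sum>q<2. power_tensor N n p p (i div 2) (j div 2) * channel_tensor N q q (i mod 2) (j mod 2))"
    by (rule sum_lessThan_prod_index)
  also have "\<dots> = (\<Sum>p<2 ^ n. power_tensor N n p p (i div 2) (j div 2)) * (\<Sum>q<2. channel_tensor N q q (i mod 2) (j mod 2))"
    by (simp add: sum_product)
  also have "\<dots> = (if i div 2 = j div 2 \<and> i mod 2 = j mod 2 then 1 else 0)"
    using Suc.IH[OF lt] assms[of "i mod 2" "j mod 2"] by simp
  also have "(i div 2 = j div 2 \<and> i mod 2 = j mod 2) \<longleftrightarrow> i = j" by (metis div_mult_mod_eq)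
  finally show ?case .
qed

section \<open>States of the circuit\<close>

definition gram_state :: "nat \<Rightarrow> complex mat \<Rightarrow> bool" where
  "gram_state d X \<longleftrightarrow> X \<in> carrier_mat d d \<and> gram_kernel d (\<lambda>i j. X $$ (i, j)) \<and> mat_trace X = 1"

lemma density_operator_gram_state: "density_operator d X \<Longrightarrow> gram_state d X"
  by (auto simp: gram_state_def density_operator_def gram_kernel_of_pos_semidef pos_semidef_def)

text \<open>The Gram vectors of the output are the Kraus operators applied to those of the input,
  over all pairs of labels.\<close>

lemma gram_kernel_kraus:
  assumes "gram_kernel d X"
    and K: "\<And>a b i j. a < d \<Longrightarrow> b < d \<Longrightarrow> i < d \<Longrightarrow> j < d \<Longrightarrow> T a b i j = (\<Sum>m<(M::nat). K m a i * cnj (K m b j))"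
  shows "gram_kernel d (\<lambda>a b. \<Sum>i<d. \<Sum>j<d. X i j * T a b i j)"
proof -
  obtain R w where w: "\<And>i j. i < d \<Longrightarrow> j < d \<Longrightarrow> X i j = (\<Sum>m<(R::nat). w m i * cnj (w m j))"
    using assms(1) by (auto simp: gram_kernel_def)
  define z where "z q a = (\<Sum>i<d. K (q div R) a i * w (q mod R) i)" for q a
  have "(\<Sum>i<d. \<Sum>j<d. X i j * T a b i j) = (\<Sum>q<M * R. z q a * cnj (z q b))" if ab: "a < d" "b < d" for a b
  proof -
    have "(\<Sum>i<d. \<Sum>j<d. X i j * T a b i j)
      = (\<Sum>i<d. \<Sum>j<d. \<Sum>m<M. \<Sum>r<R. (K m a i * w r i) * cnj (K m b j * w r j))"
      by (intro sum.cong refl) (simp add: w K[OF ab] sum_product mult_ac, rule sum.swap)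
    also have "\<dots> = (\<Sum>i<d. \<Sum>m<M. \<Sum>j<d. \<Sum>r<R. (K m a i * w r i) * cnj (K m b j * w r j))"
      by (intro sum.cong refl sum.swap)
    also have "\<dots> = (\<Sum>m<M. \<Sum>i<d. \<Sum>j<d. \<Sum>r<R. (K m a i * w r i) * cnj (K m b j * w r j))"
      by (rule sum.swap)
    also have "\<dots> = (\<Sum>m<M. \<Sum>i<d. \<Sum>r<R. \<Sum>j<d. (K m a i * w r i) * cnj (K m b j * w r j))"
      by (intro sum.cong refl sum.swap)
    also have "\<dots> = (\<Sum>m<M. \<Sum>r<R. \<Sum>i<d. \<Sum>j<d. (K m a i * w r i) * cnj (K m b j * w r j))"
      by (intro sum.cong refl sum.swap)
    also have "\<dots> = (\<Sum>m<M. \<Sum>r<R. (\<Sum>i<d. K m a i * w r i) * cnj (\<Sum>j<d. K m b j * w r j))"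
      by (simp add: sum_product)
    also have "\<dots> = (\<Sum>q<M * R. z q a * cnj (z q b))"
      unfolding z_def by (rule sum_lessThan_prod_index[symmetric])
    finally show ?thesis .
  qed
  thus ?thesis unfolding gram_kernel_def by blast
qed

text \<open>A common interface for the gates, with a single Kraus operator, and for the
  noise.\<close>

lemma gram_state_kraus:
  assumes X: "gram_state d X" and Y: "Y \<in> carrier_mat d d"
    and YX: "\<And>a b. a < d \<Longrightarrow> b < d \<Longrightarrow> Y $$ (a, b) = (\<Sum>i<d. \<Sum>j<d. X $$ (i, j) * T a b i j)"
    and K: "\<And>a b i j. a < d \<Longrightarrow> b < d \<Longrightarrow> i < d \<Longrightarrow> j < d \<Longrightarrow> T a b i j = (\<Sum>m<(M::nat). K m a i * cnj (K m b j))"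
    and tr: "\<And>i j. i < d \<Longrightarrow> j < d \<Longrightarrow> (\<Sum>a<d. T a a i j) = (if i = j then 1 else 0)"
  shows "gram_state d Y"
proof -
  have Xc: "X \<in> carrier_mat d d" and g: "gram_kernel d (\<lambda>i j. X $$ (i, j))" and t: "mat_trace X = 1"
    using X by (auto simp: gram_state_def)
  have "gram_kernel d (\<lambda>i j. Y $$ (i, j))"
    using gram_kernel_kraus[OF g K] YX unfolding gram_kernel_def by auto
  moreover have "mat_trace Y = mat_trace X"
  proof -
    have "mat_trace Y = (\<Sum>a<d. \<Sum>i<d. \<Sum>j<d. X $$ (i, j) * T a a i j)"
      using Y YX by (simp add: mat_trace_def)
    also have "\<dots> = (\<Sum>i<d. \<Sum>a<d. \<Sum>j<d. X $$ (i, j) * T a a i j)" by (rule sum.swap)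
    also have "\<dots> = (\<Sum>i<d. \<Sum>j<d. \<Sum>a<d. X $$ (i, j) * T a a i j)" by (intro sum.cong refl sum.swap)
    also have "\<dots> = (\<Sum>i<d. \<Sum>j<d. if i = j then X $$ (i, j) else 0)"
      by (intro sum.cong refl) (simp add: sum_distrib_left[symmetric] tr)
    also have "\<dots> = mat_trace X" using Xc by (simp add: mat_trace_def)
    finally show ?thesis .
  qed
  ultimately show ?thesis using Y t by (simp add: gram_state_def)
qed

lemma gram_state_unitary_conj:
  assumes X: "gram_state d X" and U: "is_unitary d U"
  shows "gram_state d (U * X * mat_adjoint U)"
proof (rule gram_state_kraus[OF X, where T = "\<lambda>a b i j. U $$ (a, i) * cnj (U $$ (b, j))" and M = 1 and K = "\<lambda>_ a i. U $$ (a, i)"])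
  have Uc: "U \<in> carrier_mat d d" and Xc: "X \<in> carrier_mat d d" using U X by (auto simp: is_unitary_def gram_state_def)
  show "U * X * mat_adjoint U \<in> carrier_mat d d"
    using Uc Xc mat_adjoint_carrier[OF Uc] by (intro mult_carrier_mat)
  show "(U * X * mat_adjoint U) $$ (a, b) = (\<Sum>i<d. \<Sum>j<d. X $$ (i, j) * (U $$ (a, i) * cnj (U $$ (b, j))))"
    if "a < d" "b < d" for a b
    by (subst sandwich_index[OF Uc Xc mat_adjoint_carrier[OF Uc] that]) (use Uc that in \<open>auto intro!: sum.cong simp: mult_ac\<close>)
  show "(\<Sum>a<d. U $$ (a, i) * cnj (U $$ (a, j))) = (if i = j then 1 else 0)" if "i < d" "j < d" for i j
    using unitary_isometry(2)[OF U that] .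
qed auto

section \<open>Unitarity of the brickwall layers\<close>

lemma kron_carrier: "A \<in> carrier_mat a b \<Longrightarrow> B \<in> carrier_mat c d \<Longrightarrow> kron A B \<in> carrier_mat (a * c) (b * d)"
  by (auto simp: kron_def)

lemma kron_index:
  "A \<in> carrier_mat a b \<Longrightarrow> B \<in> carrier_mat c d \<Longrightarrow> i < a * c \<Longrightarrow> j < b * d \<Longrightarrow>
    kron A B $$ (i, j) = A $$ (i div c, j div d) * B $$ (i mod c, j mod d)"
  by (auto simp: kron_def)

lemma div_mod_less_prod:
  assumes "i < a * (c::nat)"
  shows "i div c < a" "i mod c < c"
proof -
  have "c > 0" using assms by (cases c) auto
  thus "i div c < a" "i mod c < c" using assms by (auto simp: less_mult_imp_div_less)
qed

lemma is_unitaryI: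
  assumes U: "U \<in> carrier_mat d d"
    and iso: "\<And>i j. i < d \<Longrightarrow> j < d \<Longrightarrow> (\<Sum>a<d. cnj (U $$ (a, i)) * U $$ (a, j)) = (if i = j then 1 else 0)"
  shows "is_unitary d U"
proof -
  have "mat_adjoint U * U = 1\<^sub>m d"
    by (rule eq_matI) (use U iso in \<open>auto simp: scalar_prod_def atLeast0LessThan\<close>)
  thus ?thesis using mat_mult_left_right_inverse[OF mat_adjoint_carrier[OF U] U] U by (simp add: is_unitary_def)
qed

lemma is_unitary_kron:
  assumes A: "is_unitary d A" and B: "is_unitary e B"
  shows "is_unitary (d * e) (kron A B)"
proof (rule is_unitaryI)
  have Ac: "A \<in> carrier_mat d d" and Bc: "B \<in> carrier_mat e e" using A B by (auto simp: is_unitary_def)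
  show "kron A B \<in> carrier_mat (d * e) (d * e)" by (rule kron_carrier[OF Ac Bc])
  fix i j assume ij: "i < d * e" "j < d * e"
  note lt = div_mod_less_prod[OF ij(1)] div_mod_less_prod[OF ij(2)]
  have "(\<Sum>a<d * e. cnj (kron A B $$ (a, i)) * kron A B $$ (a, j))
    = (\<Sum>a<d * e. cnj (A $$ (a div e, i div e) * B $$ (a mod e, i mod e)) * (A $$ (a div e, j div e) * B $$ (a mod e, j mod e)))"
    using ij by (intro sum.cong refl) (simp add: kron_index[OF Ac Bc])
  also have "\<dots> = (\<Sum>p<d. \<Sum>q<e. cnj (A $$ (p, i div e) * B $$ (q, i mod e)) * (A $$ (p, j div e) * B $$ (q, j mod e)))"
    by (rule sum_lessThan_prod_index)
  also have "\<dots> = (\<Sum>p<d. cnj (A $$ (p, i div e)) * A $$ (p, j div e)) * (\<Sum>q<e. cnj (B $$ (q, i mod e)) * B $$ (q, j mod e))"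
    unfolding sum_product by (simp add: mult_ac)
  also have "\<dots> = (if i div e = j div e \<and> i mod e = j mod e then 1 else 0)"
    using unitary_isometry(1)[OF A lt(1) lt(3)] unitary_isometry(1)[OF B lt(2) lt(4)] by simp
  also have "(i div e = j div e \<and> i mod e = j mod e) \<longleftrightarrow> i = j" by (metis div_mult_mod_eq)
  finally show "(\<Sum>a<d * e. cnj (kron A B $$ (a, i)) * kron A B $$ (a, j)) = (if i = j then 1 else 0)" .
qed

lemma is_unitary_one: "is_unitary d (1\<^sub>m d)"
  by (rule is_unitaryI) (auto simp: if_distrib[of cnj] if_distrib[of "\<lambda>x. x * _"] cong: if_cong)

lemma is_unitary_mult:
  assumes A: "is_unitary d A" and B: "is_unitary d B"
  shows "is_unitary d (A * B)"
proof (rule is_unitaryI)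
  have Ac: "A \<in> carrier_mat d d" and Bc: "B \<in> carrier_mat d d" using A B by (auto simp: is_unitary_def)
  show "A * B \<in> carrier_mat d d" using Ac Bc by simp
  fix i j assume ij: "i < d" "j < d"
  have AB: "(A * B) $$ (a, i) = (\<Sum>k<d. A $$ (a, k) * B $$ (k, i))" if "a < d" "i < d" for a i
    using Ac Bc that by (simp add: scalar_prod_def atLeast0LessThan)
  have "(\<Sum>a<d. cnj ((A * B) $$ (a, i)) * (A * B) $$ (a, j))
    = (\<Sum>a<d. \<Sum>k<d. \<Sum>l<d. (cnj (B $$ (k, i)) * B $$ (l, j)) * (cnj (A $$ (a, k)) * A $$ (a, l)))"
    using ij by (intro sum.cong refl) (simp add: AB sum_product mult_ac, rule sum.swap)
  also have "\<dots> = (\<Sum>k<d. \<Sum>a<d. \<Sum>l<d. (cnj (B $$ (k, i)) * B $$ (l, j)) * (cnj (A $$ (a, k)) * A $$ (a, l)))"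
    by (rule sum.swap)
  also have "\<dots> = (\<Sum>k<d. \<Sum>l<d. \<Sum>a<d. (cnj (B $$ (k, i)) * B $$ (l, j)) * (cnj (A $$ (a, k)) * A $$ (a, l)))"
    by (intro sum.cong refl sum.swap)
  also have "\<dots> = (\<Sum>k<d. \<Sum>l<d. if k = l then cnj (B $$ (k, i)) * B $$ (l, j) else 0)"
    by (intro sum.cong refl) (simp add: sum_distrib_left[symmetric] unitary_isometry(1)[OF A])
  also have "\<dots> = (if i = j then 1 else 0)" using unitary_isometry(1)[OF B ij] by simp
  finally show "(\<Sum>a<d. cnj ((A * B) $$ (a, i)) * (A * B) $$ (a, j)) = (if i = j then 1 else 0)" .
qed

lemma is_unitary_two_qubit_gate:
  assumes g: "is_unitary 4 g" and i: "1 \<le> i" "i < n"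
  shows "is_unitary (2 ^ n) (two_qubit_gate n i g)"
proof -
  have "is_unitary (2 ^ (i - 1) * 4 * 2 ^ (n - i - 1)) (two_qubit_gate n i g)"
    unfolding two_qubit_gate_def by (intro is_unitary_kron is_unitary_one g)
  also have "(4::nat) = 2 ^ 2" by simp
  also have "(2::nat) ^ (i - 1) * 2 ^ 2 * 2 ^ (n - i - 1) = 2 ^ (i - 1 + 2 + (n - i - 1))" by (simp only: power_add)
  also have "i - 1 + 2 + (n - i - 1) = n" using i by simp
  finally show ?thesis .
qed

lemma is_unitary_layer_unitary:
  assumes g: "\<And>j i. is_unitary 4 (g j i)"
  shows "is_unitary (2 ^ n) (layer_unitary n g l)"
proof -
  have *: "is_unitary (2 ^ n) (foldr (\<lambda>i M. two_qubit_gate n i (g l i) * M) xs (1\<^sub>m (2 ^ n)))"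
    if "set xs \<subseteq> {1..<n}" for xs
    using that by (induction xs) (auto intro!: is_unitary_mult is_unitary_two_qubit_gate g is_unitary_one)
  show ?thesis unfolding layer_unitary_def by (rule *) (auto simp: brick_positions_def)
qed

section \<open>The states of the circuit, and Hermiticity of the channel\<close>

lemma quantum_channel_carrier: "quantum_channel 2 N \<Longrightarrow> X \<in> carrier_mat 2 2 \<Longrightarrow> N X \<in> carrier_mat 2 2"
  by (auto simp: quantum_channel_def linear_supermap_def)

lemma channel_tensor_trace:
  assumes N: "quantum_channel 2 N" and kl: "k < 2" "l < 2"
  shows "(\<Sum>a<2. channel_tensor N a a k l) = (if k = l then 1 else 0)"
proof -
  have "N (matrix_unit 2 k l) \<in> carrier_mat 2 2" using quantum_channel_carrier[OF N] by simp
  hence "(\<Sum>a<2. channel_tensor N a a k l) = mat_trace (N (matrix_unit 2 k l))"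
    by (simp add: mat_trace_def channel_tensor_def)
  also have "\<dots> = mat_trace (matrix_unit 2 k l)" using N by (simp add: quantum_channel_def)
  also have "\<dots> = (if k = l then 1 else 0)" using kl
    by (auto simp: mat_trace_def sum_lessThan_2 matrix_unit_index dest!: less_2_cases)
  finally show ?thesis .
qed

lemma gram_state_channel_power:
  assumes N: "quantum_channel 2 N" and X: "gram_state (2 ^ n) X"
  shows "gram_state (2 ^ n) (channel_power N n X)"
proof -
  have Xc: "X \<in> carrier_mat (2 ^ n) (2 ^ n)" using X by (simp add: gram_state_def)
  have cp: "completely_positive 2 N" using N by (simp add: quantum_channel_def)
  have Nc: "N Z \<in> carrier_mat 2 2" if "Z \<in> carrier_mat 2 2" for Z using quantum_channel_carrier[OF N that] .
  obtain M K where K: "\<And>a b i j. a < 2 ^ n \<Longrightarrow> b < 2 ^ n \<Longrightarrow> i < 2 ^ n \<Longrightarrow> j < 2 ^ n \<Longrightarrow>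
     power_tensor N n a b i j = (\<Sum>m<(M::nat). K m a i * cnj (K m b j))"
    using power_tensor_gram[where N = N, OF cp Nc, of n] by auto
  note P = channel_power_index[where N = N, OF Nc Xc]
  show ?thesis
  proof (rule gram_state_kraus[OF X, where T = "power_tensor N n"])
    show "power_tensor N n a b i j = (\<Sum>m<M. K m a i * cnj (K m b j))"
      if "a < 2 ^ n" "b < 2 ^ n" "i < 2 ^ n" "j < 2 ^ n" for a b i j using K that by blast
    show "(\<Sum>a<2 ^ n. power_tensor N n a a i j) = (if i = j then 1 else 0)" if "i < 2 ^ n" "j < 2 ^ n" for i j
      by (rule power_tensor_trace[OF channel_tensor_trace[OF N] that])
  qed (use P in auto)
qed

lemma gram_state_circuit:
  assumes N: "quantum_channel 2 N" and g: "\<And>j i. is_unitary 4 (g j i)" and X: "gram_state (2 ^ n) X"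
  shows "gram_state (2 ^ n) (circuit_state N n g X l)"
  by (induction l) (use X in \<open>auto simp: noisy_layer_def intro!: gram_state_channel_power[OF N] gram_state_unitary_conj is_unitary_layer_unitary g\<close>)

lemma gram_state_kron:
  assumes A: "gram_state d A" and B: "gram_state e B"
  shows "gram_state (d * e) (kron A B)"
proof -
  have Ac: "A \<in> carrier_mat d d" and Bc: "B \<in> carrier_mat e e" using A B by (auto simp: gram_state_def)
  obtain M w where w: "\<And>i j. i < d \<Longrightarrow> j < d \<Longrightarrow> A $$ (i, j) = (\<Sum>m<(M::nat). w m i * cnj (w m j))"
    using A by (auto simp: gram_state_def gram_kernel_def)
  obtain M' w' where w': "\<And>i j. i < e \<Longrightarrow> j < e \<Longrightarrow> B $$ (i, j) = (\<Sum>m<(M'::nat). w' m i * cnj (w' m j))"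
    using B by (auto simp: gram_state_def gram_kernel_def)
  define z where "z m i = w (m div M') (i div e) * w' (m mod M') (i mod e)" for m i
  have "kron A B $$ (i, j) = (\<Sum>m<M * M'. z m i * cnj (z m j))" if ij: "i < d * e" "j < d * e" for i j
  proof -
    note lt = div_mod_less_prod[OF ij(1)] div_mod_less_prod[OF ij(2)]
    have "(\<Sum>m<M * M'. z m i * cnj (z m j)) = (\<Sum>p<M. \<Sum>q<M'. (w p (i div e) * w' q (i mod e)) * cnj (w p (j div e) * w' q (j mod e)))"
      unfolding z_def by (rule sum_lessThan_prod_index)
    also have "\<dots> = kron A B $$ (i, j)"
      unfolding kron_index[OF Ac Bc ij] w[OF lt(1,3)] w'[OF lt(2,4)] sum_product by (simp add: mult_ac)
    finally show ?thesis by simp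
  qed
  hence "gram_kernel (d * e) (\<lambda>i j. kron A B $$ (i, j))" unfolding gram_kernel_def by blast
  moreover have "mat_trace (kron A B) = 1"
  proof -
    have "mat_trace (kron A B) = (\<Sum>i<d * e. A $$ (i div e, i div e) * B $$ (i mod e, i mod e))"
      using kron_carrier[OF Ac Bc] by (auto simp: mat_trace_def kron_index[OF Ac Bc] intro!: sum.cong)
    also have "\<dots> = (\<Sum>p<d. \<Sum>q<e. A $$ (p, p) * B $$ (q, q))" by (rule sum_lessThan_prod_index)
    also have "\<dots> = mat_trace A * mat_trace B" using Ac Bc by (simp add: mat_trace_def sum_product)
    finally show ?thesis using A B by (simp add: gram_state_def)
  qed
  ultimately show ?thesis using kron_carrier[OF Ac Bc] by (simp add: gram_state_def)
qed

lemma gram_state_product_state: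
  assumes "\<forall>i\<in>{1..n}. density_operator 2 (\<sigma> i)"
  shows "gram_state (2 ^ n) (product_state n \<sigma>)"
  using assms
proof (induction n)
  case 0
  have "gram_kernel 1 (\<lambda>i j. (1\<^sub>m 1 :: complex mat) $$ (i, j))"
    unfolding gram_kernel_def by (rule exI[of _ 1], rule exI[of _ "\<lambda>_ _. 1"]) simp
  thus ?case by (simp add: gram_state_def mat_trace_def)
next
  case (Suc n)
  have "gram_state (2 ^ n * 2) (kron (product_state n \<sigma>) (\<sigma> (Suc n)))"
    by (rule gram_state_kron[OF Suc.IH density_operator_gram_state]) (use Suc.prems in auto)
  thus ?case by (simp add: mult.commute)
qed

text \<open>The Kraus form of the kernel shows that conjugation swaps its row and column indices.
  This makes the normal form available for every channel.\<close>

lemma channel_hermiticity_preserving: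
  assumes N: "quantum_channel 2 N"
  shows "hermiticity_preserving N"
  unfolding hermiticity_preserving_def
proof (intro ballI impI)
  fix A :: "complex mat" assume A: "A \<in> carrier_mat 2 2" and h: "mat_adjoint A = A"
  have lin: "linear_supermap 2 N" and cp: "completely_positive 2 N" using N by (auto simp: quantum_channel_def)
  have NA: "N A \<in> carrier_mat 2 2" by (rule quantum_channel_carrier[OF N A])
  have hA: "cnj (A $$ (i, j)) = A $$ (j, i)" if "i < 2" "j < 2" for i j
    using mat_adjoint_index[of j A i] A h that by auto
  obtain M K where K: "\<And>a b i j. a < 2 \<Longrightarrow> b < 2 \<Longrightarrow> i < 2 \<Longrightarrow> j < 2 \<Longrightarrow>
     channel_tensor N a b i j = (\<Sum>m<(M::nat). K m a i * cnj (K m b j))"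
    using channel_tensor_gram[where N = N, OF cp] quantum_channel_carrier[OF N] by blast
  have hN: "cnj (channel_tensor N a b i j) = channel_tensor N b a j i" if "a < 2" "b < 2" "i < 2" "j < 2" for a b i j
    using that by (simp add: K mult.commute)
  have e: "N A $$ (a, b) = (\<Sum>i<2. \<Sum>j<2. A $$ (i, j) * channel_tensor N a b i j)" if "a < 2" "b < 2" for a b
    using linear_supermap_expand2[OF lin A that] by (simp add: channel_tensor_def)
  have hNA: "cnj (N A $$ (a, b)) = N A $$ (b, a)" if "a < 2" "b < 2" for a b
  proof -
    have "cnj (N A $$ (a, b)) = (\<Sum>i<2. \<Sum>j<2. A $$ (j, i) * channel_tensor N b a j i)"
      unfolding e[OF that] cnj_sum using that by (intro sum.cong refl) (simp add: hA hN)
    also have "\<dots> = (\<Sum>j<2. \<Sum>i<2. A $$ (j, i) * channel_tensor N b a j i)" by (rule sum.swap)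
    also have "\<dots> = N A $$ (b, a)" using e[OF that(2,1)] by simp
    finally show ?thesis .
  qed
  show "mat_adjoint (N A) = N A" by (rule eq_matI) (use NA hNA in auto)
qed

section \<open>Purity after a layer of noise\<close>

text \<open>The entries of the tensor power applied to \<open>x y\<^sup>T\<close>. The two vectors
  are independent because splitting off a qubit pairs the slice \<open>k\<close> of \<open>x\<close>
  with the slice \<open>l\<close> of \<open>y\<close>, also for distinct \<open>k\<close> and
  \<open>l\<close>.\<close>

definition rank_one_image :: "(complex mat \<Rightarrow> complex mat) \<Rightarrow> nat \<Rightarrow> (nat \<Rightarrow> complex) \<Rightarrow> (nat \<Rightarrow> complex) \<Rightarrow> nat \<Rightarrow> nat \<Rightarrow> complex" where
  "rank_one_image N n x y a b = (\<Sum>i<2 ^ n. \<Sum>j<2 ^ n. x i * y j * power_tensor N n a b i j)"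

lemma rank_one_image_Suc:
  "rank_one_image N (Suc n) x y a b = (\<Sum>k<2. \<Sum>l<2. channel_tensor N (a mod 2) (b mod 2) k l *
     rank_one_image N n (\<lambda>i. x (i * 2 + k)) (\<lambda>j. y (j * 2 + l)) (a div 2) (b div 2))"
proof -
  define h where "h i k j l = channel_tensor N (a mod 2) (b mod 2) k l *
     (x (i * 2 + k) * y (j * 2 + l) * power_tensor N n (a div 2) (b div 2) i j)" for i k j l
  have "rank_one_image N (Suc n) x y a b = (\<Sum>i<2 ^ n * 2. \<Sum>j<2 ^ n * 2. x i * y j * power_tensor N (Suc n) a b i j)"
    by (simp add: rank_one_image_def mult.commute)
  also have "\<dots> = (\<Sum>i<2 ^ n. \<Sum>k<2. \<Sum>j<2 ^ n. \<Sum>l<2. x (i * 2 + k) * y (j * 2 + l) * power_tensor N (Suc n) a b (i * 2 + k) (j * 2 + l))"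
    by (simp only: sum_lessThan_prod_index')
  also have "\<dots> = (\<Sum>i<2 ^ n. \<Sum>k<2. \<Sum>j<2 ^ n. \<Sum>l<2. h i k j l)"
    by (intro sum.cong refl) (simp add: h_def)
  also have "\<dots> = (\<Sum>k<2. \<Sum>i<2 ^ n. \<Sum>j<2 ^ n. \<Sum>l<2. h i k j l)" by (rule sum.swap)
  also have "\<dots> = (\<Sum>k<2. \<Sum>i<2 ^ n. \<Sum>l<2. \<Sum>j<2 ^ n. h i k j l)" by (intro sum.cong refl sum.swap)
  also have "\<dots> = (\<Sum>k<2. \<Sum>l<2. \<Sum>i<2 ^ n. \<Sum>j<2 ^ n. h i k j l)" by (intro sum.cong refl sum.swap)
  also have "\<dots> = (\<Sum>k<2. \<Sum>l<2. channel_tensor N (a mod 2) (b mod 2) k l *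
     rank_one_image N n (\<lambda>i. x (i * 2 + k)) (\<lambda>j. y (j * 2 + l)) (a div 2) (b div 2))"
    by (simp add: h_def rank_one_image_def sum_distrib_left)
  finally show ?thesis .
qed

lemma cmod_sum_mult_le:
  fixes c y :: "nat \<Rightarrow> nat \<Rightarrow> complex"
  shows "(cmod (\<Sum>k<2. \<Sum>l<2. c k l * y k l))\<^sup>2 \<le> (\<Sum>k<2. \<Sum>l<2. (cmod (c k l))\<^sup>2) * (\<Sum>k<2. \<Sum>l<2. (cmod (y k l))\<^sup>2)"
proof -
  let ?S = "{..<2::nat} \<times> {..<2::nat}"
  have "(cmod (\<Sum>(k, l)\<in>?S. c k l * y k l))\<^sup>2 \<le> (\<Sum>(k, l)\<in>?S. cmod (c k l) * cmod (y k l))\<^sup>2"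
    by (intro power_mono order_trans[OF norm_sum]) (auto simp: norm_mult intro!: sum_mono)
  also have "\<dots> = (\<Sum>s\<in>?S. cmod (c (fst s) (snd s)) * cmod (y (fst s) (snd s)))\<^sup>2"
    by (simp add: case_prod_unfold)
  also have "\<dots> \<le> (\<Sum>s\<in>?S. (cmod (c (fst s) (snd s)))\<^sup>2) * (\<Sum>s\<in>?S. (cmod (y (fst s) (snd s)))\<^sup>2)"
    by (rule Cauchy_Schwarz_ineq_sum)
  finally show ?thesis by (simp add: sum.cartesian_product case_prod_unfold)
qed

lemma cmod_parallelogram: "(cmod u)\<^sup>2 + (cmod v)\<^sup>2 = (cmod (u + v))\<^sup>2 / 2 + (cmod (u - v))\<^sup>2 / 2"
  unfolding cmod_power2 by (simp add: power2_eq_square field_simps)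

text \<open>With \<open>a, b\<close> the squared norms of the two slices of \<open>x\<close> and
  \<open>c, d\<close> those of \<open>y\<close>, this bounds a partial trace without losing a factor
  2. By the arithmetic-geometric mean the cross term is at most \<open>K (a d + b c)\<close>, just
  what completes the product.\<close>

lemma minkowski_product_bound:
  fixes u v :: "'s \<Rightarrow> complex" and a b c d K :: real
  assumes u: "(\<Sum>s\<in>S. (cmod (u s))\<^sup>2) \<le> K * (a * c)" and v: "(\<Sum>s\<in>S. (cmod (v s))\<^sup>2) \<le> K * (b * d)"
    and pos: "0 \<le> K" "0 \<le> a" "0 \<le> b" "0 \<le> c" "0 \<le> d"
  shows "(\<Sum>s\<in>S. (cmod (u s + v s))\<^sup>2) \<le> K * ((a + b) * (c + d))"
proof -
  have "(\<Sum>s\<in>S. (cmod (u s + v s))\<^sup>2) \<le> (\<Sum>s\<in>S. (cmod (u s))\<^sup>2 + (cmod (v s))\<^sup>2 + 2 * (\<bar>cmod (u s)\<bar> * \<bar>cmod (v s)\<bar>))"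
  proof (intro sum_mono)
    fix s
    have "(cmod (u s + v s))\<^sup>2 \<le> (cmod (u s) + cmod (v s))\<^sup>2" by (intro power_mono norm_triangle_ineq) auto
    thus "(cmod (u s + v s))\<^sup>2 \<le> (cmod (u s))\<^sup>2 + (cmod (v s))\<^sup>2 + 2 * (\<bar>cmod (u s)\<bar> * \<bar>cmod (v s)\<bar>)"
      by (simp add: power2_sum)
  qed
  also have "\<dots> = (\<Sum>s\<in>S. (cmod (u s))\<^sup>2) + (\<Sum>s\<in>S. (cmod (v s))\<^sup>2) + 2 * (\<Sum>s\<in>S. \<bar>cmod (u s)\<bar> * \<bar>cmod (v s)\<bar>)"
    by (simp add: sum.distrib sum_distrib_left)
  also have "(\<Sum>s\<in>S. \<bar>cmod (u s)\<bar> * \<bar>cmod (v s)\<bar>) \<le> sqrt (\<Sum>s\<in>S. (cmod (u s))\<^sup>2) * sqrt (\<Sum>s\<in>S. (cmod (v s))\<^sup>2)"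
    using L2_set_mult_ineq[of "\<lambda>s. cmod (u s)" "\<lambda>s. cmod (v s)" S] by (simp add: L2_set_def)
  also have "\<dots> \<le> sqrt (K * (a * c)) * sqrt (K * (b * d))"
    using u v pos by (intro mult_mono) (auto intro!: sum_nonneg)
  also have "\<dots> = sqrt ((K * (a * d)) * (K * (b * c)))" by (simp add: real_sqrt_mult[symmetric] mult_ac)
  also have "\<dots> \<le> (K * (a * d) + K * (b * c)) / 2" using pos by (intro arith_geo_mean_sqrt) auto
  finally have "(\<Sum>s\<in>S. (cmod (u s + v s))\<^sup>2) \<le> K * (a * c) + K * (b * d) + 2 * ((K * (a * d) + K * (b * c)) / 2)"
    using u v by simp
  also have "2 * ((K * (a * d) + K * (b * c)) / 2) = K * (a * d) + K * (b * c)" by simp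
  finally show ?thesis by (simp add: algebra_simps)
qed

text \<open>Trace preservation fixes the sum of the diagonal entries of the image of each matrix
  unit. By the parallelogram law these sums contribute \<open>1/2\<close> for each of the two
  diagonal units, together the subtracted 1.\<close>

lemma supermap_norm2_traceless:
  assumes tr: "\<And>k l. k < 2 \<Longrightarrow> l < 2 \<Longrightarrow> (\<Sum>a<2. channel_tensor N a a k l) = (if k = l then 1 else 0)"
  defines "t \<equiv> channel_tensor N"
  shows "supermap_norm2 N - 1 = (\<Sum>k<2. \<Sum>l<2. (cmod (t 0 0 k l - t 1 1 k l))\<^sup>2) / 2
    + (\<Sum>k<2. \<Sum>l<2. (cmod (t 0 1 k l))\<^sup>2) + (\<Sum>k<2. \<Sum>l<2. (cmod (t 1 0 k l))\<^sup>2)"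
proof -
  have s: "t 0 0 k l + t 1 1 k l = (if k = l then 1 else 0)" if "k < 2" "l < 2" for k l
    using tr[OF that] by (simp add: sum_lessThan_2 t_def)
  have p: "(cmod (t 0 0 k l))\<^sup>2 + (cmod (t 1 1 k l))\<^sup>2 = (if k = l then 1 / 2 else 0) + (cmod (t 0 0 k l - t 1 1 k l))\<^sup>2 / 2"
    if "k < 2" "l < 2" for k l
    using cmod_parallelogram[of "t 0 0 k l" "t 1 1 k l"] s[OF that] by simp
  have "supermap_norm2 N = (\<Sum>k<2. \<Sum>l<2. \<Sum>a<2. \<Sum>b<2. (cmod (t a b k l))\<^sup>2)"
    by (simp add: supermap_norm2_def t_def channel_tensor_def)
  also have "\<dots> = (\<Sum>k<2. \<Sum>l<2. ((cmod (t 0 0 k l))\<^sup>2 + (cmod (t 1 1 k l))\<^sup>2) + (cmod (t 0 1 k l))\<^sup>2 + (cmod (t 1 0 k l))\<^sup>2)"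
    by (intro sum.cong refl) (simp add: sum_lessThan_2)
  also have "\<dots> = (\<Sum>k<2. \<Sum>l<2. ((if k = l then 1 / 2 else 0) + (cmod (t 0 0 k l - t 1 1 k l))\<^sup>2 / 2) + (cmod (t 0 1 k l))\<^sup>2 + (cmod (t 1 0 k l))\<^sup>2)"
    by (intro sum.cong refl) (simp only: p lessThan_iff)
  finally show ?thesis by (simp add: sum_lessThan_2 field_simps)
qed

text \<open>Splitting \<open>N (E\<^bsub>kl\<^esub>)\<close> into its trace part and its traceless part on the last qubit gains the
  factor \<open>1/2 + 3 c\<close> per site.\<close>

lemma rank_one_image_norm:
  assumes tr: "\<And>k l. k < 2 \<Longrightarrow> l < 2 \<Longrightarrow> (\<Sum>a<2. channel_tensor N a a k l) = (if k = l then 1 else 0)"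
  defines "\<kappa> \<equiv> supermap_norm2 N - 1 / 2"
  shows "(\<Sum>a<2 ^ n. \<Sum>b<2 ^ n. (cmod (rank_one_image N n x y a b))\<^sup>2)
    \<le> \<kappa> ^ n * ((\<Sum>i<2 ^ n. (cmod (x i))\<^sup>2) * (\<Sum>j<2 ^ n. (cmod (y j))\<^sup>2))"
proof (induction n arbitrary: x y)
  case 0
  show ?case by (simp add: rank_one_image_def norm_mult power_mult_distrib)
next
  case (Suc n)
  define t where "t = channel_tensor N"
  define G where "G = supermap_norm2 N - 1"
  have G: "G = (\<Sum>k<2. \<Sum>l<2. (cmod (t 0 0 k l - t 1 1 k l))\<^sup>2) / 2
    + (\<Sum>k<2. \<Sum>l<2. (cmod (t 0 1 k l))\<^sup>2) + (\<Sum>k<2. \<Sum>l<2. (cmod (t 1 0 k l))\<^sup>2)"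
    unfolding G_def t_def by (rule supermap_norm2_traceless[OF tr])
  have G0: "0 \<le> G" unfolding G by (intro add_nonneg_nonneg divide_nonneg_nonneg sum_nonneg) auto
  have \<kappa>: "\<kappa> = 1 / 2 + G" by (simp add: \<kappa>_def G_def)
  have K0: "0 \<le> \<kappa> ^ n" using G0 \<kappa> by simp
  define Y where "Y k l p r = rank_one_image N n (\<lambda>i. x (i * 2 + k)) (\<lambda>j. y (j * 2 + l)) p r" for k l p r
  define xs where "xs k = (\<Sum>i<2 ^ n. (cmod (x (i * 2 + k)))\<^sup>2)" for k
  define ys where "ys l = (\<Sum>j<2 ^ n. (cmod (y (j * 2 + l)))\<^sup>2)" for l
  have xs0: "0 \<le> xs k" and ys0: "0 \<le> ys k" for k by (auto simp: xs_def ys_def sum_nonneg)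
  have IH: "(\<Sum>p<2 ^ n. \<Sum>r<2 ^ n. (cmod (Y k l p r))\<^sup>2) \<le> \<kappa> ^ n * (xs k * ys l)" for k l
    unfolding Y_def xs_def ys_def by (rule Suc.IH)
  have split: "(\<Sum>i<2 ^ Suc n. (cmod (z i))\<^sup>2) = (\<Sum>i<2 ^ n. (cmod (z (i * 2 + 0)))\<^sup>2) + (\<Sum>i<2 ^ n. (cmod (z (i * 2 + 1)))\<^sup>2)" for z :: "nat \<Rightarrow> complex"
  proof -
    have "(\<Sum>i<2 ^ Suc n. (cmod (z i))\<^sup>2) = (\<Sum>i<2 ^ n * 2. (cmod (z i))\<^sup>2)" by (simp add: mult.commute)
    also have "\<dots> = (\<Sum>i<2 ^ n. \<Sum>k<2. (cmod (z (i * 2 + k)))\<^sup>2)" by (rule sum_lessThan_prod_index')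
    finally show ?thesis by (simp add: sum_lessThan_2 sum.distrib)
  qed
  \<comment> \<open>On the last qubit, the diagonal sum of the output is the partial trace
    \<open>z 0 0 + z 1 1\<close>. The diagonal difference and the two off-diagonal entries are
    bounded by Cauchy-Schwarz, with total weight \<open>G\<close>.\<close>
  have pt: "(\<Sum>q<2. \<Sum>s<2. (cmod (\<Sum>k<2. \<Sum>l<2. t q s k l * z k l))\<^sup>2)
     \<le> (cmod (z 0 0 + z 1 1))\<^sup>2 / 2 + G * (\<Sum>k<2. \<Sum>l<2. (cmod (z k l))\<^sup>2)" for z
  proof -
    define A where "A q s = (\<Sum>k<2. \<Sum>l<2. t q s k l * z k l)" for q s
    define Z where "Z = (\<Sum>k<2. \<Sum>l<2. (cmod (z k l))\<^sup>2)"
    have s: "t 0 0 k l + t 1 1 k l = (if k = l then 1 else 0)" if "k < 2" "l < 2" for k l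
      using tr[OF that] by (simp add: sum_lessThan_2 t_def)
    have "A 0 0 + A 1 1 = (\<Sum>k<2. \<Sum>l<2. (t 0 0 k l + t 1 1 k l) * z k l)"
      by (simp add: A_def sum.distrib algebra_simps)
    also have "\<dots> = (\<Sum>k<2. \<Sum>l<2. (if k = l then 1 else 0) * z k l)"
      by (intro sum.cong refl) (simp only: s lessThan_iff)
    also have "\<dots> = z 0 0 + z 1 1" by (simp add: sum_lessThan_2)
    finally have add: "A 0 0 + A 1 1 = z 0 0 + z 1 1" .
    have "A 0 0 - A 1 1 = (\<Sum>k<2. \<Sum>l<2. (t 0 0 k l - t 1 1 k l) * z k l)"
      by (simp add: A_def sum_subtractf algebra_simps)
    hence sub: "(cmod (A 0 0 - A 1 1))\<^sup>2 \<le> (\<Sum>k<2. \<Sum>l<2. (cmod (t 0 0 k l - t 1 1 k l))\<^sup>2) * Z"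
      unfolding Z_def by (simp only: cmod_sum_mult_le)
    define S0 S1 S2 where "S0 = (\<Sum>k<2. \<Sum>l<2. (cmod (t 0 0 k l - t 1 1 k l))\<^sup>2)"
      and "S1 = (\<Sum>k<2. \<Sum>l<2. (cmod (t 0 1 k l))\<^sup>2)" and "S2 = (\<Sum>k<2. \<Sum>l<2. (cmod (t 1 0 k l))\<^sup>2)"
    have "(\<Sum>q<2. \<Sum>s<2. (cmod (A q s))\<^sup>2) = ((cmod (A 0 0))\<^sup>2 + (cmod (A 1 1))\<^sup>2) + (cmod (A 0 1))\<^sup>2 + (cmod (A 1 0))\<^sup>2"
      by (simp add: sum_lessThan_2)
    moreover have "(cmod (A 0 0))\<^sup>2 + (cmod (A 1 1))\<^sup>2 = (cmod (z 0 0 + z 1 1))\<^sup>2 / 2 + (cmod (A 0 0 - A 1 1))\<^sup>2 / 2"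
      using cmod_parallelogram[of "A 0 0" "A 1 1"] unfolding add .
    moreover have "(cmod (A 0 0 - A 1 1))\<^sup>2 \<le> S0 * Z" using sub unfolding S0_def .
    moreover have "(cmod (A 0 1))\<^sup>2 \<le> S1 * Z" "(cmod (A 1 0))\<^sup>2 \<le> S2 * Z"
      unfolding A_def Z_def S1_def S2_def by (rule cmod_sum_mult_le)+
    moreover have "G * Z = S0 * Z / 2 + S1 * Z + S2 * Z"
      unfolding G S0_def[symmetric] S1_def[symmetric] S2_def[symmetric] by (simp add: distrib_right)
    ultimately have "(\<Sum>q<2. \<Sum>s<2. (cmod (A q s))\<^sup>2) \<le> (cmod (z 0 0 + z 1 1))\<^sup>2 / 2 + G * Z" by linarith
    thus ?thesis unfolding A_def Z_def .
  qed
  have "(\<Sum>a<2 ^ Suc n. \<Sum>b<2 ^ Suc n. (cmod (rank_one_image N (Suc n) x y a b))\<^sup>2)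
    = (\<Sum>a<2 ^ n * 2. \<Sum>b<2 ^ n * 2. (cmod (\<Sum>k<2. \<Sum>l<2. t (a mod 2) (b mod 2) k l * Y k l (a div 2) (b div 2)))\<^sup>2)"
    unfolding rank_one_image_Suc Y_def t_def by (simp add: mult.commute)
  also have "\<dots> = (\<Sum>p<2 ^ n. \<Sum>q<2. \<Sum>r<2 ^ n. \<Sum>s<2. (cmod (\<Sum>k<2. \<Sum>l<2. t q s k l * Y k l p r))\<^sup>2)"
    unfolding sum_lessThan_prod_index' by (intro sum.cong refl) simp
  also have "\<dots> = (\<Sum>p<2 ^ n. \<Sum>r<2 ^ n. \<Sum>q<2. \<Sum>s<2. (cmod (\<Sum>k<2. \<Sum>l<2. t q s k l * Y k l p r))\<^sup>2)"
    by (intro sum.cong refl sum.swap)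
  also have "\<dots> \<le> (\<Sum>p<2 ^ n. \<Sum>r<2 ^ n. (cmod (Y 0 0 p r + Y 1 1 p r))\<^sup>2 / 2 + G * (\<Sum>k<2. \<Sum>l<2. (cmod (Y k l p r))\<^sup>2))"
    by (intro sum_mono pt)
  also have "\<dots> = (\<Sum>p<2 ^ n. \<Sum>r<2 ^ n. (cmod (Y 0 0 p r + Y 1 1 p r))\<^sup>2) / 2
     + G * (\<Sum>k<2. \<Sum>l<2. \<Sum>p<2 ^ n. \<Sum>r<2 ^ n. (cmod (Y k l p r))\<^sup>2)"
    by (simp add: sum_lessThan_2 sum.distrib sum_divide_distrib[symmetric] sum_distrib_left[symmetric] add_ac)
  \<comment> \<open>The partial trace is bounded by the Minkowski estimate, the other term by
    summing the induction hypothesis over all four slice pairs; both yield the same product, with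
    the factors \<open>1/2\<close> and \<open>G\<close>.\<close>
  also have "\<dots> \<le> (\<kappa> ^ n * ((xs 0 + xs 1) * (ys 0 + ys 1))) / 2 + G * (\<kappa> ^ n * ((xs 0 + xs 1) * (ys 0 + ys 1)))"
  proof (intro add_mono divide_right_mono mult_left_mono G0)
    have "(\<Sum>s\<in>{..<2 ^ n} \<times> {..<2 ^ n}. (cmod (Y 0 0 (fst s) (snd s) + Y 1 1 (fst s) (snd s)))\<^sup>2) \<le> \<kappa> ^ n * ((xs 0 + xs 1) * (ys 0 + ys 1))"
      using IH by (intro minkowski_product_bound K0 xs0 ys0) (simp_all add: sum.cartesian_product case_prod_unfold)
    thus "(\<Sum>p<2 ^ n. \<Sum>r<2 ^ n. (cmod (Y 0 0 p r + Y 1 1 p r))\<^sup>2) \<le> \<kappa> ^ n * ((xs 0 + xs 1) * (ys 0 + ys 1))"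
      by (simp add: sum.cartesian_product case_prod_unfold)
    have "(\<Sum>k<2. \<Sum>l<2. \<Sum>p<2 ^ n. \<Sum>r<2 ^ n. (cmod (Y k l p r))\<^sup>2) \<le> (\<Sum>k<2. \<Sum>l<2. \<kappa> ^ n * (xs k * ys l))"
      by (intro sum_mono IH)
    also have "\<dots> = \<kappa> ^ n * ((xs 0 + xs 1) * (ys 0 + ys 1))" by (simp add: sum_lessThan_2 algebra_simps)
    finally show "(\<Sum>k<2. \<Sum>l<2. \<Sum>p<2 ^ n. \<Sum>r<2 ^ n. (cmod (Y k l p r))\<^sup>2) \<le> \<kappa> ^ n * ((xs 0 + xs 1) * (ys 0 + ys 1))" .
  qed auto
  also have "\<dots> = \<kappa> ^ Suc n * ((xs 0 + xs 1) * (ys 0 + ys 1))" by (simp add: \<kappa> algebra_simps)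
  finally show ?case unfolding split[of x] split[of y] by (simp add: xs_def ys_def)
qed

lemma L2_set_cmod_sum_le:
  fixes f :: "nat \<Rightarrow> 's \<Rightarrow> complex"
  shows "L2_set (\<lambda>s. cmod (\<Sum>m<M. f m s)) S \<le> (\<Sum>m<M. L2_set (\<lambda>s. cmod (f m s)) S)"
proof (induction M)
  case 0
  show ?case by (simp add: L2_set_def)
next
  case (Suc M)
  have "L2_set (\<lambda>s. cmod (\<Sum>m<Suc M. f m s)) S \<le> L2_set (\<lambda>s. cmod (\<Sum>m<M. f m s) + cmod (f M s)) S"
    by (intro L2_set_mono) (auto simp: norm_triangle_ineq)
  also have "\<dots> \<le> L2_set (\<lambda>s. cmod (\<Sum>m<M. f m s)) S + L2_set (\<lambda>s. cmod (f M s)) S"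
    by (rule L2_set_triangle_ineq)
  finally show ?case using Suc.IH by simp
qed

text \<open>The triangle inequality for the Hilbert-Schmidt norm over the Gram vectors: each
  contributes at most \<open>sqrt (\<kappa> ^ n)\<close> times its squared length, and the squared
  lengths add up to the trace 1.\<close>

lemma channel_power_purity:
  assumes N: "quantum_channel 2 N" and X: "gram_state (2 ^ n) X"
  shows "(\<Sum>a<2 ^ n. \<Sum>b<2 ^ n. (cmod (channel_power N n X $$ (a, b)))\<^sup>2) \<le> (supermap_norm2 N - 1 / 2) ^ n"
proof -
  define \<kappa> where "\<kappa> = supermap_norm2 N - 1 / 2"
  let ?S = "{..<2 ^ n} \<times> {..<(2::nat) ^ n}"
  have Xc: "X \<in> carrier_mat (2 ^ n) (2 ^ n)" using X by (simp add: gram_state_def)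
  obtain M w where w: "\<And>i j. i < 2 ^ n \<Longrightarrow> j < 2 ^ n \<Longrightarrow> X $$ (i, j) = (\<Sum>m<(M::nat). w m i * cnj (w m j))"
    using X by (auto simp: gram_state_def gram_kernel_def)
  define p where "p m = (\<Sum>i<2 ^ n. (cmod (w m i))\<^sup>2)" for m
  have p0: "0 \<le> p m" for m by (simp add: p_def sum_nonneg)
  have tr: "(\<Sum>a<2. channel_tensor N a a k l) = (if k = l then 1 else 0)" if "k < 2" "l < 2" for k l
    by (rule channel_tensor_trace[OF N that])
  have "supermap_norm2 N - 1 \<ge> 0"
    by (subst supermap_norm2_traceless[OF tr], assumption+) (intro add_nonneg_nonneg divide_nonneg_nonneg sum_nonneg; simp)
  hence \<kappa>0: "0 \<le> \<kappa> ^ n" by (simp add: \<kappa>_def)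
  have "complex_of_real (\<Sum>m<M. p m) = (\<Sum>m<M. \<Sum>i<2 ^ n. w m i * cnj (w m i))"
    unfolding p_def of_real_sum complex_norm_square ..
  also have "\<dots> = (\<Sum>i<2 ^ n. \<Sum>m<M. w m i * cnj (w m i))" by (rule sum.swap)
  also have "\<dots> = mat_trace X" using Xc by (simp add: mat_trace_def w)
  finally have p1: "(\<Sum>m<M. p m) = 1" using X by (simp add: gram_state_def flip: of_real_sum)
  define f where "f m s = rank_one_image N n (w m) (\<lambda>j. cnj (w m j)) (fst s) (snd s)" for m s
  have P: "channel_power N n X $$ (a, b) = (\<Sum>m<M. f m (a, b))" if ab: "a < 2 ^ n" "b < 2 ^ n" for a b
  proof -
    have "channel_power N n X $$ (a, b) = (\<Sum>i<2 ^ n. \<Sum>j<2 ^ n. X $$ (i, j) * power_tensor N n a b i j)"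
      using channel_power_index[where N = N and X = X and n = n] quantum_channel_carrier[OF N] Xc ab by blast
    also have "\<dots> = (\<Sum>i<2 ^ n. \<Sum>j<2 ^ n. \<Sum>m<M. w m i * cnj (w m j) * power_tensor N n a b i j)"
      by (intro sum.cong refl) (simp add: w sum_distrib_right)
    also have "\<dots> = (\<Sum>i<2 ^ n. \<Sum>m<M. \<Sum>j<2 ^ n. w m i * cnj (w m j) * power_tensor N n a b i j)"
      by (intro sum.cong refl sum.swap)
    also have "\<dots> = (\<Sum>m<M. \<Sum>i<2 ^ n. \<Sum>j<2 ^ n. w m i * cnj (w m j) * power_tensor N n a b i j)" by (rule sum.swap)
    finally show ?thesis by (simp add: f_def rank_one_image_def)
  qed
  have Lf: "L2_set (\<lambda>s. cmod (f m s)) ?S \<le> sqrt (\<kappa> ^ n) * p m" for m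
  proof -
    have "(\<Sum>s\<in>?S. (cmod (f m s))\<^sup>2) \<le> \<kappa> ^ n * (p m * p m)"
      using rank_one_image_norm[where N = N and n = n and x = "w m" and y = "\<lambda>j. cnj (w m j)", OF tr]
      by (simp add: f_def p_def \<kappa>_def sum.cartesian_product case_prod_unfold)
    hence "L2_set (\<lambda>s. cmod (f m s)) ?S \<le> sqrt (\<kappa> ^ n * (p m * p m))"
      unfolding L2_set_def by (rule real_sqrt_le_mono)
    also have "\<dots> = sqrt (\<kappa> ^ n) * p m" using p0[of m] by (simp add: real_sqrt_mult)
    finally show ?thesis .
  qed
  have "L2_set (\<lambda>s. cmod (\<Sum>m<M. f m s)) ?S \<le> (\<Sum>m<M. L2_set (\<lambda>s. cmod (f m s)) ?S)"
    by (rule L2_set_cmod_sum_le)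
  also have "\<dots> \<le> (\<Sum>m<M. sqrt (\<kappa> ^ n) * p m)" by (intro sum_mono Lf)
  also have "\<dots> = sqrt (\<kappa> ^ n)" by (simp add: sum_distrib_left[symmetric] p1)
  finally have "(\<Sum>s\<in>?S. (cmod (\<Sum>m<M. f m s))\<^sup>2) \<le> \<kappa> ^ n" by (simp add: L2_set_def)
  moreover have "(\<Sum>s\<in>?S. (cmod (\<Sum>m<M. f m s))\<^sup>2) = (\<Sum>a<2 ^ n. \<Sum>b<2 ^ n. (cmod (channel_power N n X $$ (a, b)))\<^sup>2)"
    unfolding sum.cartesian_product by (intro sum.cong refl) (auto simp: P)
  ultimately show ?thesis by (simp add: \<kappa>_def)
qed

section \<open>Entropy bound\<close>

text \<open>The row and column indices of \<open>A\<close> form the new row, those of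
  \<open>B\<close> the new column. This turns Kronecker products into rank-one matrices while
  preserving all entries.\<close>

definition realign :: "nat \<Rightarrow> complex mat \<Rightarrow> nat \<times> nat \<Rightarrow> nat \<times> nat \<Rightarrow> complex" where
  "realign dB \<rho> p q = \<rho> $$ (fst p * dB + fst q, snd p * dB + snd q)"

abbreviation square :: "nat \<Rightarrow> (nat \<times> nat) set" where "square d \<equiv> {..<d} \<times> {..<d}"

lemma mat_trace_adjoint_mult:
  assumes "A \<in> carrier_mat d d" "B \<in> carrier_mat d d"
  shows "mat_trace (mat_adjoint A * B) = ip (square d) (\<lambda>p. A $$ p) (\<lambda>p. B $$ p)"
proof -
  have "mat_trace (mat_adjoint A * B) = (\<Sum>i<d. \<Sum>k<d. cnj (A $$ (k, i)) * B $$ (k, i))"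
    using assms by (simp add: mat_trace_def scalar_prod_def atLeast0LessThan)
  also have "\<dots> = (\<Sum>k<d. \<Sum>i<d. cnj (A $$ (k, i)) * B $$ (k, i))" by (rule sum.swap)
  finally show ?thesis by (simp add: ip_def sum.cartesian_product case_prod_unfold)
qed

lemma hs_orthonormal_iff:
  "hs_orthonormal d r L \<longleftrightarrow> (\<forall>a<r. L a \<in> carrier_mat d d) \<and> ortho_family (square d) r (\<lambda>a p. L a $$ p)"
proof (cases "\<forall>a<r. L a \<in> carrier_mat d d")
  case True
  hence tr: "mat_trace (mat_adjoint (L a) * L b) = ip (square d) (\<lambda>p. L a $$ p) (\<lambda>p. L b $$ p)" if "a < r" "b < r" for a b
    using that by (intro mat_trace_adjoint_mult) auto
  show ?thesis unfolding hs_orthonormal_def ortho_family_def by (simp add: tr cong: imp_cong)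
qed (auto simp: hs_orthonormal_def)

lemma operator_schmidt_decomp_realign:
  assumes "operator_schmidt_decomp dA dB \<rho> r lam L R"
  shows "schmidt_decomp (square dA) (square dB) (realign dB \<rho>) r lam (\<lambda>a p. L a $$ p) (\<lambda>a q. R a $$ q)"
proof -
  have pos: "\<forall>a<r. 0 < lam a" and L: "hs_orthonormal dA r L" and R: "hs_orthonormal dB r R"
    and \<rho>: "\<rho> = mat (dA * dB) (dA * dB) (\<lambda>ij. \<Sum>a<r. complex_of_real (lam a) * kron (L a) (R a) $$ ij)"
    using assms by (auto simp: operator_schmidt_decomp_def)
  have "realign dB \<rho> p q = (\<Sum>a<r. complex_of_real (lam a) * L a $$ p * R a $$ q)"
    if pq: "p \<in> square dA" "q \<in> square dB" for p q
  proof -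
    have lt: "fst p * dB + fst q < dA * dB" "snd p * dB + snd q < dA * dB" using pq by (auto intro!: prod_index_less)
    have "realign dB \<rho> p q = (\<Sum>a<r. complex_of_real (lam a) * kron (L a) (R a) $$ (fst p * dB + fst q, snd p * dB + snd q))"
      unfolding realign_def using lt by (subst \<rho>) simp
    also have "\<dots> = (\<Sum>a<r. complex_of_real (lam a) * L a $$ p * R a $$ q)"
    proof (intro sum.cong refl)
      fix a assume "a \<in> {..<r}"
      hence "L a \<in> carrier_mat dA dA" "R a \<in> carrier_mat dB dB" using L R by (auto simp: hs_orthonormal_def)
      thus "complex_of_real (lam a) * kron (L a) (R a) $$ (fst p * dB + fst q, snd p * dB + snd q) = complex_of_real (lam a) * L a $$ p * R a $$ q"
        using lt pq by (auto simp: kron_index)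
    qed
    finally show ?thesis .
  qed
  thus ?thesis using pos L R by (auto simp: schmidt_decomp_def hs_orthonormal_iff)
qed

lemma operator_schmidt_decompI:
  assumes \<rho>: "\<rho> \<in> carrier_mat (dA * dB) (dA * dB)"
    and sd: "schmidt_decomp (square dA) (square dB) (realign dB \<rho>) r lam u v"
  shows "operator_schmidt_decomp dA dB \<rho> r lam (\<lambda>a. mat dA dA (u a)) (\<lambda>a. mat dB dB (v a))"
proof -
  have ou: "ortho_family (square dA) r u" and ov: "ortho_family (square dB) r v" and pos: "\<forall>a<r. 0 < lam a"
    and e: "\<And>p q. p \<in> square dA \<Longrightarrow> q \<in> square dB \<Longrightarrow> realign dB \<rho> p q = (\<Sum>a<r. complex_of_real (lam a) * u a p * v a q)"
    using sd by (auto simp: schmidt_decomp_def)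
  have ip: "ip (square d) (\<lambda>p. mat d d f $$ p) (\<lambda>p. mat d d g $$ p) = ip (square d) f g" for d f g
    unfolding ip_def by (intro sum.cong refl) auto
  have "hs_orthonormal dA r (\<lambda>a. mat dA dA (u a))" "hs_orthonormal dB r (\<lambda>a. mat dB dB (v a))"
    using ou ov by (auto simp: hs_orthonormal_iff ortho_family_def ip)
  moreover have "\<rho> = mat (dA * dB) (dA * dB) (\<lambda>ij. \<Sum>a<r. complex_of_real (lam a) * kron (mat dA dA (u a)) (mat dB dB (v a)) $$ ij)"
  proof (rule eq_matI)
    fix i j assume "i < dim_row (mat (dA * dB) (dA * dB) (\<lambda>ij. \<Sum>a<r. complex_of_real (lam a) * kron (mat dA dA (u a)) (mat dB dB (v a)) $$ ij))"
      "j < dim_col (mat (dA * dB) (dA * dB) (\<lambda>ij. \<Sum>a<r. complex_of_real (lam a) * kron (mat dA dA (u a)) (mat dB dB (v a)) $$ ij))"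
    hence ij: "i < dA * dB" "j < dA * dB" by auto
    note lt = div_mod_less_prod[OF ij(1)] div_mod_less_prod[OF ij(2)]
    have "\<rho> $$ (i, j) = realign dB \<rho> (i div dB, j div dB) (i mod dB, j mod dB)" by (simp add: realign_def)
    also have "\<dots> = (\<Sum>a<r. complex_of_real (lam a) * u a (i div dB, j div dB) * v a (i mod dB, j mod dB))"
      using lt by (intro e) auto
    also have "\<dots> = (\<Sum>a<r. complex_of_real (lam a) * kron (mat dA dA (u a)) (mat dB dB (v a)) $$ (i, j))"
      by (intro sum.cong refl) (use lt ij in \<open>simp add: kron_index[of _ dA dA _ dB dB]\<close>)
    finally show "\<rho> $$ (i, j) = mat (dA * dB) (dA * dB) (\<lambda>ij. \<Sum>a<r. complex_of_real (lam a) * kron (mat dA dA (u a)) (mat dB dB (v a)) $$ ij) $$ (i, j)"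
      using ij by simp
  qed (use \<rho> in auto)
  ultimately show ?thesis using pos by (simp add: operator_schmidt_decomp_def)
qed

text \<open>Any one decomposition may be used to compute the entropy, since all of them give the
  same spectral sum.\<close>

lemma operator_entanglement_entropy_eq:
  assumes \<rho>: "\<rho> \<in> carrier_mat (dA * dB) (dA * dB)"
    and sd: "schmidt_decomp (square dA) (square dB) (realign dB \<rho>) r lam u v"
  shows "operator_entanglement_entropy dA dB \<rho> = - (\<Sum>a<r. (lam a)\<^sup>2 * log 2 ((lam a)\<^sup>2))"
  unfolding operator_entanglement_entropy_def
proof (rule the_equality)
  show "\<exists>r' lam' L R. operator_schmidt_decomp dA dB \<rho> r' lam' L R \<and>
    - (\<Sum>a<r. (lam a)\<^sup>2 * log 2 ((lam a)\<^sup>2)) = - (\<Sum>a<r'. (lam' a)\<^sup>2 * log 2 ((lam' a)\<^sup>2))"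
    using operator_schmidt_decompI[OF assms] by blast
  fix s assume "\<exists>r lam L R. operator_schmidt_decomp dA dB \<rho> r lam L R \<and> s = - (\<Sum>a<r. (lam a)\<^sup>2 * log 2 ((lam a)\<^sup>2))"
  then obtain r' lam' L R where d: "operator_schmidt_decomp dA dB \<rho> r' lam' L R"
    and s: "s = - (\<Sum>a<r'. (lam' a)\<^sup>2 * log 2 ((lam' a)\<^sup>2))" by blast
  show "s = - (\<Sum>a<r. (lam a)\<^sup>2 * log 2 ((lam a)\<^sup>2))"
    unfolding s using schmidt_spectral_sum_unique[OF operator_schmidt_decomp_realign[OF d] sd, of "\<lambda>x. x\<^sup>2 * log 2 (x\<^sup>2)"] by simp
qed

lemma operator_entanglement_entropy_le_purity:
  assumes \<rho>: "\<rho> \<in> carrier_mat (dA * dB) (dA * dB)" and m: "dB * dB \<le> 4 ^ m"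
  shows "operator_entanglement_entropy dA dB \<rho> \<le> 2 * real m * (\<Sum>i<dA * dB. \<Sum>j<dA * dB. (cmod (\<rho> $$ (i, j)))\<^sup>2) + 2"
proof -
  obtain r lam u v where sd: "schmidt_decomp (square dA) (square dB) (realign dB \<rho>) r lam u v"
    using schmidt_decomp_exists[of "square dA" "square dB"] by blast
  \<comment> \<open>The rank is bounded through the right family, which lives in dimension
    \<open>dB\<^sup>2\<close>.\<close>
  have "r \<le> card (square dB)" using sd by (intro ortho_family_le_card[of _ _ v]) (auto simp: schmidt_decomp_def)
  hence r: "r \<le> 4 ^ m" using m by (simp add: card_cartesian_product)
  have sq: "sum h (square d) = (\<Sum>i<d. \<Sum>k<d. h (i, k))" for h :: "nat \<times> nat \<Rightarrow> real" and d
    by (simp add: sum.cartesian_product case_prod_unfold)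
  have "(\<Sum>a<r. (lam a)\<^sup>2) = (\<Sum>p\<in>square dA. \<Sum>q\<in>square dB. (cmod (realign dB \<rho> p q))\<^sup>2)"
    by (rule schmidt_square_sum[OF sd])
  also have "\<dots> = (\<Sum>i<dA. \<Sum>k<dA. \<Sum>j<dB. \<Sum>l<dB. (cmod (\<rho> $$ (i * dB + j, k * dB + l)))\<^sup>2)"
    by (simp only: sq realign_def fst_conv snd_conv)
  also have "\<dots> = (\<Sum>i<dA. \<Sum>j<dB. \<Sum>k<dA. \<Sum>l<dB. (cmod (\<rho> $$ (i * dB + j, k * dB + l)))\<^sup>2)"
    by (intro sum.cong refl sum.swap)
  also have "\<dots> = (\<Sum>i<dA * dB. \<Sum>j<dA * dB. (cmod (\<rho> $$ (i, j)))\<^sup>2)"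
    by (simp only: sum_lessThan_prod_index')
  finally have pur: "(\<Sum>a<r. (lam a)\<^sup>2) = (\<Sum>i<dA * dB. \<Sum>j<dA * dB. (cmod (\<rho> $$ (i, j)))\<^sup>2)" .
  show ?thesis unfolding operator_entanglement_entropy_eq[OF \<rho> sd] pur[symmetric]
    by (rule entropy_le_of_square_sum[OF _ r]) (use sd in \<open>auto simp: schmidt_decomp_def\<close>)
qed

text \<open>At most one Schmidt term. Its squared coefficient is the purity and may be below 1, so
  its contribution need not vanish.\<close>

lemma operator_entanglement_entropy_product:
  assumes \<rho>: "\<rho> \<in> carrier_mat (dA * dB) (dA * dB)"
    and prod: "\<And>i j k l. i < dA \<Longrightarrow> k < dA \<Longrightarrow> j < dB \<Longrightarrow> l < dB \<Longrightarrow>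
      \<rho> $$ (i * dB + j, k * dB + l) = A (i, k) * B (j, l)"
  shows "operator_entanglement_entropy dA dB \<rho> \<le> 2"
proof -
  define x where "x = (\<Sum>p\<in>square dA. (cmod (A p))\<^sup>2)"
  define y where "y = (\<Sum>q\<in>square dB. (cmod (B q))\<^sup>2)"
  have xy: "0 \<le> x" "0 \<le> y" by (simp_all add: x_def y_def sum_nonneg)
  have e: "realign dB \<rho> p q = A p * B q" if "p \<in> square dA" "q \<in> square dB" for p q
    using prod[of "fst p" "snd p" "fst q" "snd q"] that by (auto simp: realign_def)
  show ?thesis
  proof (cases "x = 0 \<or> y = 0")
    \<comment> \<open>The operator is zero and its decomposition is the empty one.\<close>
    case True
    hence "(\<forall>p\<in>square dA. A p = 0) \<or> (\<forall>q\<in>square dB. B q = 0)"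
      by (auto simp: x_def y_def sum_nonneg_eq_0_iff)
    hence "schmidt_decomp (square dA) (square dB) (realign dB \<rho>) 0 (\<lambda>_. 1) (\<lambda>_ _. 0) (\<lambda>_ _. 0)"
      using e by (auto simp: schmidt_decomp_def ortho_family_def)
    from operator_entanglement_entropy_eq[OF \<rho> this] show ?thesis by simp
  next
    case False
    with xy have pos: "0 < x" "0 < y" by auto
    have nrm: "ip S (\<lambda>p. f p / complex_of_real (sqrt z)) (\<lambda>p. f p / complex_of_real (sqrt z)) = 1"
      if z: "z = (\<Sum>p\<in>S. (cmod (f p))\<^sup>2)" "0 < z" for S :: "(nat \<times> nat) set" and f z
    proof -
      have "(\<Sum>p\<in>S. (cmod (f p / complex_of_real (sqrt z)))\<^sup>2) = (\<Sum>p\<in>S. (cmod (f p))\<^sup>2 / z)"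
        using z(2) by (intro sum.cong refl) (simp add: norm_divide power_divide)
      also have "\<dots> = 1" using z by (simp add: sum_divide_distrib[symmetric])
      finally show ?thesis by (simp add: ip_self)
    qed
    let ?lam = "\<lambda>_::nat. sqrt x * sqrt y"
    have sd: "schmidt_decomp (square dA) (square dB) (realign dB \<rho>) 1 ?lam
       (\<lambda>_ p. A p / complex_of_real (sqrt x)) (\<lambda>_ q. B q / complex_of_real (sqrt y))"
      using pos nrm[OF x_def pos(1)] nrm[OF y_def pos(2)] by (auto simp: schmidt_decomp_def ortho_family_def e)
    \<comment> \<open>One coefficient fits \<open>r \<le> 4 ^ 0\<close>, and at \<open>m = 0\<close>
      the purity term of the bound disappears.\<close>
    show ?thesis unfolding operator_entanglement_entropy_eq[OF \<rho> sd]
      using entropy_le_of_square_sum[of 1 ?lam 0] pos by simp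
  qed
qed

text \<open>The function \<open>B\<close> stands for the product of the right-hand qubits. It is
  left existential because their numbering starts at \<open>k + 1\<close>, so it is no instance of
  \<open>product_state\<close> with the same family.\<close>

lemma product_state_split:
  assumes "\<And>i. 1 \<le> i \<Longrightarrow> i \<le> k + m \<Longrightarrow> \<sigma> i \<in> carrier_mat 2 2"
  shows "\<exists>B. \<forall>i<2 ^ k. \<forall>i'<2 ^ k. \<forall>j<2 ^ m. \<forall>j'<2 ^ m.
    product_state (k + m) \<sigma> $$ (i * 2 ^ m + j, i' * 2 ^ m + j') = product_state k \<sigma> $$ (i, i') * B (j, j')"
  using assms
proof (induction m)
  case 0
  show ?case by (rule exI[of _ "\<lambda>_. 1"]) simp
next
  case (Suc m)
  have car: "product_state q \<sigma> \<in> carrier_mat (2 ^ q) (2 ^ q)" if "q \<le> k + m" for q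
    using that
  proof (induction q)
    case (Suc q)
    hence "product_state q \<sigma> \<in> carrier_mat (2 ^ q) (2 ^ q)" "\<sigma> (Suc q) \<in> carrier_mat 2 2" using Suc.prems Suc.IH assms Suc_leD
      by (auto intro!: \<open>\<And>i. 1 \<le> i \<Longrightarrow> i \<le> k + Suc m \<Longrightarrow> \<sigma> i \<in> carrier_mat 2 2\<close>)
    from kron_carrier[OF this] show ?case by (simp add: mult.commute)
  qed simp
  from Suc obtain B where B: "\<And>i i' j j'. i < 2 ^ k \<Longrightarrow> i' < 2 ^ k \<Longrightarrow> j < 2 ^ m \<Longrightarrow> j' < 2 ^ m \<Longrightarrow>
    product_state (k + m) \<sigma> $$ (i * 2 ^ m + j, i' * 2 ^ m + j') = product_state k \<sigma> $$ (i, i') * B (j, j')"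
    by force
  have s2: "\<sigma> (Suc (k + m)) \<in> carrier_mat 2 2" using Suc.prems by simp
  define B' where "B' p = B (fst p div 2, snd p div 2) * \<sigma> (Suc (k + m)) $$ (fst p mod 2, snd p mod 2)" for p
  have "product_state (k + Suc m) \<sigma> $$ (i * 2 ^ Suc m + j, i' * 2 ^ Suc m + j') = product_state k \<sigma> $$ (i, i') * B' (j, j')"
    if "i < 2 ^ k" "i' < 2 ^ k" "j < 2 ^ Suc m" "j' < 2 ^ Suc m" for i i' j j'
  proof -
    have lt: "i * 2 ^ Suc m + j < 2 ^ (k + m) * 2" if "i < 2 ^ k" "j < 2 ^ Suc m" for i j :: nat
      using prod_index_less[OF that] by (simp add: power_add mult_ac)
    have dv: "(i * 2 ^ Suc m + j) div 2 = i * 2 ^ m + j div 2" "(i * 2 ^ Suc m + j) mod 2 = j mod 2" for i j :: nat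
    proof -
      have "i * 2 ^ Suc m + j = j + 2 * (i * 2 ^ m)" by simp
      thus "(i * 2 ^ Suc m + j) div 2 = i * 2 ^ m + j div 2" "(i * 2 ^ Suc m + j) mod 2 = j mod 2" by (simp_all only: div_mult_self2 mod_mult_self2)
    qed
    have "product_state (k + Suc m) \<sigma> $$ (i * 2 ^ Suc m + j, i' * 2 ^ Suc m + j')
      = kron (product_state (k + m) \<sigma>) (\<sigma> (Suc (k + m))) $$ (i * 2 ^ Suc m + j, i' * 2 ^ Suc m + j')" by simp
    also have "\<dots> = product_state (k + m) \<sigma> $$ (i * 2 ^ m + j div 2, i' * 2 ^ m + j' div 2) * \<sigma> (Suc (k + m)) $$ (j mod 2, j' mod 2)"
      unfolding kron_index[OF car[OF order_refl] s2 lt[OF that(1,3)] lt[OF that(2,4)]] dv ..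
    also have "product_state (k + m) \<sigma> $$ (i * 2 ^ m + j div 2, i' * 2 ^ m + j' div 2) = product_state k \<sigma> $$ (i, i') * B (j div 2, j' div 2)"
      using that by (intro B) auto
    finally show ?thesis by (simp add: B'_def)
  qed
  thus ?case by blast
qed

section \<open>Constants and the final estimate\<close>

lemma real_mult_power_le_2: "real n * (9 / 16) ^ n \<le> 2"
proof -
  \<comment> \<open>Here \<open>16/9 = 1 + 7/9\<close>, and \<open>9/7\<close> is rounded up to
    2.\<close>
  have "1 + real n * (7 / 9) \<le> (1 + 7 / 9) ^ n" by (rule Bernoulli_inequality) simp
  hence "real n \<le> 2 * (16 / 9) ^ n" by simp
  hence "real n * (9 / 16) ^ n \<le> 2 * (16 / 9) ^ n * (9 / 16) ^ n" by (intro mult_right_mono) auto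
  also have "\<dots> = 2 * ((16 / 9) * (9 / 16)) ^ n" by (simp only: power_mult_distrib mult.assoc)
  finally show ?thesis by simp
qed

lemma circuit_entropy_bounded:
  assumes N: "quantum_channel 2 N" and c: "contraction_coeff N < 1 / 48"
    and g: "\<And>j i. is_unitary 4 (g j i)" and \<sigma>: "\<forall>i\<in>{1..n}. density_operator 2 (\<sigma> i)" and k: "k < n"
  shows "operator_entanglement_entropy (2 ^ k) (2 ^ (n - k)) (circuit_state N n g (product_state n \<sigma>) l) \<le> 6"
proof -
  have n: "(2::nat) ^ k * 2 ^ (n - k) = 2 ^ n" using k by (simp flip: power_add)
  have X: "gram_state (2 ^ n) (product_state n \<sigma>)" by (rule gram_state_product_state[OF \<sigma>])
  show ?thesis
  proof (cases l)
    case 0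
    \<comment> \<open>Before any noise the purity may be 1, and the purity bound would grow linearly
      in \<open>n\<close>; the product structure across the cut replaces it.\<close>
    have "\<exists>B. \<forall>i<2 ^ k. \<forall>i'<2 ^ k. \<forall>j<2 ^ (n - k). \<forall>j'<2 ^ (n - k).
      product_state (k + (n - k)) \<sigma> $$ (i * 2 ^ (n - k) + j, i' * 2 ^ (n - k) + j') = product_state k \<sigma> $$ (i, i') * B (j, j')"
      by (rule product_state_split) (use \<sigma> k in \<open>auto simp: density_operator_def pos_semidef_def\<close>)
    hence "\<exists>B. \<forall>i<2 ^ k. \<forall>i'<2 ^ k. \<forall>j<2 ^ (n - k). \<forall>j'<2 ^ (n - k).
      product_state n \<sigma> $$ (i * 2 ^ (n - k) + j, i' * 2 ^ (n - k) + j') = product_state k \<sigma> $$ (i, i') * B (j, j')"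
      unfolding le_add_diff_inverse[OF less_imp_le[OF k]] .
    then obtain B where B: "\<And>i i' j j'. i < 2 ^ k \<Longrightarrow> i' < 2 ^ k \<Longrightarrow> j < 2 ^ (n - k) \<Longrightarrow> j' < 2 ^ (n - k) \<Longrightarrow>
      product_state n \<sigma> $$ (i * 2 ^ (n - k) + j, i' * 2 ^ (n - k) + j') = product_state k \<sigma> $$ (i, i') * B (j, j')"
      by blast
    have "operator_entanglement_entropy (2 ^ k) (2 ^ (n - k)) (product_state n \<sigma>) \<le> 2"
      by (rule operator_entanglement_entropy_product[where A = "\<lambda>p. product_state k \<sigma> $$ p" and B = B])
        (use X B in \<open>auto simp: n gram_state_def\<close>)
    thus ?thesis using 0 by simp
  next
    case (Suc l')
    let ?X = "circuit_state N n g (product_state n \<sigma>) l'"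
    define Y where "Y = layer_unitary n g (Suc l') * ?X * mat_adjoint (layer_unitary n g (Suc l'))"
    have Y: "gram_state (2 ^ n) Y" unfolding Y_def
      by (intro gram_state_unitary_conj gram_state_circuit N g X is_unitary_layer_unitary)
    have \<rho>: "circuit_state N n g (product_state n \<sigma>) l = channel_power N n Y"
      by (simp add: Suc noisy_layer_def Y_def)
    have car: "channel_power N n Y \<in> carrier_mat (2 ^ k * 2 ^ (n - k)) (2 ^ k * 2 ^ (n - k))"
      using gram_state_channel_power[OF N Y] unfolding n by (simp add: gram_state_def)
    have lin: "linear_supermap 2 N" and tr: "\<And>A. A \<in> carrier_mat 2 2 \<Longrightarrow> mat_trace (N A) = mat_trace A"
      using N by (auto simp: quantum_channel_def)
    have "(supermap_norm2 N - 1) / 3 < 1 / 48"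
      using c contraction_coeff_eq[OF lin channel_hermiticity_preserving[OF N] tr] by simp
    \<comment> \<open>From \<open>supermap_norm2 N < 1 + 3/48\<close>, subtracting
      \<open>1/2\<close>.\<close>
    hence F: "supermap_norm2 N - 1 / 2 \<le> 9 / 16" by simp
    have "supermap_norm2 N - 1 \<ge> 0"
      by (subst supermap_norm2_traceless[OF channel_tensor_trace[OF N]], assumption+)
        (intro add_nonneg_nonneg divide_nonneg_nonneg sum_nonneg; simp)
    hence "(supermap_norm2 N - 1 / 2) ^ n \<le> (9 / 16) ^ n" using F by (intro power_mono) auto
    hence pur: "(\<Sum>i<2 ^ n. \<Sum>j<2 ^ n. (cmod (channel_power N n Y $$ (i, j)))\<^sup>2) \<le> (9 / 16) ^ n"
      using channel_power_purity[OF N Y] by linarith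
    have "(2::nat) ^ (n - k) * 2 ^ (n - k) = 4 ^ (n - k)" by (simp flip: power_mult_distrib)
    also have "\<dots> \<le> 4 ^ n" by (intro power_increasing) auto
    finally have "operator_entanglement_entropy (2 ^ k) (2 ^ (n - k)) (channel_power N n Y)
      \<le> 2 * real n * (\<Sum>i<2 ^ n. \<Sum>j<2 ^ n. (cmod (channel_power N n Y $$ (i, j)))\<^sup>2) + 2"
      using operator_entanglement_entropy_le_purity[OF car, of n] unfolding n by simp
    also have "\<dots> \<le> 2 * real n * (9 / 16) ^ n + 2" using pur by (intro add_right_mono mult_left_mono) auto
    \<comment> \<open>Twice the bound 2 on \<open>n (9/16)\<^sup>n\<close>, plus the additive 2 from
      the entropy estimate.\<close>
    also have "\<dots> \<le> 6" using real_mult_power_le_2[of n] by simp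
    finally show ?thesis unfolding \<rho> .
  qed
qed

theorem theorem3:
  fixes N :: "complex mat \<Rightarrow> complex mat"
  assumes "quantum_channel 2 N"
    and "\<exists>!\<omega>. density_operator 2 \<omega> \<and> N \<omega> = \<omega>"
    and "contraction_coeff N < 1 / 48"
  shows "\<exists>C>0. \<forall>n\<ge>2. \<forall>(g :: nat \<Rightarrow> nat \<Rightarrow> complex mat) (\<sigma> :: nat \<Rightarrow> complex mat) (k :: nat) (l :: nat).
    (\<forall>j i. is_unitary 4 (g j i)) \<longrightarrow>
    (\<forall>i\<in>{1..n}. density_operator 2 (\<sigma> i)) \<longrightarrow>
    1 \<le> k \<longrightarrow> k < n \<longrightarrow>
    operator_entanglement_entropy (2 ^ k) (2 ^ (n - k)) (circuit_state N n g (product_state n \<sigma>) l)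
      \<le> C * log 2 (real n)"
proof (intro exI[of _ 6] conjI allI impI)
  fix n :: nat and g :: "nat \<Rightarrow> nat \<Rightarrow> complex mat" and \<sigma> :: "nat \<Rightarrow> complex mat" and k l :: nat
  assume n: "2 \<le> n" and g: "\<forall>j i. is_unitary 4 (g j i)" and \<sigma>: "\<forall>i\<in>{1..n}. density_operator 2 (\<sigma> i)"
    and k: "1 \<le> k" "k < n"
  have "operator_entanglement_entropy (2 ^ k) (2 ^ (n - k)) (circuit_state N n g (product_state n \<sigma>) l) \<le> 6"
    using g by (intro circuit_entropy_bounded[OF assms(1,3) _ \<sigma> k(2)]) auto
  \<comment> \<open>For \<open>n \<ge> 2\<close> the binary logarithm is at least 1, which absorbs
    the uniform bound.\<close>
  also have "6 \<le> 6 * log 2 (real n)" using n by (simp add: le_log_iff)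
  finally show "operator_entanglement_entropy (2 ^ k) (2 ^ (n - k)) (circuit_state N n g (product_state n \<sigma>) l)
      \<le> 6 * log 2 (real n)" .
qed simp

end
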